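(* (1) There are infinitely many $j\in\mathbb{Q}$ such that there exists an elliptic curve $E/\mathbb{Q}$ with $j(E)=j$ that satisfies $E(\mathbb{Q})_{\mathrm{tors}}=\{\mathcal{O}\}$ and $E(\mathbb{Q}_{\infty,3})_{\mathrm{tors}}\simeq\mathbb{Z}/2\mathbb{Z}\oplus\mathbb{Z}/2\mathbb{Z}$. (2) There are infinitely many $j\in\mathbb{Q}$ such that there exists an elliptic curve $E/\mathbb{Q}$ with $j(E)=j$ that satisfies $E(\mathbb{Q})_{\mathrm{tors}}\simeq\mathbb{Z}/3\mathbb{Z}$ and $E(\mathbb{Q}_{\infty,3})_{\mathrm{tors}}\simeq\mathbb{Z}/2\mathbb{Z}\oplus\mathbb{Z}/6\mathbb{Z}$.
   Context: $\mathbb{Q}_{\infty,3}$ denotes the $\mathbb{Z}_3$-extension of $\mathbb{Q}$, i.e. the unique Galois extension of $\mathbb{Q}$ (inside $\overline{\mathbb{Q}}$) with Galois group isomorphic to the additive group $\mathbb{Z}_3$ of $3$-adic integers; it is the fixed field in $\mathbb{Q}(\zeta_{3^\infty})$ of the order-2 subgroup of $\mathrm{Gal}(\mathbb{Q}(\zeta_{3^\infty})/\mathbb{Q})\simeq\mathbb{Z}_3^\times$. For a field $K$, $E(K)_{\mathrm{tors}}$ is the torsion subgroup of $E(K)$, and $\mathcal{O}$ is the identity of $E$. *)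

theory Defs
  imports
    Complex_Main
    "HOL-Algebra.Bij"
    "HOL-Algebra.Elementary_Groups"
    "HOL-Algebra.Generated_Fields"
    "HOL-Algebra.QuotRing"
    "HOL-Algebra.Algebraic_Closure_Type"
begin

section \<open>Weierstrass equations\<close>

text \<open>
  The equation $y^2 + a_1 x y + a_3 y = x^3 + a_2 x^2 + a_4 x + a_6$ over a field.
\<close>

datatype 'a weierstrass =
  Weierstrass (a\<^sub>1: 'a) (a\<^sub>2: 'a) (a\<^sub>3: 'a) (a\<^sub>4: 'a) (a\<^sub>6: 'a)

definition b\<^sub>2 :: "'a::field weierstrass \<Rightarrow> 'a" where
  "b\<^sub>2 E = a\<^sub>1 E ^ 2 + 4 * a\<^sub>2 E"

definition b\<^sub>4 :: "'a::field weierstrass \<Rightarrow> 'a" where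
  "b\<^sub>4 E = 2 * a\<^sub>4 E + a\<^sub>1 E * a\<^sub>3 E"

definition b\<^sub>6 :: "'a::field weierstrass \<Rightarrow> 'a" where
  "b\<^sub>6 E = a\<^sub>3 E ^ 2 + 4 * a\<^sub>6 E"

definition b\<^sub>8 :: "'a::field weierstrass \<Rightarrow> 'a" where
  "b\<^sub>8 E = a\<^sub>1 E ^ 2 * a\<^sub>6 E + 4 * a\<^sub>2 E * a\<^sub>6 E - a\<^sub>1 E * a\<^sub>3 E * a\<^sub>4 E
           + a\<^sub>2 E * a\<^sub>3 E ^ 2 - a\<^sub>4 E ^ 2"

definition c\<^sub>4 :: "'a::field weierstrass \<Rightarrow> 'a" where
  "c\<^sub>4 E = b\<^sub>2 E ^ 2 - 24 * b\<^sub>4 E"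

definition discriminant :: "'a::field weierstrass \<Rightarrow> 'a" where
  "discriminant E = - (b\<^sub>2 E ^ 2 * b\<^sub>8 E) - 8 * b\<^sub>4 E ^ 3 - 27 * b\<^sub>6 E ^ 2
                    + 9 * b\<^sub>2 E * b\<^sub>4 E * b\<^sub>6 E"

definition elliptic_curve :: "'a::field weierstrass \<Rightarrow> bool" where
  "elliptic_curve E \<longleftrightarrow> discriminant E \<noteq> 0"

definition j_invariant :: "'a::field weierstrass \<Rightarrow> 'a" where
  "j_invariant E = c\<^sub>4 E ^ 3 / discriminant E"


section \<open>Points and the group law\<close>

datatype 'a point = Infinity (\<open>\<O>\<close>) | Affine 'a 'a

fun on_curve :: "'a::field weierstrass \<Rightarrow> 'a point \<Rightarrow> bool" where
  "on_curve E \<O> \<longleftrightarrow> True"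
| "on_curve E (Affine x y) \<longleftrightarrow>
     y ^ 2 + a\<^sub>1 E * x * y + a\<^sub>3 E * y = x ^ 3 + a\<^sub>2 E * x ^ 2 + a\<^sub>4 E * x + a\<^sub>6 E"

text \<open>
  The chord-tangent law.  In the first case of the last equation the two points are
  negatives of each other; otherwise \<open>l\<close> is the slope of the chord, or of the tangent if
  the points coincide.
\<close>

fun point_add :: "'a::field weierstrass \<Rightarrow> 'a point \<Rightarrow> 'a point \<Rightarrow> 'a point" where
  "point_add E \<O> Q = Q"
| "point_add E (Affine x\<^sub>1 y\<^sub>1) \<O> = Affine x\<^sub>1 y\<^sub>1"
| "point_add E (Affine x\<^sub>1 y\<^sub>1) (Affine x\<^sub>2 y\<^sub>2) =
     (if x\<^sub>1 = x\<^sub>2 \<and> y\<^sub>1 + y\<^sub>2 + a\<^sub>1 E * x\<^sub>2 + a\<^sub>3 E = 0 then \<O>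
      else
        let l = (if x\<^sub>1 = x\<^sub>2
                 then (3 * x\<^sub>1 ^ 2 + 2 * a\<^sub>2 E * x\<^sub>1 + a\<^sub>4 E - a\<^sub>1 E * y\<^sub>1)
                        / (2 * y\<^sub>1 + a\<^sub>1 E * x\<^sub>1 + a\<^sub>3 E)
                 else (y\<^sub>2 - y\<^sub>1) / (x\<^sub>2 - x\<^sub>1));
            x\<^sub>3 = l ^ 2 + a\<^sub>1 E * l - a\<^sub>2 E - x\<^sub>1 - x\<^sub>2;
            y\<^sub>3 = - (l * (x\<^sub>3 - x\<^sub>1) + y\<^sub>1) - a\<^sub>1 E * x\<^sub>3 - a\<^sub>3 E
        in Affine x\<^sub>3 y\<^sub>3)"

text \<open>
  For a curve \<open>E\<close> over the rationals and a subfield \<open>K\<close> of the complex numbers, the group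
  $E(K)$; in particular $E(\mathbf{Q})$ is the case \<open>K = \<rat>\<close>.
\<close>

definition mordell_weil :: "rat weierstrass \<Rightarrow> complex set \<Rightarrow> complex point monoid" where
  "mordell_weil E K =
     \<lparr>carrier = {P. on_curve (map_weierstrass of_rat E) P \<and> set_point P \<subseteq> K},
      monoid.mult = point_add (map_weierstrass of_rat E),
      monoid.one = \<O>\<rparr>"

definition torsion_points :: "('a, 'b) monoid_scheme \<Rightarrow> 'a set" where
  "torsion_points G = {P \<in> carrier G. \<exists>n::nat. n > 0 \<and> P [^]\<^bsub>G\<^esub> n = \<one>\<^bsub>G\<^esub>}"

definition torsion_group :: "('a, 'b) monoid_scheme \<Rightarrow> ('a, 'b) monoid_scheme" where
  "torsion_group G = G\<lparr>carrier := torsion_points G\<rparr>"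


section \<open>The $\mathbf{Z}_3$-extension of the rationals\<close>

abbreviation complex_ring :: "complex ring" where
  "complex_ring \<equiv> ring_of_type_algebra"

text \<open>The field $\mathbf{Q}(\zeta_{3^\infty})$.\<close>

definition Q_zeta_3_inf :: "complex set" where
  "Q_zeta_3_inf = generate_field complex_ring {z. \<exists>n::nat. z ^ (3 ^ n) = 1}"

text \<open>
  The group of automorphisms of a subfield \<open>L\<close> of the complex numbers fixing \<open>F\<close> pointwise.
  As in \<^const>\<open>BijGroup\<close>, automorphisms are extended by \<open>undefined\<close> outside \<open>L\<close>.
\<close>

definition galois_group :: "complex set \<Rightarrow> complex set \<Rightarrow> (complex \<Rightarrow> complex) monoid" where
  "galois_group L F =
     BijGroup L
       \<lparr>carrier := {\<sigma> \<in> Bij L.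
          \<sigma> \<in> ring_iso (complex_ring\<lparr>carrier := L\<rparr>) (complex_ring\<lparr>carrier := L\<rparr>)
          \<and> (\<forall>x\<in>F. \<sigma> x = x)}\<rparr>"

definition fixed_field :: "complex set \<Rightarrow> (complex \<Rightarrow> complex) set \<Rightarrow> complex set" where
  "fixed_field L H = {x \<in> L. \<forall>\<sigma>\<in>H. \<sigma> x = x}"

abbreviation Gal_zeta :: "(complex \<Rightarrow> complex) monoid" where
  "Gal_zeta \<equiv> galois_group Q_zeta_3_inf \<rat>"

text \<open>The subgroup of order 2 is unique by \<open>ex1_order_2_subgroup\<close> below.\<close>

definition Q_inf_3 :: "complex set" where
  "Q_inf_3 = fixed_field Q_zeta_3_inf (THE H. subgroup H Gal_zeta \<and> card H = 2)"


subsection \<open>Existence and uniqueness of the subgroup of order 2\<close>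

lemma complex_ring_simps [simp]:
  "carrier complex_ring = UNIV" "monoid.mult complex_ring = (*)" "add complex_ring = (+)"
  "\<zero>\<^bsub>complex_ring\<^esub> = 0" "\<one>\<^bsub>complex_ring\<^esub> = 1"
  by (simp_all add: ring_of_type_algebra_def)

lemma field_complex_ring: "field complex_ring" by (rule field_from_type_algebra)

lemma minus_complex_ring: "\<ominus>\<^bsub>complex_ring\<^esub> x = - x"
proof -
  interpret field complex_ring by (rule field_complex_ring)
  have "\<ominus>\<^bsub>complex_ring\<^esub> x \<oplus>\<^bsub>complex_ring\<^esub> x = \<zero>\<^bsub>complex_ring\<^esub>" by (rule l_neg) simp
  thus ?thesis by (simp add: eq_neg_iff_add_eq_0)
qed

lemma inv_complex_ring: assumes "x \<noteq> 0" shows "inv\<^bsub>complex_ring\<^esub> x = inverse x"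
proof -
  interpret field complex_ring by (rule field_complex_ring)
  have "inv\<^bsub>complex_ring\<^esub> x \<otimes>\<^bsub>complex_ring\<^esub> x = \<one>\<^bsub>complex_ring\<^esub>"
    using assms by (intro Units_l_inv) (simp add: field_Units)
  thus ?thesis by (metis complex_ring_simps(2,5) inverse_unique mult.commute)
qed

lemma Q_zeta_closed:
  "1 \<in> Q_zeta_3_inf" "z ^ (3^n) = 1 \<Longrightarrow> z \<in> Q_zeta_3_inf" "x \<in> Q_zeta_3_inf \<Longrightarrow> - x \<in> Q_zeta_3_inf"
  "x \<in> Q_zeta_3_inf \<Longrightarrow> y \<in> Q_zeta_3_inf \<Longrightarrow> x + y \<in> Q_zeta_3_inf" "x \<in> Q_zeta_3_inf \<Longrightarrow> y \<in> Q_zeta_3_inf \<Longrightarrow> x * y \<in> Q_zeta_3_inf"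
  "x \<in> Q_zeta_3_inf \<Longrightarrow> inverse x \<in> Q_zeta_3_inf" "0 \<in> Q_zeta_3_inf"
proof -
  note d = Q_zeta_3_inf_def
  show 1: "1 \<in> Q_zeta_3_inf" using generate_field.one[of complex_ring] unfolding d by simp
  show "z ^ (3^n) = 1 \<Longrightarrow> z \<in> Q_zeta_3_inf" unfolding d by (rule generate_field.incl) auto
  show m: "x \<in> Q_zeta_3_inf \<Longrightarrow> - x \<in> Q_zeta_3_inf" for x unfolding d using generate_field.a_inv minus_complex_ring by metis
  show a: "x \<in> Q_zeta_3_inf \<Longrightarrow> y \<in> Q_zeta_3_inf \<Longrightarrow> x + y \<in> Q_zeta_3_inf" for x y unfolding d using generate_field.eng_add[of _ complex_ring] by simp
  show "x \<in> Q_zeta_3_inf \<Longrightarrow> y \<in> Q_zeta_3_inf \<Longrightarrow> x * y \<in> Q_zeta_3_inf" unfolding d using generate_field.eng_mult[of _ complex_ring] by simp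
  show 0: "0 \<in> Q_zeta_3_inf" using a[OF m[OF 1] 1] by simp
  show "x \<in> Q_zeta_3_inf \<Longrightarrow> inverse x \<in> Q_zeta_3_inf"
    using 0 generate_field.m_inv[of x complex_ring] inv_complex_ring[of x] unfolding d by (cases "x=0") auto
qed

lemma Q_zeta_induct [consumes 1, case_names one root minus inverse add mult]:
  assumes "x \<in> Q_zeta_3_inf" "P 1" "\<And>z n. z ^ (3^n) = 1 \<Longrightarrow> P z" "\<And>x. x \<in> Q_zeta_3_inf \<Longrightarrow> P x \<Longrightarrow> P (-x)"
   "\<And>x. x \<in> Q_zeta_3_inf \<Longrightarrow> P x \<Longrightarrow> x \<noteq> 0 \<Longrightarrow> P (inverse x)"
   "\<And>x y. x \<in> Q_zeta_3_inf \<Longrightarrow> y \<in> Q_zeta_3_inf \<Longrightarrow> P x \<Longrightarrow> P y \<Longrightarrow> P (x + y)"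
   "\<And>x y. x \<in> Q_zeta_3_inf \<Longrightarrow> y \<in> Q_zeta_3_inf \<Longrightarrow> P x \<Longrightarrow> P y \<Longrightarrow> P (x * y)"
  shows "P x"
  using assms(1) unfolding Q_zeta_3_inf_def
proof (induction rule: generate_field.induct)
  case one thus ?case using assms(2) by simp
next case incl thus ?case using assms(3) by auto
next case (a_inv h) thus ?case using assms(4)[of h] by (simp add: minus_complex_ring Q_zeta_3_inf_def)
next case (m_inv h) thus ?case using assms(5)[of h] by (simp add: inv_complex_ring Q_zeta_3_inf_def)
next case (eng_add x y) thus ?case using assms(6)[of x y] by (simp add: Q_zeta_3_inf_def)
next case (eng_mult x y) thus ?case using assms(7)[of x y] by (simp add: Q_zeta_3_inf_def)
qed

lemma cnj_in_Q_zeta: "x \<in> Q_zeta_3_inf \<Longrightarrow> cnj x \<in> Q_zeta_3_inf"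
proof (induction rule: Q_zeta_induct)
  case (root z n)
  have "cnj z ^ (3^n) = 1" using root by (metis complex_cnj_one complex_cnj_power)
  thus ?case by (rule Q_zeta_closed)
qed (auto intro: Q_zeta_closed)

lemma Gal_zeta_iff: "\<sigma> \<in> carrier Gal_zeta \<longleftrightarrow> \<sigma> \<in> extensional Q_zeta_3_inf \<and> bij_betw \<sigma> Q_zeta_3_inf Q_zeta_3_inf \<and>
  (\<forall>x\<in>Q_zeta_3_inf. \<forall>y\<in>Q_zeta_3_inf. \<sigma> (x * y) = \<sigma> x * \<sigma> y \<and> \<sigma> (x + y) = \<sigma> x + \<sigma> y) \<and> \<sigma> 1 = 1 \<and> (\<forall>x\<in>\<rat>. \<sigma> x = x)"
  unfolding galois_group_def ring_iso_def ring_hom_def Bij_def by (auto simp: bij_betw_def)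

lemma Gal_zeta_eqI:
  assumes s: "\<sigma> \<in> carrier Gal_zeta" "\<tau> \<in> carrier Gal_zeta" and r: "\<And>z n. z ^ (3^n) = 1 \<Longrightarrow> \<sigma> z = \<tau> z"
  shows "\<sigma> = \<tau>"
proof (rule extensionalityI[of _ Q_zeta_3_inf])
  have z: "f 0 = 0" if "f \<in> carrier Gal_zeta" for f
    using that Q_zeta_closed(7) unfolding Gal_zeta_iff by (metis add_cancel_right_right)
  have m: "f (-x) = - f x" if "f \<in> carrier Gal_zeta" "x \<in> Q_zeta_3_inf" for f x
    using z[OF that(1)] that Q_zeta_closed(3)[of x] unfolding Gal_zeta_iff by (metis add.right_inverse minus_unique)
  have i: "f (inverse x) = inverse (f x)" if "f \<in> carrier Gal_zeta" "x \<in> Q_zeta_3_inf" "x \<noteq> 0" for f x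
    using that Q_zeta_closed(6)[of x] unfolding Gal_zeta_iff by (metis right_inverse inverse_unique)
  fix x assume "x \<in> Q_zeta_3_inf" thus "\<sigma> x = \<tau> x"
    by (induction rule: Q_zeta_induct) (use s r m[OF s(1)] m[OF s(2)] i[OF s(1)] i[OF s(2)] in \<open>auto simp: Gal_zeta_iff\<close>)
qed (use s in \<open>auto simp: Gal_zeta_iff\<close>)

definition "id_zeta = (\<lambda>x\<in>Q_zeta_3_inf. x)"
definition "cnj_zeta = (\<lambda>x\<in>Q_zeta_3_inf. cnj x)"

lemma Rats_in_Q_zeta: "x \<in> \<rat> \<Longrightarrow> x \<in> Q_zeta_3_inf"
proof -
  have n: "of_nat n \<in> Q_zeta_3_inf" for n by (induction n) (auto intro: Q_zeta_closed)
  have i: "of_int n \<in> Q_zeta_3_inf" for n by (cases n) (auto intro: n Q_zeta_closed simp del: of_nat_Suc)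
  assume "x \<in> \<rat>" then obtain a b where "x = of_int a / of_int b" by (elim Rats_cases') auto
  thus ?thesis by (auto simp: divide_inverse intro: i Q_zeta_closed)
qed

lemma id_zeta_in_Gal: "id_zeta \<in> carrier Gal_zeta" unfolding Gal_zeta_iff id_zeta_def using Rats_in_Q_zeta
  by (auto simp: bij_betw_def inj_on_def Q_zeta_closed)
lemma cnj_zeta_in_Gal: "cnj_zeta \<in> carrier Gal_zeta"
proof -
  have "cnj ` Q_zeta_3_inf = Q_zeta_3_inf" using cnj_in_Q_zeta by (metis complex_cnj_cnj image_subsetI subsetI subset_antisym image_eqI)
  thus ?thesis unfolding Gal_zeta_iff cnj_zeta_def using Rats_in_Q_zeta
  by (auto simp: bij_betw_def inj_on_def Q_zeta_closed elim!: Rats_cases')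
qed

lemma mult_Gal_zeta: "f \<in> carrier Gal_zeta \<Longrightarrow> g \<in> carrier Gal_zeta \<Longrightarrow> f \<otimes>\<^bsub>Gal_zeta\<^esub> g = compose Q_zeta_3_inf f g"
  unfolding galois_group_def BijGroup_def by (auto simp: Bij_def)
lemma one_Gal_zeta: "\<one>\<^bsub>Gal_zeta\<^esub> = id_zeta" unfolding galois_group_def BijGroup_def id_zeta_def by auto

lemma subgroup_Gal_zeta: "subgroup (carrier Gal_zeta) (BijGroup Q_zeta_3_inf)"
proof -
  interpret B: group "BijGroup Q_zeta_3_inf" by (rule group_BijGroup)
  have cl: "bij_betw a Q_zeta_3_inf Q_zeta_3_inf \<Longrightarrow> x \<in> Q_zeta_3_inf \<Longrightarrow> a x \<in> Q_zeta_3_inf" for a x by (auto simp: bij_betw_def)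
  show ?thesis
  proof (rule B.subgroupI)
    show s: "carrier Gal_zeta \<subseteq> carrier (BijGroup Q_zeta_3_inf)" by (auto simp: galois_group_def BijGroup_def)
    show "carrier Gal_zeta \<noteq> {}" using id_zeta_in_Gal by auto
    fix a assume a: "a \<in> carrier Gal_zeta"
    show "a \<otimes>\<^bsub>BijGroup Q_zeta_3_inf\<^esub> b \<in> carrier Gal_zeta" if b: "b \<in> carrier Gal_zeta" for b
    proof -
      have "a \<otimes>\<^bsub>BijGroup Q_zeta_3_inf\<^esub> b = compose Q_zeta_3_inf a b" using a b by (simp add: BijGroup_def Bij_def Gal_zeta_iff)
      moreover have "compose Q_zeta_3_inf a b \<in> carrier Gal_zeta" unfolding Gal_zeta_iff
        using a b Rats_in_Q_zeta bij_betw_compose[of b Q_zeta_3_inf Q_zeta_3_inf a Q_zeta_3_inf] by (auto simp: Gal_zeta_iff compose_eq Q_zeta_closed cl)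
      ultimately show ?thesis by simp
    qed
    have aB: "a \<in> Bij Q_zeta_3_inf" using a by (simp add: Gal_zeta_iff Bij_def)
    have e: "inv\<^bsub>BijGroup Q_zeta_3_inf\<^esub> a = restrict (inv_into Q_zeta_3_inf a) Q_zeta_3_inf"
      using aB by (rule inv_BijGroup)
    let ?i = "inv_into Q_zeta_3_inf a"
    have ii: "?i (a x) = x" "a (?i x) = x" "?i x \<in> Q_zeta_3_inf" if "x \<in> Q_zeta_3_inf" for x
      using a that unfolding Gal_zeta_iff by (auto simp: bij_betw_inv_into_left bij_betw_inv_into_right bij_betw_def inv_into_into)
    show "inv\<^bsub>BijGroup Q_zeta_3_inf\<^esub> a \<in> carrier Gal_zeta" unfolding e Gal_zeta_iff
    proof (intro conjI ballI)
      have "restrict ?i Q_zeta_3_inf \<in> Bij Q_zeta_3_inf" using aB by (rule restrict_inv_into_Bij)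
      thus "bij_betw (restrict ?i Q_zeta_3_inf) Q_zeta_3_inf Q_zeta_3_inf" by (simp add: Bij_def)
      fix x y assume xy: "x \<in> Q_zeta_3_inf" "y \<in> Q_zeta_3_inf"
      have "a (?i x * ?i y) = x * y" "a (?i x + ?i y) = x + y"
        using a ii xy unfolding Gal_zeta_iff by auto
      hence "?i (x * y) = ?i x * ?i y" "?i (x + y) = ?i x + ?i y"
        using ii xy Q_zeta_closed by metis+
      thus "restrict ?i Q_zeta_3_inf (x * y) = restrict ?i Q_zeta_3_inf x * restrict ?i Q_zeta_3_inf y"
        "restrict ?i Q_zeta_3_inf (x + y) = restrict ?i Q_zeta_3_inf x + restrict ?i Q_zeta_3_inf y" using xy Q_zeta_closed by auto
    next
      show "restrict ?i Q_zeta_3_inf 1 = 1" using a ii(1)[OF Q_zeta_closed(1)] Q_zeta_closed(1) by (simp add: Gal_zeta_iff)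
      fix x :: complex assume x: "x \<in> \<rat>"
      show "restrict ?i Q_zeta_3_inf x = x" using a ii(1)[OF Rats_in_Q_zeta[OF x]] Rats_in_Q_zeta[OF x] x by (simp add: Gal_zeta_iff)
    qed auto
  qed
qed

lemma group_Gal_zeta: "group Gal_zeta"
proof -
  have "Gal_zeta = BijGroup Q_zeta_3_inf\<lparr>carrier := carrier Gal_zeta\<rparr>" by (simp add: galois_group_def)
  thus ?thesis using group.subgroup_imp_group[OF group_BijGroup subgroup_Gal_zeta] by metis
qed

lemma Gal_zeta_involution:
  assumes s: "\<sigma> \<in> carrier Gal_zeta" "\<sigma> \<otimes>\<^bsub>Gal_zeta\<^esub> \<sigma> = id_zeta" and ne: "\<sigma> \<noteq> id_zeta" shows "\<sigma> = cnj_zeta"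
proof -
  note m = s(1)[unfolded Gal_zeta_iff]
  have ss: "\<sigma> (\<sigma> x) = x" if "x \<in> Q_zeta_3_inf" for x using s(2) mult_Gal_zeta[OF s(1) s(1)] that
    by (metis compose_eq id_zeta_def restrict_apply')
  have pow: "\<sigma> (x ^ k) = \<sigma> x ^ k" "x ^ k \<in> Q_zeta_3_inf" if "x \<in> Q_zeta_3_inf" for x k
  proof -
    have "\<sigma> (x ^ k) = \<sigma> x ^ k \<and> x ^ k \<in> Q_zeta_3_inf" using that m by (induction k) (auto intro: Q_zeta_closed)
    thus "\<sigma> (x ^ k) = \<sigma> x ^ k" "x ^ k \<in> Q_zeta_3_inf" by auto
  qed
  define w where "w n = cis (2 * pi / 3 ^ n)" for n
  have wk: "w n ^ k = cis (2 * pi * real k / real (3 ^ n))" for n k by (simp add: w_def Complex.DeMoivre mult_ac)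
  have w1: "w n ^ 3 ^ n = 1" for n by (simp add: wk)
  have wp: "w n powi (3 ^ n) = 1" for n using w1[of n] power_int_of_nat[of "w n" "3 ^ n"] by simp
  have wL: "w n \<in> Q_zeta_3_inf" for n using w1 Q_zeta_closed(2) by auto
  have gen: "\<exists>k. z = w n ^ k" if "z ^ 3 ^ n = 1" for z n
    using bij_betw_roots_unity[of "3^n"] that unfolding wk bij_betw_def by auto
  have inj: "3 ^ n dvd (int a - int b)" if "w n ^ a = w n ^ b" for n a b
  proof -
    let ?m = "3 ^ n :: nat"
    have r: "w n ^ c = w n ^ (c mod ?m)" for c
    proof -
      have "w n ^ c = w n ^ (?m * (c div ?m) + c mod ?m)" by simp
      also have "\<dots> = w n ^ (c mod ?m)" unfolding power_add power_mult w1 by simp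
      finally show ?thesis .
    qed
    have "inj_on (\<lambda>k. w n ^ k) {..<?m}"
      using bij_betw_roots_unity[of ?m] unfolding wk bij_betw_def by auto
    moreover have "w n ^ (a mod ?m) = w n ^ (b mod ?m)" using r that by metis
    ultimately have "a mod ?m = b mod ?m" by (auto dest!: inj_onD)
    hence "int a mod int ?m = int b mod int ?m" by (metis zmod_int)
    thus ?thesis by (simp add: mod_eq_dvd_iff)
  qed
  have winv: "cnj (w n) = inverse (w n)" for n by (simp add: w_def cis_cnj)
  have dich: "\<sigma> (w n) = w n \<or> \<sigma> (w n) = cnj (w n)" for n
  proof -
    have "\<sigma> (w n) ^ 3^n = 1" using pow[OF wL, of n "3^n"] w1 m by simp
    then obtain k where k: "\<sigma> (w n) = w n ^ k" using gen by blast
    have "w n ^ 1 = w n ^ (k * k)" using ss[OF wL, of n] k pow[OF wL, of n k] by (simp add: power_mult)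
    from inj[OF this] have d: "3 ^ n dvd (int k - 1) * (int k + 1)" by (simp add: algebra_simps dvd_diff_commute)
    have "3 ^ n dvd int k - 1 \<or> 3 ^ n dvd int k + 1"
    proof (cases "3 dvd int k - 1")
      case True hence "\<not> 3 dvd int k + 1" by presburger
      hence "coprime (3 ^ n) (int k + 1)" by (simp add: prime_imp_coprime)
      thus ?thesis using d coprime_dvd_mult_left_iff by blast
    next
      case False hence "coprime (3 ^ n) (int k - 1)" by (simp add: prime_imp_coprime)
      thus ?thesis using d coprime_dvd_mult_right_iff by blast
    qed
    thus ?thesis
    proof
      assume "3 ^ n dvd int k - 1"
      then obtain t where "int k - 1 = 3 ^ n * t" by auto
      hence "w n powi (int k - 1) = 1" using wp by (simp add: power_int_mult)
      hence "w n ^ k = w n" by (simp add: power_int_diff w_def)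
      thus ?thesis using k by simp
    next
      assume "3 ^ n dvd int k + 1"
      then obtain t where "int k + 1 = 3 ^ n * t" by auto
      hence "w n powi (int k + 1) = 1" using wp by (simp add: power_int_mult)
      hence "w n ^ k * w n = 1" by (simp add: power_int_add w_def)
      hence "w n ^ k = inverse (w n)" by (metis inverse_unique mult.commute)
      thus ?thesis using k winv by simp
    qed
  qed
  have w1n: "w (Suc n) ^ (3 ^ n) = w 1" for n by (simp add: w_def Complex.DeMoivre)
  have w1ne: "w 1 \<noteq> cnj (w 1)"
    by (simp add: w_def complex_eq_iff sin_120)
  show ?thesis
  proof (cases "\<sigma> (w 1) = w 1")
    case True
    have "\<sigma> (w n) = w n" for n
    proof (cases n)
      case 0 thus ?thesis using m by (simp add: w_def)
    next
      case (Suc n')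
      have "\<sigma> (w n) \<noteq> cnj (w n) \<or> \<sigma> (w n) = w n" using pow[OF wL, of n "3^n'"] True w1ne w1n[of n'] Suc
        by (metis complex_cnj_power)
      thus ?thesis using dich by blast
    qed
    hence "\<sigma> z = id_zeta z" if "z ^ 3 ^ n = 1" for z n
      using gen[OF that] pow[OF wL] by (auto simp: id_zeta_def)
    hence "\<sigma> = id_zeta" by (intro Gal_zeta_eqI s id_zeta_in_Gal)
    thus ?thesis using ne by simp
  next
    case False
    have "\<sigma> (w n) = cnj (w n)" for n
    proof (cases n)
      case 0 thus ?thesis using m by (simp add: w_def)
    next
      case (Suc n')
      have "\<sigma> (w n) \<noteq> w n" using pow[OF wL, of n "3^n'"] False w1n[of n'] Suc by metis
      thus ?thesis using dich by blast
    qed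
    hence "\<sigma> z = cnj_zeta z" if "z ^ 3 ^ n = 1" for z n
      using gen[OF that] pow[OF wL] by (auto simp: cnj_zeta_def)
    thus ?thesis by (intro Gal_zeta_eqI s cnj_zeta_in_Gal)
  qed
qed

lemma id_zeta_neq_cnj_zeta: "id_zeta \<noteq> cnj_zeta"
proof
  assume e: "id_zeta = cnj_zeta"
  let ?w = "cis (2 * pi / 3)"
  have "?w ^ 3 ^ 1 = 1" by (simp add: Complex.DeMoivre)
  hence "?w \<in> Q_zeta_3_inf" by (rule Q_zeta_closed)
  hence "?w = cnj ?w" using e by (metis id_zeta_def cnj_zeta_def restrict_apply')
  thus False by (simp add: complex_eq_iff sin_120)
qed

lemma cnj_zeta_mult_self: "cnj_zeta \<otimes>\<^bsub>Gal_zeta\<^esub> cnj_zeta = id_zeta"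
  unfolding mult_Gal_zeta[OF cnj_zeta_in_Gal cnj_zeta_in_Gal] by (auto simp: compose_def cnj_zeta_def id_zeta_def cnj_in_Q_zeta)

lemma order_2_subgroup_iff: "subgroup H Gal_zeta \<and> card H = 2 \<longleftrightarrow> H = {id_zeta, cnj_zeta}"
proof
  interpret group Gal_zeta by (rule group_Gal_zeta)
  assume H: "subgroup H Gal_zeta \<and> card H = 2"
  then obtain \<sigma> where s: "H = {id_zeta, \<sigma>}" "\<sigma> \<noteq> id_zeta"
    using one_Gal_zeta subgroup.one_closed[of H Gal_zeta] by (auto simp: card_2_iff)
  hence sc: "\<sigma> \<in> carrier Gal_zeta" using H subgroup.subset by blast
  have "\<sigma> \<otimes>\<^bsub>Gal_zeta\<^esub> \<sigma> \<in> H" using subgroup.m_closed[of H Gal_zeta \<sigma> \<sigma>] H s by simp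
  moreover have "\<sigma> \<otimes>\<^bsub>Gal_zeta\<^esub> \<sigma> \<noteq> \<sigma>" using s sc one_Gal_zeta l_cancel_one'[of \<sigma> \<sigma>] by auto
  ultimately have "\<sigma> \<otimes>\<^bsub>Gal_zeta\<^esub> \<sigma> = id_zeta" using s by auto
  thus "H = {id_zeta, cnj_zeta}" using Gal_zeta_involution[OF sc] s by auto
next
  interpret group Gal_zeta by (rule group_Gal_zeta)
  assume H: "H = {id_zeta, cnj_zeta}"
  have ic: "inv\<^bsub>Gal_zeta\<^esub> cnj_zeta = cnj_zeta" by (rule inv_equality) (use cnj_zeta_mult_self cnj_zeta_in_Gal one_Gal_zeta in auto)
  have ii: "inv\<^bsub>Gal_zeta\<^esub> id_zeta = id_zeta" using inv_one unfolding one_Gal_zeta .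
  have il: "id_zeta \<otimes>\<^bsub>Gal_zeta\<^esub> x = x" "x \<otimes>\<^bsub>Gal_zeta\<^esub> id_zeta = x" if "x \<in> carrier Gal_zeta" for x using l_one[OF that] r_one[OF that] unfolding one_Gal_zeta .
  have "subgroup H Gal_zeta" unfolding H
  proof (rule subgroupI)
    show "{id_zeta, cnj_zeta} \<subseteq> carrier Gal_zeta" using id_zeta_in_Gal cnj_zeta_in_Gal by blast
    show "{id_zeta, cnj_zeta} \<noteq> {}" by blast
    show "inv\<^bsub>Gal_zeta\<^esub> a \<in> {id_zeta, cnj_zeta}" if "a \<in> {id_zeta, cnj_zeta}" for a using that ic ii by fastforce
    show "a \<otimes>\<^bsub>Gal_zeta\<^esub> b \<in> {id_zeta, cnj_zeta}" if "a \<in> {id_zeta, cnj_zeta}" "b \<in> {id_zeta, cnj_zeta}" for a b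
      using that il id_zeta_in_Gal cnj_zeta_in_Gal cnj_zeta_mult_self by (elim insertE emptyE) simp_all
  qed
  thus "subgroup H Gal_zeta \<and> card H = 2" using id_zeta_neq_cnj_zeta H by auto
qed

lemma ex1_order_2_subgroup:
  "\<exists>!H. subgroup H Gal_zeta \<and> card H = 2" unfolding order_2_subgroup_iff by auto

lemma Q_inf_3_eq_real_subfield: "Q_inf_3 = Q_zeta_3_inf \<inter> \<real>"
  unfolding Q_inf_3_def order_2_subgroup_iff fixed_field_def by (auto simp: id_zeta_def cnj_zeta_def complex_is_Real_iff complex_eq_iff)

end

theory Submission
  imports Defs "Jordan_Normal_Form.Char_Poly" "HOL-Number_Theory.Residues"
begin

text \<open>
  Let $\theta$ be a root of $x^3 - 3 x + 1$, with conjugates in the cubic subfield of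
  $\mathbf{Q}_{\infty,3}$. For an integer $k$ the elements $x_i = \theta_i + 3 k \theta_{i+1}$
  have trace 0, hence are the roots of some $x^3 + P x + Q$, and the cubic
  $x^3 + (P x - Q^2)^2$ has the roots $- (x_i x_j)^2$. So the curve
  $y^2 = x^3 + (P x - Q^2)^2$ has a rational 3-torsion point \<open>T\<close> and full 2-torsion over the
  cubic field, but no rational 2-torsion since $P$ and $Q$ are odd. It yields part (2), and its
  quadratic twist by 2 yields part (1).

  Over $\mathbf{Q}(\zeta_{3^n})$ with the valuation above 3, whose residue field has three
  elements, the differences of the roots of the cubic have equal valuation. Up to scaling,
  the curve therefore reduces to $y^2 = \pm (x^3 - x)$, all of whose points over the residue
  field are 2-torsion. Doubling moves a point into the kernel of reduction, where tripling moves a point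
  strictly closer to the origin; so every torsion point \<open>R\<close> has $2 \cdot 3^b R = O$. Over the reals the
  only 3-torsion abscissa is 0. For the twist this would require $\sqrt 2$, and divisibility
  of \<open>T\<close> by 3 would require a cube root of $2 Q^2$; both are impossible because 2 is
  unramified in $\mathbf{Q}(\zeta_{3^\infty})$.
\<close>

section \<open>Group law on a Weierstrass cubic\<close>

text \<open>Substituting \<open>x = - s^2\<close> turns \<open>x^3 + (P x - Q^2)^2\<close> into a
  difference of squares with the factor \<open>s^3 + P s^2 + Q^2\<close>. Its missing linear term
  says that the numbers \<open>Q / s\<close> have sum 0, so elements of trace 0 in a cyclic cubic
  field parametrize such curves with split 2-torsion. The multiplier \<open>3 k\<close> keeps each
  element congruent to a conjugate of theta above 3, so that valuations do not depend on
  \<open>k\<close> while \<open>j\<close> does. The line \<open>y = P x - Q^2\<close> meets the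
  curve only at \<open>x = 0\<close>, with multiplicity three; this is why \<open>T\<close> has
  order 3. A twist by 2 preserves \<open>j\<close> and, 2 being a unit above 3, all valuations. A
  valuation with values in the integers exists only on the finite layers of the tower, so each
  torsion point is treated in a layer containing its coordinates. The curve is never rescaled: being
  near a root or near the origin is expressed by inequalities relative to the common valuation of
  the root differences.\<close>

fun point_neg :: "'a::uminus point \<Rightarrow> 'a point" where
  "point_neg \<O> = \<O>"
| "point_neg (Affine x y) = Affine x (- y)"

lemma point_neg_neg [simp]: "point_neg (point_neg P) = (P :: 'a::group_add point)"
  by (cases P) auto

text \<open>
  The three affine points are the intersection, counted with multiplicity, of the line
  $y = l x + m$ with the curve $y^2 = x^3 + A x^2 + B x + C$.
\<close>

definition on_line ::
  "'a::field \<Rightarrow> 'a \<Rightarrow> 'a \<Rightarrow> 'a \<Rightarrow> 'a \<Rightarrow> 'a \<times> 'a \<Rightarrow> 'a \<times> 'a \<Rightarrow> 'a \<times> 'a \<Rightarrow> bool" where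
  "on_line A B C l m P Q R \<longleftrightarrow>
     fst P + fst Q + fst R = l^2 - A \<and>
     fst P * fst Q + fst P * fst R + fst Q * fst R = B - 2 * l * m \<and>
     fst P * fst Q * fst R = m^2 - C \<and>
     snd P = l * fst P + m \<and> snd Q = l * fst Q + m \<and> snd R = l * fst R + m"

definition collinear :: "'a::field \<Rightarrow> 'a \<Rightarrow> 'a \<Rightarrow> 'a \<times> 'a \<Rightarrow> 'a \<times> 'a \<Rightarrow> 'a \<times> 'a \<Rightarrow> bool" where
  "collinear A B C P Q R \<longleftrightarrow> (\<exists>l m. on_line A B C l m P Q R)"

lemma collinear_swap: "collinear A B C P Q R \<Longrightarrow> collinear A B C Q P R"
  unfolding collinear_def on_line_def by (auto simp: algebra_simps)

lemma collinear_rotate: "collinear A B C P Q R \<Longrightarrow> collinear A B C Q R P"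
  unfolding collinear_def on_line_def by (auto simp: algebra_simps)

lemma collinear_neg:
  "collinear A B C (x1, y1) (x2, y2) (x3, y3) \<Longrightarrow> collinear A B C (x1, - y1) (x2, - y2) (x3, - y3)"
proof -
  assume "collinear A B C (x1, y1) (x2, y2) (x3, y3)"
  then obtain l m where "on_line A B C l m (x1, y1) (x2, y2) (x3, y3)"
    unfolding collinear_def by blast
  hence "on_line A B C (- l) (- m) (x1, - y1) (x2, - y2) (x3, - y3)"
    unfolding on_line_def by simp
  thus ?thesis unfolding collinear_def by blast
qed

text \<open>The cubic and its derivative have no common root. The coordinates are complex because
  associativity is deduced from a generic case, which takes infinitely many points.\<close>

locale complex_curve =
  fixes A B C :: complex
  assumes smooth: "x^3 + A * x^2 + B * x + C = 0 \<Longrightarrow> 3 * x^2 + 2 * A * x + B \<noteq> 0"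
begin

abbreviation E :: "complex weierstrass" where "E \<equiv> Weierstrass 0 A 0 B C"
abbreviation pts :: "complex point set" where "pts \<equiv> Collect (on_curve E)"
abbreviation add :: "complex point \<Rightarrow> complex point \<Rightarrow> complex point" (infixl "\<^bold>+" 65)
  where "P \<^bold>+ Q \<equiv> point_add E P Q"

lemma on_curve_iff: "on_curve E (Affine x y) \<longleftrightarrow> y^2 = x^3 + A * x^2 + B * x + C"
  by simp

lemma collinear_on_curve:
  assumes "collinear A B C (x1, y1) (x2, y2) (x3, y3)"
  shows "on_curve E (Affine x1 y1)" "on_curve E (Affine x2 y2)" "on_curve E (Affine x3 y3)"
proof -
  obtain l m where "on_line A B C l m (x1, y1) (x2, y2) (x3, y3)"
    using assms unfolding collinear_def by blast
  hence e: "A = l^2 - x1 - x2 - x3" "B = x1 * x2 + x1 * x3 + x2 * x3 + 2 * l * m" "C = m^2 - x1 * x2 * x3"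
    "y1 = l * x1 + m" "y2 = l * x2 + m" "y3 = l * x3 + m"
    unfolding on_line_def by (auto simp: algebra_simps)
  show "on_curve E (Affine x1 y1)" "on_curve E (Affine x2 y2)" "on_curve E (Affine x3 y3)"
    unfolding on_curve_iff e by (simp_all add: algebra_simps power2_eq_square power3_eq_cube)
qed

lemma add_affine:
  "Affine x1 y1 \<^bold>+ Affine x2 y2 = (if x1 = x2 \<and> y1 + y2 = 0 then \<O> else
     let l = (if x1 = x2 then (3 * x1^2 + 2 * A * x1 + B) / (2 * y1) else (y2 - y1) / (x2 - x1));
         x3 = l^2 - A - x1 - x2
     in Affine x3 (- (l * (x3 - x1) + y1)))"
  by (auto simp: Let_def)

text \<open>Replacing \<open>A\<close> and \<open>B\<close> by the symmetric functions of the three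
  abscissas identifies the slope in the addition formula with \<open>l\<close>, for chords and
  tangents alike.\<close>

lemma add_eq_of_collinear:
  assumes c: "collinear A B C (x1, y1) (x2, y2) (x3, y3)" and ne: "\<not> (x1 = x2 \<and> y1 + y2 = 0)"
  shows "Affine x1 y1 \<^bold>+ Affine x2 y2 = Affine x3 (- y3)"
proof -
  obtain l m where "on_line A B C l m (x1, y1) (x2, y2) (x3, y3)"
    using c unfolding collinear_def by blast
  hence e: "A = l^2 - x1 - x2 - x3" "B = x1 * x2 + x1 * x3 + x2 * x3 + 2 * l * m"
    "y1 = l * x1 + m" "y2 = l * x2 + m" "y3 = l * x3 + m"
    unfolding on_line_def by (auto simp: algebra_simps)
  have sl: "(if x1 = x2 then (3 * x1^2 + 2 * A * x1 + B) / (2 * y1) else (y2 - y1) / (x2 - x1)) = l"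
  proof (cases "x1 = x2")
    case True
    hence "y1 \<noteq> 0" using ne unfolding e(3,4) by (metis add_0)
    moreover have "3 * x1^2 + 2 * A * x1 + B = l * (2 * y1)"
      unfolding e True by (simp add: algebra_simps power2_eq_square)
    ultimately show ?thesis using True by simp
  next
    case False
    moreover have "y2 - y1 = l * (x2 - x1)" unfolding e(3,4) by (simp add: algebra_simps)
    ultimately show ?thesis by simp
  qed
  have "x3 = l^2 - A - x1 - x2" "- (l * (x3 - x1) + y1) = - y3" unfolding e by (simp_all add: algebra_simps)
  thus ?thesis unfolding add_affine sl Let_def using ne by auto
qed

lemma collinear_exists:
  assumes P: "on_curve E (Affine x1 y1)" and Q: "on_curve E (Affine x2 y2)"
    and ne: "\<not> (x1 = x2 \<and> y1 + y2 = 0)"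
  obtains x3 y3 where "collinear A B C (x1, y1) (x2, y2) (x3, y3)"
proof -
  note P = P[unfolded on_curve_iff] and Q = Q[unfolded on_curve_iff]
  define l where "l = (if x1 = x2 then (3 * x1^2 + 2 * A * x1 + B) / (2 * y1) else (y2 - y1) / (x2 - x1))"
  define m where "m = y1 - l * x1"
  define x3 where "x3 = l^2 - A - x1 - x2"
  have y2: "y2 = l * x2 + m"
  proof (cases "x1 = x2")
    case True
    hence "y1^2 = y2^2" using P Q by simp
    hence "y1 = y2" using ne True by (auto simp: power2_eq_iff)
    thus ?thesis using True m_def by simp
  next
    case False
    hence "l * (x2 - x1) = y2 - y1" unfolding l_def by simp
    thus ?thesis unfolding m_def by (simp add: algebra_simps)
  qed
  have B: "x1 * x2 + x1 * x3 + x2 * x3 = B - 2 * l * m"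
  proof (cases "x1 = x2")
    case True
    hence "y1^2 = y2^2" using P Q by simp
    hence "y1 = y2" using ne True by (auto simp: power2_eq_iff)
    hence "y1 \<noteq> 0" using ne True by auto
    hence "l * (2 * y1) = 3 * x1^2 + 2 * A * x1 + B" using True unfolding l_def by simp
    hence "B = l * (2 * y1) - 3 * x1^2 - 2 * A * x1" by simp
    thus ?thesis unfolding x3_def m_def True[symmetric] by (simp add: algebra_simps power2_eq_square)
  next
    case False
    \<comment> \<open>The difference of the two curve equations, divided by \<open>x1 - x2\<close>,
      is the relation for \<open>B\<close>.\<close>
    have "(x1 - x2) * (x1^2 + x1 * x2 + x2^2 + A * (x1 + x2) + B)
        = (x1^3 + A * x1^2 + B * x1 + C) - (x2^3 + A * x2^2 + B * x2 + C)"
      by (simp add: algebra_simps power2_eq_square power3_eq_cube)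
    also have "\<dots> = (y1 - y2) * (y1 + y2)"
      unfolding P[symmetric] Q[symmetric] by (simp add: algebra_simps power2_eq_square)
    also have "\<dots> = (x1 - x2) * (l * (y1 + y2))" unfolding y2 m_def by (simp add: algebra_simps)
    finally have "x1^2 + x1 * x2 + x2^2 + A * (x1 + x2) + B = l * (y1 + y2)"
      using False by simp
    hence "B = l * (y1 + y2) - (x1^2 + x1 * x2 + x2^2 + A * (x1 + x2))" by (simp add: algebra_simps)
    thus ?thesis unfolding x3_def y2 m_def by (simp add: algebra_simps power2_eq_square)
  qed
  have C': "C = y1^2 - x1^3 - A * x1^2 - B * x1" using P by simp
  have B': "B = x1 * x2 + x1 * x3 + x2 * x3 + 2 * l * m" using B by simp
  have "x1 * x2 * x3 = m^2 - C" unfolding C' unfolding B' x3_def m_def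
    by (simp add: algebra_simps power2_eq_square power3_eq_cube)
  hence "on_line A B C l m (x1, y1) (x2, y2) (x3, l * x3 + m)"
    unfolding on_line_def using B y2 by (simp add: x3_def m_def)
  thus ?thesis using that unfolding collinear_def by blast
qed

lemma add_cases:
  assumes "on_curve E P" "on_curve E Q"
  obtains "P = \<O>" | "Q = \<O>" | "P \<noteq> \<O>" "Q = point_neg P"
    | x1 y1 x2 y2 x3 y3 where "P = Affine x1 y1" "Q = Affine x2 y2" "\<not> (x1 = x2 \<and> y1 + y2 = 0)"
        "collinear A B C (x1, y1) (x2, y2) (x3, y3)" "P \<^bold>+ Q = Affine x3 (- y3)"
proof (cases P; cases Q)
  fix x1 y1 x2 y2 assume e: "P = Affine x1 y1" "Q = Affine x2 y2"
  show ?thesis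
  proof (cases "x1 = x2 \<and> y1 + y2 = 0")
    case True
    hence "Q = point_neg P" unfolding e by (auto simp: eq_neg_iff_add_eq_0 add.commute)
    thus ?thesis using that(3) e by blast
  next
    case False
    then obtain x3 y3 where "collinear A B C (x1, y1) (x2, y2) (x3, y3)"
      using collinear_exists assms unfolding e by metis
    thus ?thesis using that(4) False add_eq_of_collinear e by blast
  qed
qed (use that(1,2) in blast)+

lemma add_O [simp]: "P \<^bold>+ \<O> = P" by (cases P) auto

lemma add_neg [simp]: "P \<^bold>+ point_neg P = \<O>" by (cases P) auto

lemma neg_on_curve [simp]: "on_curve E (point_neg P) \<longleftrightarrow> on_curve E P" by (cases P) auto

lemma add_on_curve [intro]: assumes "on_curve E P" "on_curve E Q" shows "on_curve E (P \<^bold>+ Q)"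
  using assms
proof (cases rule: add_cases)
  case (4 x1 y1 x2 y2 x3 y3)
  show ?thesis using collinear_on_curve(3)[OF 4(4)] unfolding 4(5) by simp
qed (use assms in \<open>auto simp del: on_curve.simps(2)\<close>)

lemma add_comm: assumes "on_curve E P" "on_curve E Q" shows "P \<^bold>+ Q = Q \<^bold>+ P"
  using assms
proof (cases rule: add_cases)
  case 3 thus ?thesis by (metis add_neg point_neg_neg)
next
  case (4 x1 y1 x2 y2 x3 y3)
  show ?thesis using add_eq_of_collinear[OF collinear_swap[OF 4(4)]] 4(3,5) unfolding 4(1,2)
    by (auto simp: add.commute)
qed auto

lemma add_neg_cancel: assumes "on_curve E P" "on_curve E T" shows "(P \<^bold>+ T) \<^bold>+ point_neg T = P"
  using assms
proof (cases rule: add_cases)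
  case 3
  thus ?thesis by (metis add_neg point_add.simps(1) point_neg_neg)
next
  case (4 x1 y1 x2 y2 x3 y3)
  \<comment> \<open>\<open>smooth\<close> enters here: in the exceptional case a line of finite
    slope has double contact with the curve at a point with ordinate 0, and that point would be
    singular.\<close>
  have ne: "\<not> (x3 = x2 \<and> - y3 + - y2 = 0)"
  proof
    assume a: "x3 = x2 \<and> - y3 + - y2 = 0"
    obtain l m where c: "on_line A B C l m (x1, y1) (x2, y2) (x3, y3)"
      using 4(4) unfolding collinear_def by blast
    have "y3 = y2" "y3 = - y2" using a c by (auto simp: on_line_def algebra_simps add_eq_0_iff)
    hence y: "y2 = 0" by simp
    have "x2^3 + A * x2^2 + B * x2 + C = 0" using assms(2) y 4(2) by simp
    moreover have "3 * x2^2 + 2 * A * x2 + B = 0"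
    proof -
      have "A = l^2 - x1 - x2 - x2" "B = x1 * x2 + x1 * x2 + x2 * x2 + 2 * l * m" and m: "m = - l * x2"
        using c a y unfolding on_line_def by (auto simp: algebra_simps add_eq_0_iff)
      show ?thesis unfolding \<open>A = _\<close> \<open>B = _\<close> m by (simp add: algebra_simps power2_eq_square)
    qed
    ultimately show False using smooth by blast
  qed
  have "collinear A B C (x3, - y3) (x2, - y2) (x1, - y1)"
    using collinear_neg[OF 4(4)] collinear_rotate collinear_swap by blast
  from add_eq_of_collinear[OF this ne] show ?thesis unfolding 4(5) unfolding 4(1,2) by simp
qed auto

lemma add_right_cancel:
  assumes "on_curve E P" "on_curve E Q" "on_curve E T" "P \<^bold>+ T = Q \<^bold>+ T" shows "P = Q"
  using assms add_neg_cancel by metis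

text \<open>
  Let \<open>l\<close>, \<open>l + a\<close> and \<open>b - l\<close> be the slopes of the lines through \<open>P\<close> and \<open>Q\<close>, through \<open>Q\<close> and
  $T = (t, y)$, and through $P + Q$ and \<open>T\<close>. The equation of the curve at \<open>T\<close> then says
  $t - x(P) = a b$, so that all coordinates become polynomials in \<open>l\<close>, \<open>a\<close>, \<open>b\<close>, \<open>t\<close> and two
  differences of abscissas, and the line through \<open>P\<close> and $Q + T$ has slope \<open>b - l - a\<close>.
\<close>

lemma assoc_generic:
  assumes P: "on_curve E P" and Q: "on_curve E Q"
  shows "\<exists>Z. finite Z \<and> (\<forall>T. on_curve E T \<longrightarrow> T \<notin> Z \<longrightarrow> (P \<^bold>+ Q) \<^bold>+ T = P \<^bold>+ (Q \<^bold>+ T))"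
  using assms
proof (cases rule: add_cases)
  case 3
  have "(P \<^bold>+ Q) \<^bold>+ T = P \<^bold>+ (Q \<^bold>+ T)" if T: "on_curve E T" for T
  proof -
    have "P \<^bold>+ (Q \<^bold>+ T) = (T \<^bold>+ Q) \<^bold>+ P" using P Q T add_comm add_on_curve by metis
    also have "\<dots> = T" using add_neg_cancel[OF T Q] 3 by simp
    finally show ?thesis using 3 by simp
  qed
  thus ?thesis by blast
next
  case (4 x1 y1 x2 y2 x3 y3)
  let ?S = "Affine x3 y3"
  \<comment> \<open>Outside \<open>?Z\<close>, \<open>t\<close> differs from \<open>x2\<close> and
    \<open>x3\<close>, so that \<open>T\<close> is joined by proper chords to \<open>Q\<close> and
    to \<open>P + Q\<close>; the last element prevents \<open>Q + T = - P\<close>.\<close>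
  let ?Z = "{\<O>, Q, point_neg Q, ?S, point_neg ?S, point_neg P \<^bold>+ point_neg Q}"
  have "(P \<^bold>+ Q) \<^bold>+ T = P \<^bold>+ (Q \<^bold>+ T)" if T: "on_curve E T" "T \<notin> ?Z" for T
  proof -
    from T(2) obtain t y where Ty: "T = Affine t y" by (cases T) auto
    have Ty2: "y^2 = t^3 + A * t^2 + B * t + C" using T(1) Ty by simp
    obtain l m where c: "on_line A B C l m (x1, y1) (x2, y2) (x3, y3)"
      using 4(4) unfolding collinear_def by blast
    have t2: "t \<noteq> x2"
    proof
      assume "t = x2"
      hence "y^2 = y2^2" using Ty2 collinear_on_curve(2)[OF 4(4)] by simp
      thus False using T(2) \<open>t = x2\<close> unfolding Ty 4(2) by (auto simp: power2_eq_iff)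
    qed
    have t3: "t \<noteq> x3"
    proof
      assume "t = x3"
      hence "y^2 = y3^2" using Ty2 collinear_on_curve(3)[OF 4(4)] by simp
      thus False using T(2) \<open>t = x3\<close> unfolding Ty by (auto simp: power2_eq_iff)
    qed
    define u2 u3 where "u2 = t - x2" and "u3 = t - x3"
    define a b where "a = (y - (l * t + m)) / u2" and "b = (y + (l * t + m)) / u3"
    have u: "u2 \<noteq> 0" "u3 \<noteq> 0" "a * u2 = y - (l * t + m)" "b * u3 = y + (l * t + m)"
      using t2 t3 by (auto simp: u2_def u3_def a_def b_def)
    have "(a * b) * (u2 * u3) = (t - x1) * (u2 * u3)"
    proof -
      have "(a * b) * (u2 * u3) = (y - (l * t + m)) * (y + (l * t + m))" unfolding u(3,4)[symmetric] by simp
      also have "\<dots> = (t - x1) * (t - x2) * (t - x3)"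
      proof -
        have "A = l^2 - x1 - x2 - x3" "B = x1 * x2 + x1 * x3 + x2 * x3 + 2 * l * m" "C = m^2 - x1 * x2 * x3"
          using c unfolding on_line_def by (auto simp: algebra_simps)
        moreover have "(y - (l * t + m)) * (y + (l * t + m)) = y^2 - (l * t + m)^2"
          by (simp add: algebra_simps power2_eq_square)
        ultimately show ?thesis unfolding Ty2 by (simp add: left_diff_distrib right_diff_distrib distrib_left distrib_right power2_eq_square power3_eq_cube mult_ac)
      qed
      finally show ?thesis by (simp add: u2_def u3_def mult.assoc)
    qed
    hence "a * b = t - x1" using u(1,2) by simp
    hence x1: "x1 = t - a * b" by simp
    have x2: "x2 = t - u2" and x3: "x3 = t - u3" by (simp_all add: u2_def u3_def)
    have y: "y = (a * u2 + b * u3) / 2" using u(3,4) by (simp add: field_simps)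
    have m: "m = (b * u3 - a * u2) / 2 - l * t" using u(3,4) by (simp add: field_simps)
    have A: "A = l^2 - x1 - x2 - x3" and B: "B = x1 * x2 + x1 * x3 + x2 * x3 + 2 * l * m"
      and C: "C = m^2 - x1 * x2 * x3" and y1: "y1 = l * x1 + m" and y2: "y2 = l * x2 + m" and y3: "y3 = l * x3 + m"
      using c unfolding on_line_def by (auto simp: algebra_simps)
    define v where "v = t + 2 * l * a + a^2 - a * b - u3"
    define w where "w = t + b^2 - 2 * b * l - a * b - u2"
    define v' where "v' = (l + a) * (v - x2) + y2"
    define w' where "w' = (b - l) * (w - t) + y"
    have "on_line A B C (l + a) (y2 - (l + a) * x2) (x2, y2) (t, y) (v, v')"
      unfolding on_line_def fst_conv snd_conv A B C y1 y2 y3 m y x1 x2 x3 v_def v'_def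
      by (simp add: field_simps power2_eq_square)
    hence QT: "Q \<^bold>+ T = Affine v (- v')"
      unfolding 4(2) Ty using t2 by (intro add_eq_of_collinear) (auto simp: collinear_def)
    have "on_line A B C (b - l) (y - (b - l) * t) (x3, - y3) (t, y) (w, w')"
      unfolding on_line_def fst_conv snd_conv A B C y1 y2 y3 m y x1 x2 x3 w_def w'_def
      by (simp add: field_simps power2_eq_square)
    hence ST: "(P \<^bold>+ Q) \<^bold>+ T = Affine w (- w')"
      unfolding 4(5) Ty using t3 by (intro add_eq_of_collinear) (auto simp: collinear_def)
    have "on_line A B C (b - l - a) (y1 - (b - l - a) * x1) (x1, y1) (v, - v') (w, w')"
      unfolding on_line_def fst_conv snd_conv A B C y1 y2 y3 m y x1 x2 x3 w_def w'_def v_def v'_def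
      by (simp add: field_simps power2_eq_square)
    moreover have "\<not> (x1 = v \<and> y1 + - v' = 0)"
    proof
      assume "x1 = v \<and> y1 + - v' = 0"
      hence "Q \<^bold>+ T = point_neg P" unfolding QT 4(1) by simp
      hence "T = point_neg P \<^bold>+ point_neg Q" using add_neg_cancel[OF T(1) Q] add_comm[OF T(1) Q] by simp
      thus False using T(2) by simp
    qed
    ultimately have "P \<^bold>+ (Q \<^bold>+ T) = Affine w (- w')"
      unfolding QT unfolding 4(1) by (intro add_eq_of_collinear) (auto simp: collinear_def)
    thus ?thesis using ST by simp
  qed
  moreover have "finite ?Z" by simp
  ultimately show ?thesis by blast
qed (auto intro!: exI[of _ "{}"])

lemma infinite_pts: "infinite pts"
proof
  assume "finite pts"
  hence "finite ((\<lambda>P. case P of Affine x y \<Rightarrow> x | _ \<Rightarrow> 0) ` pts)" by simp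
  moreover have "x \<in> (\<lambda>P. case P of Affine x y \<Rightarrow> x | _ \<Rightarrow> 0) ` pts" for x
  proof -
    have "Affine x (csqrt (x^3 + A * x^2 + B * x + C)) \<in> pts" by simp
    thus ?thesis by (rule rev_image_eqI) simp
  qed
  ultimately show False using infinite_UNIV_char_0[where 'a = complex] by (metis UNIV_eq_I)
qed

text \<open>Four applications of \<open>assoc_generic\<close> with the same generic \<open>U\<close>
  show that both sides agree after adding \<open>U\<close>, and \<open>U\<close> can be cancelled.
  One application has \<open>R + U\<close> as its third point, so its exceptional set is translated
  by \<open>- R\<close>.\<close>

lemma add_assoc:
  assumes P: "on_curve E P" and Q: "on_curve E Q" and R: "on_curve E R"
  shows "(P \<^bold>+ Q) \<^bold>+ R = P \<^bold>+ (Q \<^bold>+ R)"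
proof -
  obtain Z1 where Z1: "finite Z1" "\<And>T. on_curve E T \<Longrightarrow> T \<notin> Z1 \<Longrightarrow> ((P \<^bold>+ Q) \<^bold>+ R) \<^bold>+ T = (P \<^bold>+ Q) \<^bold>+ (R \<^bold>+ T)"
    using assoc_generic[of "P \<^bold>+ Q" R] P Q R by blast
  obtain Z2 where Z2: "finite Z2" "\<And>T. on_curve E T \<Longrightarrow> T \<notin> Z2 \<Longrightarrow> (P \<^bold>+ Q) \<^bold>+ T = P \<^bold>+ (Q \<^bold>+ T)"
    using assoc_generic[of P Q] P Q by blast
  obtain Z3 where Z3: "finite Z3" "\<And>T. on_curve E T \<Longrightarrow> T \<notin> Z3 \<Longrightarrow> (Q \<^bold>+ R) \<^bold>+ T = Q \<^bold>+ (R \<^bold>+ T)"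
    using assoc_generic[of Q R] Q R by blast
  obtain Z4 where Z4: "finite Z4" "\<And>T. on_curve E T \<Longrightarrow> T \<notin> Z4 \<Longrightarrow> (P \<^bold>+ (Q \<^bold>+ R)) \<^bold>+ T = P \<^bold>+ ((Q \<^bold>+ R) \<^bold>+ T)"
    using assoc_generic[of P "Q \<^bold>+ R"] P Q R by blast
  have "finite (Z1 \<union> (\<lambda>T. T \<^bold>+ point_neg R) ` Z2 \<union> Z3 \<union> Z4)" using Z1 Z2 Z3 Z4 by simp
  hence "\<not> pts \<subseteq> Z1 \<union> (\<lambda>T. T \<^bold>+ point_neg R) ` Z2 \<union> Z3 \<union> Z4"
    using infinite_pts finite_subset by blast
  then obtain U where U: "on_curve E U" "U \<notin> Z1" "U \<notin> (\<lambda>T. T \<^bold>+ point_neg R) ` Z2" "U \<notin> Z3" "U \<notin> Z4"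
    by blast
  have "R \<^bold>+ U \<notin> Z2" using U(3) add_neg_cancel[OF U(1) R] add_comm[OF U(1) R] by (metis image_eqI)
  hence "((P \<^bold>+ Q) \<^bold>+ R) \<^bold>+ U = (P \<^bold>+ (Q \<^bold>+ R)) \<^bold>+ U"
    using Z1(2) Z2(2)[of "R \<^bold>+ U"] Z3(2) Z4(2) U R add_on_curve by simp
  thus ?thesis using add_right_cancel[of "(P \<^bold>+ Q) \<^bold>+ R" "P \<^bold>+ (Q \<^bold>+ R)" U] P Q R U add_on_curve by blast
qed

end

section \<open>Cyclotomic integers of 3-power order\<close>

definition int_adjoin :: "complex \<Rightarrow> complex set" where
  "int_adjoin w = range (\<lambda>p :: int poly. poly (map_poly of_int p) w)"

lemma int_adjoinI: "poly (map_poly of_int p) w \<in> int_adjoin w"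
  unfolding int_adjoin_def by blast

lemma ipoly_pCons:
  "poly (map_poly of_int (pCons a p)) x = of_int a + x * poly (map_poly of_int p) (x :: 'a :: comm_ring_1)"
  by (cases "a = 0 \<and> p = 0") (auto simp: map_poly_pCons)

lemma int_adjoin_gen: "w \<in> int_adjoin w"
  using int_adjoinI[of "[:0, 1:]" w] by (simp add: ipoly_pCons)

lemma int_adjoin_of_int [simp]: "of_int a \<in> int_adjoin w"
  using int_adjoinI[of "[:a:]" w] by (simp add: ipoly_pCons)

lemma int_adjoin_0 [simp]: "0 \<in> int_adjoin w" and int_adjoin_1 [simp]: "1 \<in> int_adjoin w"
  and int_adjoin_numeral [simp]: "numeral k \<in> int_adjoin w"
  using int_adjoin_of_int[of 0 w] int_adjoin_of_int[of 1 w] int_adjoin_of_int[of "numeral k" w] by simp_all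

lemma int_adjoin_add [intro]: "x \<in> int_adjoin w \<Longrightarrow> y \<in> int_adjoin w \<Longrightarrow> x + y \<in> int_adjoin w"
proof -
  assume "x \<in> int_adjoin w" "y \<in> int_adjoin w"
  then obtain p q :: "int poly" where "x = poly (map_poly of_int p) w" "y = poly (map_poly of_int q) w"
    unfolding int_adjoin_def by blast
  hence "x + y = poly (map_poly of_int (p + q)) w" by (simp add: of_int_poly_hom.hom_add)
  thus ?thesis using int_adjoinI by simp
qed

lemma int_adjoin_mult [intro]: "x \<in> int_adjoin w \<Longrightarrow> y \<in> int_adjoin w \<Longrightarrow> x * y \<in> int_adjoin w"
proof -
  assume "x \<in> int_adjoin w" "y \<in> int_adjoin w"
  then obtain p q :: "int poly" where "x = poly (map_poly of_int p) w" "y = poly (map_poly of_int q) w"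
    unfolding int_adjoin_def by blast
  hence "x * y = poly (map_poly of_int (p * q)) w" by (simp add: of_int_poly_hom.hom_mult)
  thus ?thesis using int_adjoinI by simp
qed

lemma int_adjoin_minus [intro]: "x \<in> int_adjoin w \<Longrightarrow> - x \<in> int_adjoin w"
  using int_adjoin_mult[of "-1" w x] int_adjoin_of_int[of "-1" w] by simp

lemma int_adjoin_diff [intro]: "x \<in> int_adjoin w \<Longrightarrow> y \<in> int_adjoin w \<Longrightarrow> x - y \<in> int_adjoin w"
  using int_adjoin_add[of x w "- y"] int_adjoin_minus[of y w] by simp

lemma int_adjoin_power [intro]: "x \<in> int_adjoin w \<Longrightarrow> x ^ k \<in> int_adjoin w"
  by (induction k) auto

lemma int_adjoin_subset: assumes "w \<in> int_adjoin u" shows "int_adjoin w \<subseteq> int_adjoin u"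
proof -
  have "poly (map_poly of_int p) w \<in> int_adjoin u" for p :: "int poly"
    by (induction p) (auto simp: ipoly_pCons intro!: int_adjoin_add int_adjoin_mult assms)
  thus ?thesis unfolding int_adjoin_def[of w] by blast
qed

section \<open>Integrality, fractions and the prime 2 in Z[w] for a root of unity w\<close>

locale root_of_unity =
  fixes w :: complex and N :: nat
  assumes N_pos: "N > 0" and w_pow: "w ^ N = 1"
begin

abbreviation R :: "complex set" where "R \<equiv> int_adjoin w"

text \<open>
  Multiplication by \<open>x \<in> R\<close> acts on the generators $1, w, \dots, w^{N-1}$ by an integer matrix,
  so \<open>x\<close> is a root of its characteristic polynomial.
\<close>

lemma algebraic_int_R: assumes "x \<in> R" shows "algebraic_int x"
proof -
  obtain p :: "int poly" where p: "x = poly (map_poly of_int p) w"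
    using assms unfolding int_adjoin_def by blast
  \<comment> \<open>Row \<open>i\<close> expands \<open>x * w^i\<close> with exponents reduced
    modulo \<open>N\<close>. The generators may be linearly dependent; an eigenvector suffices, and
    it is nonzero because its first entry is 1.\<close>
  define M :: "int mat" where
    "M = mat N N (\<lambda>(i, j). \<Sum>k | k \<le> degree p \<and> (i + k) mod N = j. coeff p k)"
  let ?M = "map_mat of_int M :: complex mat"
  let ?v = "vec N (\<lambda>i. w ^ i)"
  have M: "M \<in> carrier_mat N N" "?M \<in> carrier_mat N N" unfolding M_def by auto
  have wmod: "w ^ (a mod N) = w ^ a" for a
  proof -
    have "w ^ a = w ^ (N * (a div N) + a mod N)" by simp
    also have "\<dots> = w ^ (a mod N)" unfolding power_add power_mult w_pow by simp
    finally show ?thesis by simp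
  qed
  have x: "x = (\<Sum>k\<le>degree p. of_int (coeff p k) * w ^ k)"
    unfolding p poly_altdef by simp
  have "?M *\<^sub>v ?v = x \<cdot>\<^sub>v ?v"
  proof (rule eq_vecI)
    fix i assume "i < dim_vec (x \<cdot>\<^sub>v ?v)"
    hence i: "i < N" by simp
    have "(?M *\<^sub>v ?v) $ i = (\<Sum>j<N. (\<Sum>k | k \<le> degree p \<and> (i + k) mod N = j. of_int (coeff p k)) * w ^ j)"
      using i M by (simp add: M_def scalar_prod_def atLeast0LessThan)
    also have "\<dots> = (\<Sum>j<N. \<Sum>k | k \<in> {..degree p} \<and> (i + k) mod N = j. of_int (coeff p k) * w ^ (i + k))"
      unfolding sum_distrib_right by (intro sum.cong) (auto simp: wmod)
    also have "\<dots> = (\<Sum>k\<le>degree p. of_int (coeff p k) * w ^ (i + k))"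
      by (rule sum.group) (use N_pos in auto)
    also have "\<dots> = (x \<cdot>\<^sub>v ?v) $ i"
      using i unfolding x by (simp add: sum_distrib_left sum_distrib_right power_add mult_ac)
    finally show "(?M *\<^sub>v ?v) $ i = (x \<cdot>\<^sub>v ?v) $ i" .
  qed (use M in simp)
  moreover have "?v \<noteq> 0\<^sub>v N"
  proof
    assume "?v = 0\<^sub>v N"
    hence "?v $ 0 = 0\<^sub>v N $ 0" by simp
    thus False using N_pos by simp
  qed
  ultimately have "eigenvalue ?M x" unfolding eigenvalue_def eigenvector_def using M
    by (intro exI[of _ ?v]) auto
  hence "poly (char_poly ?M) x = 0" using eigenvalue_root_char_poly M by blast
  hence "poly (map_poly of_int (char_poly M)) x = 0" unfolding of_int_hom.char_poly_hom[OF M(1)] .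
  moreover have "lead_coeff (char_poly M) = 1" using degree_monic_char_poly[OF M(1)] by simp
  ultimately show ?thesis unfolding algebraic_int_altdef_ipoly by blast
qed

text \<open>The quotient \<open>b / a\<close> is rational and an algebraic integer, hence an
  integer.\<close>

lemma of_int_dvd_in_R:
  assumes "x \<in> R" "of_int a * x = of_int b" "a \<noteq> 0" shows "a dvd b"
proof -
  have "x = of_int b / of_int a" using assms by (simp add: field_simps)
  hence "x \<in> \<rat>" by auto
  hence "x \<in> \<int>" using rational_algebraic_int_is_int algebraic_int_R assms(1) by blast
  then obtain c where "x = of_int c" by (elim Ints_cases)
  hence "of_int (a * c) = (of_int b :: complex)" using assms(2) by simp
  hence "b = a * c" by (metis of_int_eq_iff)
  thus ?thesis by simp
qed

text \<open>Cancel powers of the variable from an integral equation of \<open>x\<close> until its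
  constant term is nonzero; that constant is then a multiple of \<open>x\<close> in
  \<open>R\<close>.\<close>

lemma divides_int_in_R:
  assumes "x \<in> R" "x \<noteq> 0" obtains y m where "y \<in> R" "m \<noteq> 0" "x * y = of_int m"
proof -
  obtain p where p: "poly (map_poly of_int p) x = 0" "lead_coeff p = 1"
    using algebraic_int_R[OF assms(1)] unfolding algebraic_int_altdef_ipoly by blast
  hence "p \<noteq> 0" by auto
  hence "\<exists>q. coeff q 0 \<noteq> 0 \<and> poly (map_poly of_int q) x = 0" using p(1)
  proof (induction p)
    case (pCons a p)
    show ?case
    proof (cases "a = 0")
      case True
      hence "poly (map_poly of_int p) x = 0" "p \<noteq> 0" using pCons assms(2) by (auto simp: ipoly_pCons)
      thus ?thesis using pCons by blast
    next
      case False
      thus ?thesis using pCons by (intro exI[of _ "pCons a p"]) simp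
    qed
  qed simp
  then obtain q where q: "coeff q 0 \<noteq> 0" "poly (map_poly of_int q) x = 0" by blast
  obtain c r where cr: "q = pCons c r" by (cases q)
  have "x * poly (map_poly of_int r) x = - of_int c" using q(2) unfolding cr
    by (simp add: ipoly_pCons eq_neg_iff_add_eq_0 add.commute)
  hence "x * (- poly (map_poly of_int r) x) = of_int c" by simp
  moreover have "poly (map_poly of_int r) x \<in> R"
    using int_adjoin_subset[OF assms(1)] int_adjoinI by blast
  ultimately show ?thesis using that[of "- poly (map_poly of_int r) x" c] q(1) cr by auto
qed

text \<open>The fraction field of \<open>R\<close>: integer denominators suffice by
  \<open>divides_int_in_R\<close>.\<close>

definition K :: "complex set" where "K = {x / of_int m | x m. x \<in> R \<and> m \<noteq> 0}"

lemma K_I: "x \<in> R \<Longrightarrow> m \<noteq> 0 \<Longrightarrow> x / of_int m \<in> K" unfolding K_def by blast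

lemma R_subset_K: "x \<in> R \<Longrightarrow> x \<in> K" using K_I[of x 1] by simp

lemma K_add: assumes "x \<in> K" "y \<in> K" shows "x + y \<in> K"
proof -
  obtain a m b n where e: "x = a / of_int m" "y = b / of_int n" "a \<in> R" "b \<in> R" "m \<noteq> 0" "n \<noteq> 0"
    using assms unfolding K_def by blast
  have "x + y = (a * of_int n + b * of_int m) / of_int (m * n)" using e by (simp add: field_simps)
  thus ?thesis using e K_I[of "a * of_int n + b * of_int m" "m * n"] by (simp add: int_adjoin_add int_adjoin_mult)
qed

lemma K_mult: assumes "x \<in> K" "y \<in> K" shows "x * y \<in> K"
proof -
  obtain a m b n where e: "x = a / of_int m" "y = b / of_int n" "a \<in> R" "b \<in> R" "m \<noteq> 0" "n \<noteq> 0"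
    using assms unfolding K_def by blast
  have "x * y = (a * b) / of_int (m * n)" using e by (simp add: field_simps)
  thus ?thesis using e K_I[of "a * b" "m * n"] by (simp add: int_adjoin_mult)
qed

lemma K_minus: assumes "x \<in> K" shows "- x \<in> K"
  using K_mult[OF assms R_subset_K[OF int_adjoin_of_int[of "-1"]]] by simp

lemma K_inverse: assumes "x \<in> K" shows "inverse x \<in> K"
proof (cases "x = 0")
  case False
  obtain a m where e: "x = a / of_int m" "a \<in> R" "m \<noteq> 0" using assms unfolding K_def by blast
  obtain b n where b: "b \<in> R" "n \<noteq> 0" "a * b = of_int n"
    using divides_int_in_R[of a] e False by auto
  have "a \<noteq> 0" using False e by auto
  moreover have "b \<noteq> 0" using b by auto
  ultimately have "inverse x = (b * of_int m) / of_int n" unfolding e(1) b(3)[symmetric]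
    by (simp add: field_simps)
  thus ?thesis using K_I[of "b * of_int m" n] b by (simp add: int_adjoin_mult)
qed (use assms in simp)

lemma frobenius_add:
  assumes "x \<in> R" "y \<in> R" shows "\<exists>z\<in>R. (x + y) ^ 2 ^ j = x ^ 2 ^ j + y ^ 2 ^ j + 2 * z"
proof (induction j)
  case 0 show ?case by (intro bexI[of _ 0]) auto
next
  case (Suc j)
  then obtain z where z: "z \<in> R" "(x + y) ^ 2 ^ j = x ^ 2 ^ j + y ^ 2 ^ j + 2 * z" by blast
  let ?a = "x ^ 2 ^ j" and ?b = "y ^ 2 ^ j"
  have "(x + y) ^ 2 ^ Suc j = (?a + ?b + 2 * z)^2" unfolding power_Suc2 power_mult z(2) ..
  also have "\<dots> = ?a^2 + ?b^2 + 2 * (?a * ?b + 2 * (?a + ?b) * z + 2 * z * z)"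
    by (simp add: algebra_simps power2_eq_square)
  also have "?a^2 = x ^ 2 ^ Suc j" by (simp only: power_Suc2 power_mult)
  also have "?b^2 = y ^ 2 ^ Suc j" by (simp only: power_Suc2 power_mult)
  finally show ?case
    by (rule bexI) (intro int_adjoin_add int_adjoin_mult int_adjoin_power int_adjoin_numeral assms z(1))
qed

text \<open>Modulo 2, raising to the power \<open>2^j\<close> is additive and fixes integers, so it
  acts on polynomials in \<open>w\<close> through \<open>w\<close> alone.\<close>

lemma frobenius:
  "\<exists>z\<in>R. poly (map_poly of_int p) w ^ 2 ^ j = poly (map_poly of_int p) (w ^ 2 ^ j) + 2 * z"
proof (induction p)
  case 0 show ?case by (intro bexI[of _ 0]) auto
next
  case (pCons a p)
  let ?f = "poly (map_poly of_int p)"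
  obtain z where z: "z \<in> R" "?f w ^ 2 ^ j = ?f (w ^ 2 ^ j) + 2 * z" using pCons by blast
  obtain y where y: "y \<in> R" "(of_int a + w * ?f w) ^ 2 ^ j = of_int a ^ 2 ^ j + (w * ?f w) ^ 2 ^ j + 2 * y"
    using frobenius_add[OF int_adjoin_of_int int_adjoin_mult[OF int_adjoin_gen int_adjoinI]] by blast
  have "even (a ^ 2 ^ j - a)" by simp
  then obtain b where "a ^ 2 ^ j - a = 2 * b" by (elim dvdE)
  hence b: "of_int a ^ 2 ^ j = (of_int a + 2 * of_int b :: complex)"
    by (metis add.commute diff_add_cancel of_int_add of_int_mult of_int_numeral of_int_power)
  have "(of_int a + w * ?f w) ^ 2 ^ j = of_int a + w ^ 2 ^ j * ?f (w ^ 2 ^ j) + 2 * (of_int b + w ^ 2 ^ j * z + y)"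
    unfolding y(2) b power_mult_distrib z(2) by (simp add: algebra_simps)
  moreover have "of_int b + w ^ 2 ^ j * z + y \<in> R"
    by (intro int_adjoin_add int_adjoin_mult int_adjoin_power int_adjoin_of_int int_adjoin_gen z(1) y(1))
  ultimately show ?case unfolding ipoly_pCons by blast
qed

text \<open>For odd \<open>N\<close> the prime 2 is unramified: some power of the Frobenius is the identity modulo 2.\<close>

lemma even_if_power_even:
  assumes "odd N" "x \<in> R" "y \<in> R" "x ^ k = 2 * y" obtains z where "z \<in> R" "x = 2 * z"
proof -
  \<comment> \<open>The factor \<open>totient N\<close> makes \<open>w^(2^j) = w\<close>, and the
    factor \<open>k\<close> makes \<open>2^j\<close> at least \<open>k\<close>.\<close>
  define j where "j = totient N * k"
  have tot: "totient N > 0" using N_pos by simp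
  have "[2 ^ totient N = 1] (mod N)" using assms(1) by (intro euler_theorem) simp
  hence "[(2 ^ totient N) ^ k = 1 ^ k] (mod N)" by (rule cong_pow)
  hence "[2 ^ j = 1] (mod N)" by (simp add: j_def power_mult)
  then obtain t where t: "2 ^ j = 1 + N * t"
    by (metis cong_le_nat cong_sym one_le_numeral one_le_power mult.commute add.commute)
  have wj: "w ^ 2 ^ j = w" unfolding t power_add power_mult w_pow by simp
  obtain p :: "int poly" where p: "x = poly (map_poly of_int p) w" using assms(2) unfolding int_adjoin_def by blast
  obtain z where z: "z \<in> R" "x ^ 2 ^ j = x + 2 * z" using frobenius[of p j] unfolding wj p by blast
  have "k \<le> j" using tot by (simp add: j_def Suc_leI)
  also have "j \<le> 2 ^ j" by (simp add: less_imp_le)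
  finally have "x ^ 2 ^ j = x ^ k * x ^ (2 ^ j - k)" by (simp flip: power_add)
  hence "x = 2 * (y * x ^ (2 ^ j - k) - z)" using z(2) assms(4) by (simp add: algebra_simps)
  moreover have "y * x ^ (2 ^ j - k) - z \<in> R"
    by (intro int_adjoin_diff int_adjoin_mult int_adjoin_power assms z(1))
  ultimately show ?thesis using that by blast
qed

text \<open>Infinite descent on the denominator. From \<open>x^k = c m^k\<close> with
  \<open>c\<close> even, \<open>even_if_power_even\<close> gives \<open>2\<close> dividing
  \<open>x\<close>, so \<open>2^k\<close> divides \<open>c m^k\<close>; as \<open>c\<close> has only
  one factor 2 and \<open>k\<close> is at least 2, \<open>m\<close> is even, and \<open>x\<close>
  and \<open>m\<close> can be halved.\<close>

lemma power_neq_2_mod_4: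
  assumes N: "odd N" and k: "2 \<le> k" and c: "c mod 4 = 2" and z: "z \<in> K" shows "z ^ k \<noteq> of_int c"
proof
  have desc: False if "x \<in> R" "m \<noteq> 0" "x ^ k = of_int (c * m ^ k)" for x m
    using that
  proof (induction "nat \<bar>m\<bar>" arbitrary: x m rule: less_induct)
    case less
    have "even c" using c by presburger
    then obtain d where d: "c = 2 * d" by (elim dvdE)
    have "x ^ k = 2 * of_int (d * m ^ k)" unfolding less(4) d by simp
    then obtain y where y: "y \<in> R" "x = 2 * y"
      using even_if_power_even[OF N less(2) int_adjoin_of_int] by blast
    have yk: "of_int (2 ^ k) * y ^ k = of_int (c * m ^ k)"
      using less(4) y by (simp add: power_mult_distrib)
    hence "2 ^ k dvd c * m ^ k" using y by (intro of_int_dvd_in_R[of "y ^ k"]) auto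
    moreover have "(2::int) ^ 2 dvd 2 ^ k" using k by (intro le_imp_power_dvd)
    ultimately have "2 ^ 2 dvd c * m ^ k" using dvd_trans by blast
    hence dv: "4 dvd c * m ^ k" by simp
    have "even m"
    proof (rule ccontr)
      assume "odd m"
      hence "coprime (m ^ k) (2 ^ 2)" unfolding coprime_power_left_iff coprime_power_right_iff by simp
      hence "coprime (m ^ k) 4" by (metis numeral_Bit0 numeral_One one_add_one power2_eq_square mult_2)
      hence "4 dvd c" using dv by (simp add: coprime_commute coprime_dvd_mult_left_iff)
      thus False using c by presburger
    qed
    then obtain m' where m': "m = 2 * m'" by (elim dvdE)
    have "of_int (2 ^ k) * y ^ k = of_int (2 ^ k) * of_int (c * m' ^ k)"
      unfolding yk m' by (simp add: power_mult_distrib)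
    hence "y ^ k = of_int (c * m' ^ k)" by simp
    moreover have "nat \<bar>m'\<bar> < nat \<bar>m\<bar>" "m' \<noteq> 0" using m' less(3) by (simp_all add: abs_mult)
    ultimately show False using less(1) y by blast
  qed
  assume "z ^ k = of_int c"
  moreover obtain x m where "x \<in> R" "m \<noteq> 0" "z = x / of_int m" using z unfolding K_def by blast
  ultimately show False using desc[of x m] by (simp add: power_divide field_simps)
qed

end

text \<open>A discrete valuation above 3 whose residue field has three elements: every unit is
  congruent to 1 or -1. The value \<open>v 0\<close> is arbitrary, hence the case distinctions on
  zero.\<close>

locale valued_subfield =
  fixes K :: "complex set" and v :: "complex \<Rightarrow> int"
  assumes one_closed: "1 \<in> K" and add_closed: "\<And>x y. x \<in> K \<Longrightarrow> y \<in> K \<Longrightarrow> x + y \<in> K"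
    and mult_closed: "\<And>x y. x \<in> K \<Longrightarrow> y \<in> K \<Longrightarrow> x * y \<in> K"
    and minus_closed: "\<And>x. x \<in> K \<Longrightarrow> - x \<in> K" and inverse_closed: "\<And>x. x \<in> K \<Longrightarrow> inverse x \<in> K"
    and v_mult: "\<And>x y. x \<in> K \<Longrightarrow> y \<in> K \<Longrightarrow> x \<noteq> 0 \<Longrightarrow> y \<noteq> 0 \<Longrightarrow> v (x * y) = v x + v y"
    and v_add: "\<And>x y. x \<in> K \<Longrightarrow> y \<in> K \<Longrightarrow> x \<noteq> 0 \<Longrightarrow> y \<noteq> 0 \<Longrightarrow> x + y \<noteq> 0 \<Longrightarrow> min (v x) (v y) \<le> v (x + y)"
    and v_3: "v 3 > 0"
    and residue: "\<And>x. x \<in> K \<Longrightarrow> x \<noteq> 0 \<Longrightarrow> v x = 0 \<Longrightarrow>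
        x = 1 \<or> x = -1 \<or> v (x - 1) > 0 \<or> v (x + 1) > 0"

section \<open>The (1 - w)-adic valuation for w of 3-power order\<close>

locale root_of_unity_3 = root_of_unity w "3 ^ n" for w n +
  fixes \<omega> assumes omega: "\<omega> = w ^ (3 ^ (n - 1))" "1 + \<omega> + \<omega>^2 = 0"
begin

text \<open>The ideal generated by \<open>1 - w\<close>, which turns out to be the prime above
  3.\<close>

definition P where "P = (\<lambda>y. (1 - w) * y) ` R"

lemma P_subset: "x \<in> P \<Longrightarrow> x \<in> R" unfolding P_def by (auto intro!: int_adjoin_mult int_adjoin_diff int_adjoin_gen)

lemma P_add: "x \<in> P \<Longrightarrow> y \<in> P \<Longrightarrow> x + y \<in> P"
  unfolding P_def by (auto simp flip: distrib_left)

lemma P_mult: "x \<in> P \<Longrightarrow> y \<in> R \<Longrightarrow> x * y \<in> P"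
  unfolding P_def by (auto simp: mult.assoc)

lemma P_minus: "x \<in> P \<Longrightarrow> - x \<in> P"
  using P_mult[of x "-1"] int_adjoin_of_int[of "-1" w] by simp

lemma P_diff: "x \<in> P \<Longrightarrow> y \<in> P \<Longrightarrow> x - y \<in> P"
  using P_add[of x "- y"] P_minus by simp

lemma one_minus_power: "1 - w ^ k \<in> P"
proof (induction k)
  case 0 thus ?case unfolding P_def by (auto intro!: image_eqI[of _ _ 0])
next
  case (Suc k)
  have "(1 - w) * 1 \<in> P" unfolding P_def by (rule imageI) simp
  moreover have "(1 - w ^ k) * w \<in> P" by (intro P_mult Suc int_adjoin_gen)
  ultimately have "(1 - w) * 1 + (1 - w ^ k) * w \<in> P" by (rule P_add)
  thus ?case by (simp add: algebra_simps)
qed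

text \<open>As \<open>1 + \<omega> + \<omega>^2 = 0\<close>, the number 3 is the sum of
  \<open>1 - \<omega>\<close> and \<open>1 - \<omega>^2\<close>, both of the form
  \<open>1 - w^k\<close>.\<close>

lemma three_in_P: "3 \<in> P"
proof -
  have "(1 - \<omega>) + (1 - \<omega>^2) \<in> P"
    using one_minus_power by (intro P_add) (simp_all add: omega(1) flip: power_mult)
  also have "(1 - \<omega>) + (1 - \<omega>^2) = 3 - (1 + \<omega> + \<omega>^2)" by simp
  finally show ?thesis using omega(2) by simp
qed

lemma one_minus_w_power: "\<exists>y\<in>R. (1 - w) ^ 3 ^ n = 3 * y"
proof -
  have "\<exists>y\<in>R. (1 - w) ^ 3 ^ j = (1 - w ^ 3 ^ j) + 3 * y" for j
  proof (induction j)
    case 0 show ?case by (intro bexI[of _ 0]) auto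
  next
    case (Suc j)
    then obtain y where y: "y \<in> R" "(1 - w) ^ 3 ^ j = (1 - w ^ 3 ^ j) + 3 * y" by blast
    let ?u = "w ^ 3 ^ j"
    have "(1 - w) ^ 3 ^ Suc j = ((1 - ?u) + 3 * y) ^ 3" unfolding power_Suc2 power_mult y(2) ..
    also have "\<dots> = (1 - ?u ^ 3) + 3 * (?u * ?u - ?u + 3 * (1 - ?u)^2 * y + 9 * (1 - ?u) * y^2 + 9 * y^3)"
      by (simp add: algebra_simps power2_eq_square power3_eq_cube)
    also have "?u ^ 3 = w ^ 3 ^ Suc j" by (simp only: power_Suc2 power_mult)
    finally show ?case
      by (rule bexI) (intro int_adjoin_add int_adjoin_diff int_adjoin_mult int_adjoin_power
        int_adjoin_numeral int_adjoin_1 int_adjoin_gen y(1))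
  qed
  from this[of n] show ?thesis using w_pow by simp
qed

text \<open>High powers of \<open>1 - w\<close> are multiples of high powers of 3, and only 0 is an
  integer divisible by all powers of 3. This makes the valuation finite on nonzero elements.\<close>

lemma not_pow_dvd_int:
  assumes "\<And>k. \<exists>y\<in>R. of_int m = (1 - w) ^ k * y" shows "m = 0"
proof (rule ccontr)
  assume m: "m \<noteq> 0"
  obtain z where z: "z \<in> R" "(1 - w) ^ 3 ^ n = 3 * z" using one_minus_w_power by blast
  define j where "j = nat \<bar>m\<bar>"
  obtain y where y: "y \<in> R" "of_int m = (1 - w) ^ (3 ^ n * j) * y" using assms by blast
  have "of_int (3 ^ j) * (z ^ j * y) = of_int m"
    unfolding y(2) power_mult z(2) by (simp add: power_mult_distrib)
  hence "3 ^ j dvd m" using of_int_dvd_in_R[of "z ^ j * y" "3 ^ j" m] z y by auto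
  hence "3 ^ j \<le> \<bar>m\<bar>" using m by (metis dvd_imp_le_int abs_of_nonneg zero_le_numeral zero_le_power)
  moreover have "int j < 3 ^ j" using of_nat_less_two_power[of j, where 'a = int] power_mono[of "2 :: int" 3 j] by linarith
  ultimately show False unfolding j_def by simp
qed

lemma one_notin_P: "1 \<notin> P"
proof
  assume "1 \<in> P"
  then obtain y where y: "y \<in> R" "1 = (1 - w) * y" unfolding P_def by blast
  have "\<exists>y\<in>R. of_int 1 = (1 - w) ^ k * y" for k
    using y by (intro bexI[of _ "y ^ k"]) (auto simp flip: power_mult_distrib)
  from not_pow_dvd_int[OF this] show False by simp
qed

text \<open>Since \<open>w\<close> is congruent to 1, a polynomial in \<open>w\<close> is congruent
  to its integer value at 1, which is then reduced modulo 3.\<close>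

lemma residue_R: assumes "x \<in> R" shows "x \<in> P \<or> x - 1 \<in> P \<or> x + 1 \<in> P"
proof -
  have "poly (map_poly of_int p) w - of_int (poly p 1) \<in> P" for p
  proof (induction p)
    case 0 show ?case using one_minus_power[of 0] by simp
  next
    case (pCons a p)
    have "(1 - w) * of_int (poly p 1) \<in> P" unfolding P_def by (rule imageI) simp
    hence "(poly (map_poly of_int p) w - of_int (poly p 1)) * w - (1 - w) * of_int (poly p 1) \<in> P"
      using P_diff P_mult[OF pCons(2) int_adjoin_gen] by blast
    thus ?case by (simp add: ipoly_pCons algebra_simps)
  qed
  then obtain c where c: "x - of_int c \<in> P" using assms unfolding int_adjoin_def by blast
  have add3: "x - of_int c + 3 * of_int d \<in> P" for d
    by (intro P_add c P_mult three_in_P int_adjoin_of_int)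
  have "c = 3 * (c div 3) \<or> c = 3 * (c div 3) + 1 \<or> c = 3 * (c div 3 + 1) - 1" by presburger
  thus ?thesis
  proof (elim disjE)
    assume "c = 3 * (c div 3)"
    hence "of_int c = (3 * of_int (c div 3) :: complex)" by (metis of_int_mult of_int_numeral)
    thus ?thesis using add3[of "c div 3"] by simp
  next
    assume "c = 3 * (c div 3) + 1"
    hence "of_int c = (3 * of_int (c div 3) + 1 :: complex)" by (metis of_int_mult of_int_numeral of_int_add of_int_1)
    thus ?thesis using add3[of "c div 3"] by (simp add: algebra_simps)
  next
    assume "c = 3 * (c div 3 + 1) - 1"
    hence "of_int c = (3 * of_int (c div 3 + 1) - 1 :: complex)" by (metis of_int_mult of_int_numeral of_int_diff of_int_1)
    thus ?thesis using add3[of "c div 3 + 1"] by (simp add: algebra_simps)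
  qed
qed

text \<open>An element outside \<open>P\<close> is congruent to 1 or -1, so multiplying by it
  changes the other factor at most by a sign modulo \<open>P\<close>.\<close>

lemma P_prime: assumes x: "x \<in> R" "x \<notin> P" and y: "y \<in> R" "y \<notin> P" shows "x * y \<notin> P"
proof
  assume xy: "x * y \<in> P"
  consider "x - 1 \<in> P" | "x + 1 \<in> P" using residue_R x by blast
  hence "y \<in> P"
  proof cases
    case 1
    from P_diff[OF xy P_mult[OF 1 y(1)]] show ?thesis by (simp add: algebra_simps)
  next
    case 2
    from P_diff[OF P_mult[OF 2 y(1)] xy] show ?thesis by (simp add: algebra_simps)
  qed
  thus False using y by blast
qed

lemma w_neq_1: "1 - w \<noteq> 0"
  using one_minus_power[of 1] three_in_P unfolding P_def by auto

text \<open>Otherwise \<open>x\<close> would be divisible by every power of \<open>1 - w\<close>,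
  and so would a nonzero integer multiple of \<open>x\<close>.\<close>

lemma R_factor: assumes "x \<in> R" "x \<noteq> 0" obtains k u where "u \<in> R" "u \<notin> P" "x = (1 - w) ^ k * u"
proof -
  have "\<exists>k u. u \<in> R \<and> u \<notin> P \<and> x = (1 - w) ^ k * u"
  proof (rule ccontr)
    assume neg: "\<not> ?thesis"
    have pow: "\<exists>y\<in>R. x = (1 - w) ^ k * y" for k
    proof (induction k)
      case (Suc k)
      then obtain y where y: "y \<in> R" "x = (1 - w) ^ k * y" by blast
      hence "y \<in> P" using neg by blast
      then obtain z where "z \<in> R" "y = (1 - w) * z" unfolding P_def by blast
      thus ?case using y by (intro bexI[of _ z]) simp_all
    qed (use assms in simp)
    obtain y m where m: "y \<in> R" "m \<noteq> 0" "x * y = of_int m" using divides_int_in_R assms by blast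
    have "\<exists>z\<in>R. of_int m = (1 - w) ^ k * z" for k
    proof -
      obtain z where "z \<in> R" "x = (1 - w) ^ k * z" using pow by blast
      thus ?thesis using m by (intro bexI[of _ "z * y"]) (auto simp flip: m(3))
    qed
    from not_pow_dvd_int[OF this] show False using m by simp
  qed
  thus ?thesis using that by blast
qed

text \<open>The valuation as a relation, without a choice of representation. The exponent is unique
  because \<open>P\<close> is prime, so \<open>val\<close> can later be read off with
  \<open>THE\<close>.\<close>

definition has_val :: "complex \<Rightarrow> int \<Rightarrow> bool" where
  "has_val x k \<longleftrightarrow> (\<exists>a\<in>R - P. \<exists>b\<in>R - P. x = (1 - w) powi k * (a / b))"

lemma zero_in_P: "0 \<in> P" using one_minus_power[of 0] by simp

lemma has_val_unique_le: assumes "has_val x k" "has_val x l" shows "k \<le> l"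
proof (rule ccontr)
  assume "\<not> k \<le> l"
  obtain a b c d where e: "a \<in> R - P" "b \<in> R - P" "x = (1 - w) powi k * (a / b)"
    "c \<in> R - P" "d \<in> R - P" "x = (1 - w) powi l * (c / d)" using assms unfolding has_val_def by metis
  have nz: "b \<noteq> 0" "d \<noteq> 0" using e zero_in_P by auto
  have "(1 - w) powi k * (a / b) = (1 - w) powi l * (c / d)" using e by simp
  hence "(1 - w) powi k * (a * d) = (1 - w) powi l * (b * c)" using nz by (simp add: field_simps)
  moreover have "(1 - w) powi k = (1 - w) powi l * (1 - w) powi (k - l)"
    using w_neq_1 by (simp add: power_int_diff)
  ultimately have "(1 - w) powi (k - l) * (a * d) = b * c" using w_neq_1 by simp
  moreover have "(1 - w) powi (k - l) = (1 - w) * (1 - w) ^ nat (k - l - 1)"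
  proof -
    have "k - l = int (Suc (nat (k - l - 1)))" using \<open>\<not> k \<le> l\<close> by simp
    thus ?thesis by (metis power_Suc power_int_of_nat)
  qed
  ultimately have "b * c = (1 - w) * ((1 - w) ^ nat (k - l - 1) * (a * d))" by (simp add: mult.assoc)
  hence "b * c \<in> P" unfolding P_def using e int_adjoin_gen by (auto intro!: imageI int_adjoin_mult int_adjoin_power int_adjoin_diff)
  thus False using P_prime e by blast
qed

lemma has_val_unique: "has_val x k \<Longrightarrow> has_val x l \<Longrightarrow> k = l"
  using has_val_unique_le by (simp add: order_antisym)

lemma has_val_R: assumes "x \<in> R" "x \<noteq> 0" obtains k where "has_val x (int k)"
proof -
  obtain k u where "u \<in> R" "u \<notin> P" "x = (1 - w) ^ k * u" using R_factor assms by blast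
  hence "has_val x (int k)" unfolding has_val_def using one_notin_P
    by (intro bexI[of _ u] bexI[of _ 1]) auto
  thus ?thesis using that by blast
qed

lemma has_val_mult: assumes "has_val x k" "has_val y l" shows "has_val (x * y) (k + l)"
proof -
  obtain a b c d where e: "a \<in> R - P" "b \<in> R - P" "x = (1 - w) powi k * (a / b)"
    "c \<in> R - P" "d \<in> R - P" "y = (1 - w) powi l * (c / d)" using assms unfolding has_val_def by metis
  have "x * y = (1 - w) powi (k + l) * ((a * c) / (b * d))" unfolding e(3,6) using w_neq_1 by (simp add: power_int_add)
  moreover have "a * c \<in> R - P" "b * d \<in> R - P" using e P_prime int_adjoin_mult by blast+
  ultimately show ?thesis unfolding has_val_def by blast
qed

lemma has_val_inverse: assumes "has_val x k" shows "has_val (inverse x) (- k)"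
proof -
  obtain a b where e: "a \<in> R - P" "b \<in> R - P" "x = (1 - w) powi k * (a / b)"
    using assms unfolding has_val_def by metis
  hence "inverse x = (1 - w) powi (- k) * (b / a)" by (simp add: power_int_minus field_simps)
  thus ?thesis unfolding has_val_def using e by blast
qed

lemma has_val_exists: assumes "x \<in> K" "x \<noteq> 0" obtains k where "has_val x k"
proof -
  obtain a m where e: "x = a / of_int m" "a \<in> R" "m \<noteq> 0" using assms unfolding K_def by blast
  have "a \<noteq> 0" using e(1) assms(2) by auto
  obtain k where k: "has_val a (int k)" by (rule has_val_R[OF e(2) \<open>a \<noteq> 0\<close>])
  have "of_int m \<noteq> (0::complex)" using e(3) by simp
  then obtain l where l: "has_val (of_int m) (int l)" using has_val_R[OF int_adjoin_of_int] by blast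
  have "has_val x (int k + - int l)" unfolding e(1) divide_inverse
    by (rule has_val_mult[OF k has_val_inverse[OF l]])
  thus ?thesis using that by blast
qed

lemma has_val_add: assumes "has_val x k" "has_val y l" "x + y \<noteq> 0" "k \<le> l"
  obtains m where "has_val (x + y) m" "k \<le> m"
proof -
  obtain a b c d where e: "a \<in> R - P" "b \<in> R - P" "x = (1 - w) powi k * (a / b)"
    "c \<in> R - P" "d \<in> R - P" "y = (1 - w) powi l * (c / d)" using assms unfolding has_val_def by metis
  have nz: "b \<noteq> 0" "d \<noteq> 0" using e zero_in_P by auto
  define s where "s = a * d + (1 - w) ^ nat (l - k) * (b * c)"
  have "(1 - w) powi l = (1 - w) powi k * (1 - w) powi int (nat (l - k))"
    using w_neq_1 assms(4) by (simp flip: power_int_add)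
  hence "(1 - w) powi l = (1 - w) powi k * (1 - w) ^ nat (l - k)" by (simp only: power_int_of_nat)
  moreover have "s / (b * d) = a / b + (1 - w) ^ nat (l - k) * (c / d)"
    unfolding s_def add_divide_distrib using nz by simp
  ultimately have xy: "x + y = (1 - w) powi k * (s / (b * d))"
    unfolding e(3,6) by (simp only: distrib_left mult.assoc)
  have "s \<in> R" unfolding s_def using e
    by (intro int_adjoin_add int_adjoin_mult int_adjoin_power int_adjoin_diff int_adjoin_1 int_adjoin_gen) auto
  moreover have "s \<noteq> 0" using xy assms(3) by auto
  ultimately obtain j where j: "has_val s (int j)" using has_val_R by blast
  have "has_val (b * d) 0" unfolding has_val_def using e P_prime one_notin_P
    by (intro bexI[of _ "b * d"] bexI[of _ 1]) auto
  moreover have "has_val ((1 - w) powi k) k" unfolding has_val_def using one_notin_P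
    by (intro bexI[of _ 1]) auto
  ultimately have "has_val (x + y) (k + (int j + - 0))" unfolding xy divide_inverse
    using j by (intro has_val_mult has_val_inverse)
  thus ?thesis using that by force
qed

lemma P_val: assumes "x \<in> P" "x \<noteq> 0" "has_val x k" shows "k > 0"
proof -
  obtain y where y: "y \<in> R" "x = (1 - w) * y" using assms unfolding P_def by blast
  have "y \<noteq> 0" using y(2) assms(2) by auto
  then obtain j where "has_val y (int j)" using has_val_R[OF y(1)] by blast
  moreover have "has_val (1 - w) 1" unfolding has_val_def using one_notin_P by (intro bexI[of _ 1]) auto
  ultimately have "has_val x (1 + int j)" unfolding y(2) by (intro has_val_mult)
  thus ?thesis using has_val_unique assms(3) by force
qed

definition val :: "complex \<Rightarrow> int" where "val x = (THE k. has_val x k)"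

lemma val_eq: "has_val x k \<Longrightarrow> val x = k" unfolding val_def using has_val_unique by blast

lemma has_val_val: "x \<in> K \<Longrightarrow> x \<noteq> 0 \<Longrightarrow> has_val x (val x)" using has_val_exists val_eq by metis

lemma val_add:
  assumes "x \<in> K" "y \<in> K" "x \<noteq> 0" "y \<noteq> 0" "x + y \<noteq> 0" shows "min (val x) (val y) \<le> val (x + y)"
  using has_val_add[OF has_val_val has_val_val, of x y] has_val_add[OF has_val_val has_val_val, of y x] assms val_eq
  by (metis add.commute linorder_linear min_def)

lemma val_residue: assumes "x \<in> K" "x \<noteq> 0" "val x = 0"
  shows "x = 1 \<or> x = -1 \<or> val (x - 1) > 0 \<or> val (x + 1) > 0"
proof -
  have "has_val x 0" using has_val_val assms by metis
  then obtain a b where e: "a \<in> R - P" "b \<in> R - P" "x = a / b" unfolding has_val_def by auto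
  have b: "b \<noteq> 0" using e zero_in_P by auto
  have "a - b \<in> P \<or> a + b \<in> P"
  proof -
    have "a - 1 \<in> P \<or> a + 1 \<in> P" "b - 1 \<in> P \<or> b + 1 \<in> P" using residue_R e by blast+
    moreover have "(a - 1) - (b - 1) = a - b" "(a + 1) - (b + 1) = a - b" "(a - 1) + (b + 1) = a + b"
      "(a + 1) + (b - 1) = a + b" by simp_all
    ultimately show ?thesis using P_add P_diff by metis
  qed
  moreover have pos: "val (c / b) > 0" if c: "c \<in> P" "c \<noteq> 0" for c
  proof -
    obtain j where j: "has_val c (int j)" using has_val_R P_subset c by metis
    hence "j > 0" using P_val c by force
    moreover have "has_val b 0" unfolding has_val_def using e one_notin_P by (intro bexI[of _ b] bexI[of _ 1]) auto
    hence "has_val (c / b) (int j + - 0)" unfolding divide_inverse using j by (intro has_val_mult has_val_inverse)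
    ultimately show ?thesis using val_eq by force
  qed
  moreover have "x - 1 = (a - b) / b" "x + 1 = (a + b) / b" using e b by (simp_all add: field_simps)
  ultimately show ?thesis by (metis eq_iff_diff_eq_0 eq_neg_iff_add_eq_0 divide_eq_0_iff)
qed

lemma valued_subfield_K: "valued_subfield K val"
proof unfold_locales
  show "val (x * y) = val x + val y" if "x \<in> K" "y \<in> K" "x \<noteq> 0" "y \<noteq> 0" for x y
    by (intro val_eq has_val_mult has_val_val that)
  show "val 3 > 0" using P_val[OF three_in_P] has_val_val[of 3] R_subset_K by force
qed (use R_subset_K K_add K_mult K_minus K_inverse val_add val_residue in auto)

end

section \<open>The layers of the cyclotomic tower\<close>

definition cyclo :: "nat \<Rightarrow> complex" where "cyclo n = cis (2 * pi / 3 ^ n)"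

lemma cyclo_power: "cyclo n ^ 3 ^ n = 1"
  by (simp add: cyclo_def Complex.DeMoivre)

lemma cyclo_Suc: "cyclo (Suc n) ^ 3 = cyclo n"
  by (simp add: cyclo_def Complex.DeMoivre)

lemma cyclo_root_of_unity: "root_of_unity (cyclo n) (3 ^ n)"
  by unfold_locales (simp_all add: cyclo_power)

lemma cyclo_1: "1 + cyclo 1 + cyclo 1 ^ 2 = 0"
proof -
  have "(1 - cyclo 1) * (1 + cyclo 1 + cyclo 1 ^ 2) = 1 - cyclo 1 ^ 3"
    by (simp add: algebra_simps power2_eq_square power3_eq_cube)
  also have "\<dots> = 0" using cyclo_power[of 1] by simp
  finally have "1 - cyclo 1 = 0 \<or> ?thesis" unfolding mult_eq_0_iff .
  moreover have "1 - cyclo 1 \<noteq> 0" by (simp add: cyclo_def complex_eq_iff cos_120)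
  ultimately show ?thesis by blast
qed

lemma cyclo_root_of_unity_3: "root_of_unity_3 (cyclo (Suc n)) (Suc n) (cyclo 1)"
proof -
  interpret root_of_unity "cyclo (Suc n)" "3 ^ Suc n" by (rule cyclo_root_of_unity)
  have "cyclo (Suc n) ^ 3 ^ n = cyclo 1"
  proof (induction n)
    case (Suc n) thus ?case by (simp add: power_mult cyclo_Suc)
  qed simp
  thus ?thesis by unfold_locales (use cyclo_1 in simp_all)
qed

abbreviation cyclo_field :: "nat \<Rightarrow> complex set" where "cyclo_field n \<equiv> root_of_unity.K (cyclo n)"

lemma cyclo_field_mono: assumes "m \<le> n" shows "cyclo_field m \<subseteq> cyclo_field n"
proof (rule lift_Suc_mono_le[OF _ assms])
  fix n
  interpret a: root_of_unity "cyclo n" "3 ^ n" by (rule cyclo_root_of_unity)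
  interpret b: root_of_unity "cyclo (Suc n)" "3 ^ Suc n" by (rule cyclo_root_of_unity)
  have "cyclo (Suc n) ^ 3 \<in> b.R" by (intro int_adjoin_power int_adjoin_gen)
  hence "cyclo n \<in> b.R" unfolding cyclo_Suc .
  hence "a.R \<subseteq> b.R" by (rule int_adjoin_subset)
  thus "a.K \<subseteq> b.K" unfolding a.K_def b.K_def by blast
qed

text \<open>The layers form a chain, so that any two elements lie in a common one and the union is
  closed under the field operations.\<close>

lemma Q_zeta_in_cyclo_field: "x \<in> Q_zeta_3_inf \<Longrightarrow> \<exists>n. x \<in> cyclo_field n"
proof (induction rule: Q_zeta_induct)
  case one
  interpret root_of_unity "cyclo 0" "3 ^ 0" by (rule cyclo_root_of_unity)
  show ?case using R_subset_K[of 1] by auto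
next
  case (root z n)
  interpret root_of_unity "cyclo n" "3 ^ n" by (rule cyclo_root_of_unity)
  obtain k where "z = cis (2 * pi * real k / real (3 ^ n))"
    using bij_betw_roots_unity[of "3 ^ n"] root unfolding bij_betw_def by auto
  hence "z = cyclo n ^ k" by (simp add: cyclo_def Complex.DeMoivre mult_ac)
  thus ?case using R_subset_K[of z] by (auto intro!: int_adjoin_power int_adjoin_gen)
next
  case (minus x)
  then obtain n where n: "x \<in> cyclo_field n" by blast
  interpret root_of_unity "cyclo n" "3 ^ n" by (rule cyclo_root_of_unity)
  show ?case using K_minus[OF n] by blast
next
  case (inverse x)
  then obtain n where n: "x \<in> cyclo_field n" by blast
  interpret root_of_unity "cyclo n" "3 ^ n" by (rule cyclo_root_of_unity)
  show ?case using K_inverse[OF n] by blast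
next
  case (add x y)
  then obtain m n where n: "x \<in> cyclo_field m" "y \<in> cyclo_field n" by blast
  interpret root_of_unity "cyclo (max m n)" "3 ^ max m n" by (rule cyclo_root_of_unity)
  have "x \<in> K" "y \<in> K" using n cyclo_field_mono[of m "max m n"] cyclo_field_mono[of n "max m n"] by auto
  thus ?case using K_add by blast
next
  case (mult x y)
  then obtain m n where n: "x \<in> cyclo_field m" "y \<in> cyclo_field n" by blast
  interpret root_of_unity "cyclo (max m n)" "3 ^ max m n" by (rule cyclo_root_of_unity)
  have "x \<in> K" "y \<in> K" using n cyclo_field_mono[of m "max m n"] cyclo_field_mono[of n "max m n"] by auto
  thus ?case using K_mult by blast
qed

text \<open>The layer is \<open>Suc n\<close> rather than \<open>n\<close> so that it contains a
  primitive cube root of unity. Finitely many elements are enough, since only \<open>t\<close> and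
  the coordinates of one point occur at a time.\<close>

lemma Q_zeta_valued_subfield:
  assumes "finite F" "F \<subseteq> Q_zeta_3_inf" obtains K v where "valued_subfield K v" "F \<subseteq> K"
proof -
  obtain f where f: "\<And>x. x \<in> F \<Longrightarrow> x \<in> cyclo_field (f x)" using Q_zeta_in_cyclo_field assms(2) by (metis subsetD)
  obtain n where n: "\<And>x. x \<in> F \<Longrightarrow> f x \<le> n" using assms(1)
    by (metis Max_ge finite_imageI imageI)
  interpret root_of_unity_3 "cyclo (Suc n)" "Suc n" "cyclo 1" by (rule cyclo_root_of_unity_3)
  have "F \<subseteq> K"
  proof
    fix x assume "x \<in> F"
    hence "x \<in> cyclo_field (f x)" "f x \<le> Suc n" using f n by (auto simp: le_Suc_eq)
    thus "x \<in> K" using cyclo_field_mono by blast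
  qed
  thus ?thesis using that valued_subfield_K by blast
qed

lemma Q_zeta_power_neq_2_mod_4:
  assumes "z \<in> Q_zeta_3_inf" "2 \<le> k" "c mod 4 = 2" shows "z ^ k \<noteq> of_int c"
proof -
  obtain n where n: "z \<in> cyclo_field n" using Q_zeta_in_cyclo_field assms(1) by blast
  interpret root_of_unity "cyclo n" "3 ^ n" by (rule cyclo_root_of_unity)
  show ?thesis using power_neq_2_mod_4[OF _ assms(2,3) n] by simp
qed

section \<open>Torsion near the prime above 3\<close>

context valued_subfield
begin

lemma zero_closed: "0 \<in> K" using add_closed[OF one_closed minus_closed[OF one_closed]] by simp

lemma diff_closed: "x \<in> K \<Longrightarrow> y \<in> K \<Longrightarrow> x - y \<in> K"
  using add_closed[of x "- y"] minus_closed by simp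

lemma divide_closed: "x \<in> K \<Longrightarrow> y \<in> K \<Longrightarrow> x / y \<in> K"
  unfolding divide_inverse by (intro mult_closed inverse_closed)

lemma power_closed: "x \<in> K \<Longrightarrow> x ^ k \<in> K"
  by (induction k) (auto intro: one_closed mult_closed)

lemma of_nat_closed: "of_nat n \<in> K"
  by (induction n) (auto intro: zero_closed one_closed add_closed)

lemma numeral_closed: "numeral n \<in> K"
  using of_nat_closed[of "numeral n"] by simp

lemmas closed = zero_closed one_closed add_closed diff_closed minus_closed mult_closed divide_closed
  inverse_closed power_closed numeral_closed

lemma v_1: "v 1 = 0" using v_mult[OF one_closed one_closed] by simp

lemma v_minus: assumes "x \<in> K" "x \<noteq> 0" shows "v (- x) = v x"
proof -
  have "v (-1) = 0" using v_mult[of "-1" "-1"] v_1 minus_closed[OF one_closed] by simp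
  thus ?thesis using v_mult[of "-1" x] assms minus_closed[OF one_closed] by simp
qed

lemma v_divide: assumes "x \<in> K" "y \<in> K" "x \<noteq> 0" "y \<noteq> 0" shows "v (x / y) = v x - v y"
  using v_mult[of "x / y" y] assms divide_closed by simp

lemma v_square: "x \<in> K \<Longrightarrow> x \<noteq> 0 \<Longrightarrow> v (x^2) = 2 * v x"
  unfolding power2_eq_square by (simp add: v_mult)

text \<open>The fractional ideal of elements of valuation at least \<open>k\<close>, with the
  valuation of 0 read as infinity.\<close>

definition v_ge :: "int \<Rightarrow> complex \<Rightarrow> bool" where
  "v_ge k x \<longleftrightarrow> x \<in> K \<and> (x = 0 \<or> k \<le> v x)"

lemma v_geI: "x \<in> K \<Longrightarrow> k \<le> v x \<Longrightarrow> v_ge k x" unfolding v_ge_def by blast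

lemma v_ge_mono: "v_ge k x \<Longrightarrow> l \<le> k \<Longrightarrow> v_ge l x" unfolding v_ge_def by auto

lemma v_ge_minus: "v_ge k x \<Longrightarrow> v_ge k (- x)"
  using v_minus[of x] minus_closed[of x] by (cases "x = 0") (simp_all add: v_ge_def)

lemma v_ge_add: assumes "v_ge k x" "v_ge k y" shows "v_ge k (x + y)"
proof (cases "x = 0 \<or> y = 0 \<or> x + y = 0")
  case False
  thus ?thesis using assms v_add[of x y] add_closed unfolding v_ge_def by force
qed (use assms zero_closed in \<open>auto simp: v_ge_def\<close>)

lemma v_ge_diff: "v_ge k x \<Longrightarrow> v_ge k y \<Longrightarrow> v_ge k (x - y)"
  using v_ge_add[of k x "- y"] v_ge_minus by simp

lemma v_ge_mult: assumes "v_ge k x" "v_ge l y" shows "v_ge (k + l) (x * y)"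
  using assms v_mult[of x y] mult_closed zero_closed unfolding v_ge_def by fastforce

lemma v_add_eq: assumes "x \<in> K" "x \<noteq> 0" "v_ge (v x + 1) y" shows "x + y \<noteq> 0" "v (x + y) = v x"
proof -
  show nz: "x + y \<noteq> 0"
  proof
    assume "x + y = 0"
    hence "y = - x" by (simp add: add_eq_0_iff)
    thus False using assms v_minus unfolding v_ge_def by simp
  qed
  have "v_ge (v x) (x + y)" using assms by (intro v_ge_add v_ge_mono[OF assms(3)]) (auto simp: v_ge_def)
  hence "v x \<le> v (x + y)" using nz unfolding v_ge_def by blast
  moreover have "\<not> v x + 1 \<le> v (x + y)"
  proof
    assume "v x + 1 \<le> v (x + y)"
    hence "v_ge (v x + 1) (x + y)" using assms add_closed unfolding v_ge_def by blast
    from v_ge_diff[OF this assms(3)] show False using assms(2) unfolding v_ge_def by simp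
  qed
  ultimately show "v (x + y) = v x" by simp
qed

lemma v_2: "v 2 = 0"
proof -
  have "v_ge (v (-1) + 1) 3" using v_3 v_minus[of 1] v_1 one_closed numeral_closed unfolding v_ge_def by simp
  from v_add_eq(2)[OF minus_closed[OF one_closed] _ this] show ?thesis using v_minus[of 1] v_1 one_closed by simp
qed

text \<open>The residues of \<open>(x - e1) / (e2 - e1)\<close> at \<open>x = e1, e2, e3\<close> are
  0, 1 and -1, which exhausts the residue field; so every \<open>x\<close> in the disc is closer to
  one of the roots.\<close>

lemma nearest_root:
  assumes K: "x \<in> K" "e1 \<in> K" "e2 \<in> K" "e3 \<in> K"
    and d: "v (e2 - e1) = \<delta>" "v (e3 - e1) = \<delta>" "v (e3 - e2) = \<delta>" and ne: "e1 \<noteq> e2" "e1 \<noteq> e3" "e2 \<noteq> e3"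
    and x: "v_ge \<delta> (x - e1)"
  shows "v_ge (\<delta> + 1) (x - e1) \<or> v_ge (\<delta> + 1) (x - e2) \<or> v_ge (\<delta> + 1) (x - e3)"
proof (rule ccontr)
  assume neg: "\<not> ?thesis"
  let ?g = "e2 - e1"
  have g: "?g \<in> K" "?g \<noteq> 0" "v_ge \<delta> ?g" using K ne d by (auto simp: closed v_ge_def)
  have scale: "v_ge (\<delta> + 1) z" if "z = ?g * c" "c = 0 \<or> v c > 0" "c \<in> K" for z c
    using v_ge_mult[of \<delta> ?g 1 c] g that unfolding v_ge_def by auto
  have cases: "v_ge (\<delta> + 1) (z - ?g) \<or> v_ge (\<delta> + 1) (z + ?g)" if z: "z \<in> K" "z \<noteq> 0" "v z = \<delta>" for z
  proof -
    define c where "c = z / ?g"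
    have c: "c \<in> K" "c \<noteq> 0" "v c = 0" "c - 1 \<in> K" "c + 1 \<in> K"
      using z g d v_divide[of z ?g] by (auto simp: c_def closed)
    have "z - ?g = ?g * (c - 1)" "z + ?g = ?g * (c + 1)" using g(2) by (simp_all add: c_def field_simps)
    moreover have "c - 1 = 0 \<or> c + 1 = 0 \<or> v (c - 1) > 0 \<or> v (c + 1) > 0"
      using residue[OF c(1,2,3)] by (auto simp: eq_neg_iff_add_eq_0)
    ultimately show ?thesis using scale c by metis
  qed
  have "x - e1 \<in> K" "x \<noteq> e1" "v (x - e1) = \<delta>" using neg x by (auto simp: v_ge_def)
  hence "v_ge (\<delta> + 1) (x - e1 + ?g)" using cases[of "x - e1"] neg by auto
  moreover have "v_ge (\<delta> + 1) (e3 - e1 + ?g)"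
    using cases[of "e3 - e1"] K ne d by (auto simp: v_ge_def closed)
  ultimately have "v_ge (\<delta> + 1) ((x - e1 + ?g) - (e3 - e1 + ?g))" by (rule v_ge_diff)
  thus False using neg by simp
qed

text \<open>The reduced point has a vertical tangent. The derivative of the cubic has valuation
  exactly \<open>2 \<delta>\<close>, while \<open>2 * v y\<close> exceeds \<open>3 \<delta>\<close>;
  hence \<open>v (l^2) < \<delta>\<close>, and \<open>l^2\<close> dominates the new
  abscissa.\<close>

lemma double_leaves_disc:
  assumes K: "x \<in> K" "y \<in> K" "e1 \<in> K" "e2 \<in> K" "e3 \<in> K"
    and d: "v (e2 - e1) = \<delta>" "v (e3 - e1) = \<delta>" "e1 \<noteq> e2" "e1 \<noteq> e3"
    and x: "v_ge (\<delta> + 1) (x - e1)" and y: "y \<noteq> 0" "y^2 = (x - e1) * (x - e2) * (x - e3)"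
    and l: "l * (2 * y) = (x - e1) * (x - e2) + (x - e1) * (x - e3) + (x - e2) * (x - e3)"
    and x': "x' = l^2 + (e1 + e2 + e3) - 2 * x"
  shows "\<not> v_ge \<delta> (x' - e1)"
proof -
  have shift: "x - e \<noteq> 0 \<and> v (x - e) = \<delta>" if "e \<in> K" "v (e - e1) = \<delta>" "e \<noteq> e1" for e
  proof -
    have "v (e1 - e) = \<delta>" using v_minus[of "e - e1"] that K by (simp add: closed)
    thus ?thesis using v_add_eq[of "e1 - e" "x - e1"] that x K by (simp add: closed)
  qed
  note s = shift[OF K(4) d(1)] shift[OF K(5) d(2)]
  hence s2: "x - e2 \<noteq> 0" "v (x - e2) = \<delta>" and s3: "x - e3 \<noteq> 0" "v (x - e3) = \<delta>" using d by auto
  have x1: "x - e1 \<noteq> 0" using y by auto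
  hence v1: "\<delta> + 1 \<le> v (x - e1)" using x unfolding v_ge_def by blast
  have "2 * v y = v (x - e1) + \<delta> + \<delta>"
    using v_square[of y] v_mult[of "(x - e1) * (x - e2)" "x - e3"] v_mult[of "x - e1" "x - e2"] s2 s3 x1 y K
    by (simp add: closed)
  have "v_ge (\<delta> + 1 + \<delta>) ((x - e1) * ((x - e2) + (x - e3)))"
    using s2 s3 K by (intro v_ge_mult x v_ge_add v_geI) (auto simp: closed)
  moreover have v23: "v ((x - e2) * (x - e3)) = 2 * \<delta>" using v_mult[of "x - e2" "x - e3"] s2 s3 K by (simp add: closed)
  moreover have "(x - e2) * (x - e3) \<in> K" "(x - e2) * (x - e3) \<noteq> 0" using s2 s3 K by (simp_all add: closed)
  ultimately have "(x - e2) * (x - e3) + (x - e1) * ((x - e2) + (x - e3)) \<noteq> 0"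
    "v ((x - e2) * (x - e3) + (x - e1) * ((x - e2) + (x - e3))) = 2 * \<delta>"
    using v_add_eq[of "(x - e2) * (x - e3)" "(x - e1) * ((x - e2) + (x - e3))"]
    by (simp_all add: add.commute)
  moreover have "(x - e2) * (x - e3) + (x - e1) * ((x - e2) + (x - e3)) = l * (2 * y)"
    unfolding l by (simp add: algebra_simps)
  ultimately have ly: "l * (2 * y) \<noteq> 0" "v (l * (2 * y)) = 2 * \<delta>" by simp_all
  have "l = (l * (2 * y)) / (2 * y)" using y by simp
  hence lK: "l \<in> K" unfolding l using K by (metis (no_types, lifting) closed)
  have "l \<noteq> 0" using ly by auto
  have "v l + v y = 2 * \<delta>"
    using v_mult[of l "2 * y"] v_mult[of 2 y] ly lK K v_2 \<open>l \<noteq> 0\<close> y by (simp add: closed)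
  hence vl: "v (l^2) < \<delta>" using v_square[OF lK \<open>l \<noteq> 0\<close>] \<open>2 * v y = _\<close> v1 by simp
  have "v_ge \<delta> (- (x - e2) - (x - e3))"
    using s2 s3 K by (intro v_ge_diff v_ge_minus v_geI) (auto simp: closed)
  hence "v_ge (v (l^2) + 1) (- (x - e2) - (x - e3))" using vl by (elim v_ge_mono) simp
  from v_add_eq[OF _ _ this] have "l^2 + (- (x - e2) - (x - e3)) \<noteq> 0" "v (l^2 + (- (x - e2) - (x - e3))) < \<delta>"
    using lK \<open>l \<noteq> 0\<close> vl by (auto simp: closed)
  moreover have "x' - e1 = l^2 + (- (x - e2) - (x - e3))" unfolding x' by simp
  ultimately show ?thesis unfolding v_ge_def by auto
qed

text \<open>
  Near the origin of the reduced curve $y^2 = \pm (x^3 - x)$ over the field with three elements,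
  tripling strictly decreases the valuation of the \<open>x\<close>-coordinate: modulo higher order terms
  $2 Q$ agrees with $- Q$, so the chord through \<open>Q\<close> and \<open>2 Q\<close> is steep.
\<close>

lemma triple_deepens:
  assumes K: "x \<in> K" "y \<in> K" "e1 \<in> K" "e2 \<in> K" "e3 \<in> K"
    and d: "v (e2 - e1) = \<delta>" "v (e3 - e1) = \<delta>"
    and x: "\<not> v_ge \<delta> (x - e1)" and y: "y^2 = (x - e1) * (x - e2) * (x - e3)"
    and l: "l * (2 * y) = (x - e1) * (x - e2) + (x - e1) * (x - e3) + (x - e2) * (x - e3)"
    and x2: "x2 = l^2 + (e1 + e2 + e3) - 2 * x" and y2: "y2 = - (l * (x2 - x) + y)"
    and l': "x2 \<noteq> x \<Longrightarrow> l' * (x - x2) = y - y2" and x3: "x3 = l'^2 + (e1 + e2 + e3) - x2 - x"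
  shows "y \<noteq> 0" "y2 \<noteq> y" "x2 \<noteq> x \<Longrightarrow> x3 \<noteq> e1 \<and> v (x3 - e1) < v (x - e1)"
proof -
  define a where "a = v (x - e1)"
  have x1: "x - e1 \<noteq> 0" "a < \<delta>" using x K unfolding v_ge_def a_def by (auto simp: closed)
  have shift: "x - e \<noteq> 0 \<and> v (x - e) = a" if "e \<in> K" "v (e - e1) = \<delta>" for e
  proof -
    have "v_ge (a + 1) (e1 - e)" using v_ge_minus[of "a + 1" "e - e1"] that K x1 by (simp add: v_ge_def closed)
    thus ?thesis using v_add_eq[of "x - e1" "e1 - e"] that x1 K by (simp add: closed a_def)
  qed
  note s2 = shift[OF K(4) d(1)] and s3 = shift[OF K(5) d(2)]
  show y0: "y \<noteq> 0" using s2 s3 x1 y by auto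
  have vy: "2 * v y = 3 * a"
    using v_square[of y] v_mult[of "(x - e1) * (x - e2)" "x - e3"] v_mult[of "x - e1" "x - e2"] s2 s3 x1 y y0 K
    by (simp add: closed a_def)
  have X: "v_ge a (x - e1)" and d2: "v_ge (a + 1) (e1 - e2)" and d3: "v_ge (a + 1) (e1 - e3)"
    using v_ge_minus[of "a + 1" "e2 - e1"] v_ge_minus[of "a + 1" "e3 - e1"] d K x1
    by (simp_all add: v_ge_def closed a_def)
  have three: "v_ge 1 3" and two: "v_ge 0 2" using v_3 v_2 by (simp_all add: v_ge_def closed)
  \<comment> \<open>The derivative of the cubic, expanded in \<open>x - e1\<close>. Its first term
    gains from \<open>v 3 > 0\<close>, the other two from the root differences having valuation
    above \<open>a\<close>; so the tangent at \<open>Q\<close> is flatter than expected.\<close>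
  have "v_ge (2 * a + 1) (3 * ((x - e1) * (x - e1)) + 2 * ((x - e1) * ((e1 - e2) + (e1 - e3))) + (e1 - e2) * (e1 - e3))"
  proof (intro v_ge_add)
    show "v_ge (2 * a + 1) (3 * ((x - e1) * (x - e1)))"
      by (rule v_ge_mono[OF v_ge_mult[OF three v_ge_mult[OF X X]]]) simp
    show "v_ge (2 * a + 1) (2 * ((x - e1) * ((e1 - e2) + (e1 - e3))))"
      by (rule v_ge_mono[OF v_ge_mult[OF two v_ge_mult[OF X v_ge_add[OF d2 d3]]]]) simp
    show "v_ge (2 * a + 1) ((e1 - e2) * (e1 - e3))"
      by (rule v_ge_mono[OF v_ge_mult[OF d2 d3]]) simp
  qed
  also have "3 * ((x - e1) * (x - e1)) + 2 * ((x - e1) * ((e1 - e2) + (e1 - e3))) + (e1 - e2) * (e1 - e3) = l * (2 * y)"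
    unfolding l by (simp add: algebra_simps)
  finally have lv: "v_ge (2 * a + 1) (l * (2 * y))" .
  have "l = (l * (2 * y)) / (2 * y)" using y0 by simp
  hence lK: "l \<in> K" unfolding l using K by (metis (no_types, lifting) closed)
  have v2y: "v (2 * y) = v y" using v_mult[of 2 y] v_2 K y0 by (simp add: closed)
  have vl: "v_ge (2 * a + 1 - v y) l"
  proof (cases "l = 0")
    case False
    hence "v (l * (2 * y)) = v l + v y" using v_mult[of l "2 * y"] v2y lK y0 K by (simp add: closed)
    thus ?thesis using lv lK y0 False by (simp add: v_ge_def)
  qed (simp add: v_ge_def closed)
  have l2: "v_ge (a + 1) (l * l)" by (rule v_ge_mono[OF v_ge_mult[OF vl vl]]) (use vy in simp)
  have K2: "x2 \<in> K" unfolding x2 using lK K by (simp add: closed)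
  have "v_ge (a + 1) (l * l - 3 * (x - e1) - (e1 - e2) - (e1 - e3))"
    using v_ge_mult[OF three X] by (intro v_ge_diff l2 d2 d3) (simp add: add.commute)
  also have "l * l - 3 * (x - e1) - (e1 - e2) - (e1 - e3) = x2 - x"
    unfolding x2 by (simp add: power2_eq_square algebra_simps)
  finally have dx: "v_ge (a + 1) (x2 - x)" .
  have w: "v_ge (v y + 1) (l * (x2 - x))"
    by (rule v_ge_mono[OF v_ge_mult[OF vl dx]]) (use vy in simp)
  \<comment> \<open>\<open>y - y2 = 2 * y + l * (x2 - x)\<close>, where the second summand has
    larger valuation.\<close>
  have yy: "y - y2 \<noteq> 0" "v (y - y2) = v y"
    using v_add_eq[of "2 * y" "l * (x2 - x)"] w v2y K y0 by (simp_all add: closed y2 algebra_simps)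
  thus "y2 \<noteq> y" by auto
  assume ne: "x2 \<noteq> x"
  have x0: "x - x2 \<noteq> 0" "x - x2 \<in> K" "a + 1 \<le> v (x - x2)"
    using ne dx v_ge_minus[OF dx] K K2 by (auto simp: v_ge_def closed)
  have yK: "y2 \<in> K" unfolding y2 using lK K K2 by (simp add: closed)
  have l'eq: "l' = (y - y2) / (x - x2)" using l'[OF ne] x0 by (simp add: field_simps)
  have l'K: "l' \<in> K" "l' \<noteq> 0" "v l' \<le> v y - a - 1"
    using v_divide[of "y - y2" "x - x2"] yy x0 yK K unfolding l'eq by (auto simp: closed)
  \<comment> \<open>Numerically \<open>2 * v l' \<le> 3 * a - 2 * a - 2\<close>, so the square of
    the slope dominates \<open>x3\<close>.\<close>
  hence vl': "v (l'^2) < a" using v_square[of l'] vy by simp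
  have "v_ge a (- (x - e1) - (x2 - x) - (x - e1) - (e1 - e2) - (e1 - e3))"
    by (rule v_ge_diff[OF v_ge_diff[OF v_ge_diff[OF v_ge_diff[OF v_ge_minus[OF X]
      v_ge_mono[OF dx]] X] v_ge_mono[OF d2]] v_ge_mono[OF d3]]) simp_all
  hence "v_ge (v (l'^2) + 1) (- (x - e1) - (x2 - x) - (x - e1) - (e1 - e2) - (e1 - e3))"
    using vl' by (elim v_ge_mono) simp
  from v_add_eq[OF _ _ this] have "l'^2 + (- (x - e1) - (x2 - x) - (x - e1) - (e1 - e2) - (e1 - e3)) \<noteq> 0"
    "v (l'^2 + (- (x - e1) - (x2 - x) - (x - e1) - (e1 - e2) - (e1 - e3))) < a"
    using l'K vl' by (auto simp: closed)
  moreover have "x3 - e1 = l'^2 + (- (x - e1) - (x2 - x) - (x - e1) - (e1 - e2) - (e1 - e3))"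
    unfolding x3 by simp
  ultimately show "x3 \<noteq> e1 \<and> v (x3 - e1) < v (x - e1)" unfolding a_def by auto
qed

end


section \<open>The curve as an abelian group\<close>

context complex_curve
begin

definition ell_group :: "complex point monoid" where
  "ell_group = \<lparr>carrier = pts, monoid.mult = point_add E, monoid.one = \<O>\<rparr>"

lemma ell_group_simps [simp]:
  "carrier ell_group = pts" "monoid.mult ell_group = point_add E" "monoid.one ell_group = \<O>"
  by (simp_all add: ell_group_def)

sublocale G: comm_group ell_group
proof (rule comm_groupI)
  fix P assume "P \<in> carrier ell_group"
  hence P: "on_curve E P" by simp
  have "point_neg P \<^bold>+ P = \<O>" using add_neg[of "point_neg P"] by simp
  thus "\<exists>Q\<in>carrier ell_group. Q \<otimes>\<^bsub>ell_group\<^esub> P = \<one>\<^bsub>ell_group\<^esub>"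
    using P by (intro bexI[of _ "point_neg P"]) simp_all
next
  fix P Q assume "P \<in> carrier ell_group" "Q \<in> carrier ell_group"
  thus "P \<otimes>\<^bsub>ell_group\<^esub> Q = Q \<otimes>\<^bsub>ell_group\<^esub> P" using add_comm by simp
qed (simp_all add: add_on_curve add_assoc del: on_curve.simps(2))

lemma inv_eq_neg: assumes "on_curve E P" shows "inv\<^bsub>ell_group\<^esub> P = point_neg P"
proof (rule G.inv_equality)
  show "point_neg P \<otimes>\<^bsub>ell_group\<^esub> P = \<one>\<^bsub>ell_group\<^esub>" using add_neg[of "point_neg P"] by simp
qed (use assms in simp_all)

lemma double_affine:
  assumes "y \<noteq> 0"
  obtains l x2 y2 where "Affine x y \<^bold>+ Affine x y = Affine x2 y2" "l * (2 * y) = 3 * x^2 + 2 * A * x + B"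
    "x2 = l^2 - A - 2 * x" "y2 = - (l * (x2 - x) + y)"
proof -
  have "y + y \<noteq> 0" using assms by simp
  thus ?thesis unfolding add_affine using assms
    by (intro that[of _ _ "(3 * x^2 + 2 * A * x + B) / (2 * y)"]) (auto simp: Let_def)
qed

lemma add_chord:
  assumes "x1 \<noteq> x2"
  obtains l x3 y3 where "Affine x1 y1 \<^bold>+ Affine x2 y2 = Affine x3 y3" "l * (x2 - x1) = y2 - y1"
    "x3 = l^2 - A - x1 - x2" "y3 = - (l * (x3 - x1) + y1)"
  unfolding add_affine using assms
  by (intro that[of _ _ "(y2 - y1) / (x2 - x1)"]) (auto simp: Let_def)

lemma pow_2: "on_curve E P \<Longrightarrow> P [^]\<^bsub>ell_group\<^esub> (2::nat) = P \<^bold>+ P"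
  by (simp add: numeral_2_eq_2)

lemma pow_3: "on_curve E P \<Longrightarrow> P [^]\<^bsub>ell_group\<^esub> (3::nat) = (P \<^bold>+ P) \<^bold>+ P"
  by (simp add: numeral_3_eq_3)

lemma pow_2_eq_one_iff:
  assumes "on_curve E P" shows "P [^]\<^bsub>ell_group\<^esub> (2::nat) = \<O> \<longleftrightarrow> P = \<O> \<or> (\<exists>x. P = Affine x 0)"
  using assms unfolding pow_2[OF assms] by (cases P) (auto simp: Let_def)

lemma points_over_subfield_closed:
  assumes K: "\<And>x y. x \<in> K \<Longrightarrow> y \<in> K \<Longrightarrow> x - y \<in> K" "\<And>x y. x \<in> K \<Longrightarrow> y \<in> K \<Longrightarrow> x * y \<in> K"
    "\<And>x. x \<in> K \<Longrightarrow> inverse x \<in> K" "1 \<in> K" and AB: "A \<in> K" "B \<in> K"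
    and P: "set_point P \<subseteq> K" and Q: "set_point Q \<subseteq> K"
  shows "set_point (P \<^bold>+ Q) \<subseteq> K"
proof -
  have K0: "0 \<in> K" using K(1)[OF K(4,4)] by simp
  have Km: "- x \<in> K" if "x \<in> K" for x using K(1)[OF K0 that] by simp
  have Ka: "x + y \<in> K" if "x \<in> K" "y \<in> K" for x y using K(1)[OF that(1) Km[OF that(2)]] by simp
  have Kd: "x / y \<in> K" if "x \<in> K" "y \<in> K" for x y
    unfolding divide_inverse using K(2)[OF that(1) K(3)[OF that(2)]] .
  have K2: "2 \<in> K" using Ka[OF K(4) K(4)] by simp
  have K3: "3 \<in> K" using Ka[OF K2 K(4)] by simp
  have Kp: "x^2 \<in> K" if "x \<in> K" for x unfolding power2_eq_square using K(2) that by simp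
  show ?thesis
  proof (cases P; cases Q)
    fix x1 y1 x2 y2 assume e: "P = Affine x1 y1" "Q = Affine x2 y2"
    hence "x1 \<in> K" "y1 \<in> K" "x2 \<in> K" "y2 \<in> K" using P Q by auto
    thus ?thesis unfolding e add_affine Let_def
      by (simp add: K(1,2) K0 Km Ka Kd K2 K3 Kp AB)
  qed (use P Q in auto)
qed

end

section \<open>Curves with rational 2-torsion\<close>

locale split_curve = complex_curve +
  fixes e1 e2 e3 :: complex
  assumes distinct_roots: "e1 \<noteq> e2" "e1 \<noteq> e3" "e2 \<noteq> e3"
    and coeffs: "A = - (e1 + e2 + e3)" "B = e1 * e2 + e1 * e3 + e2 * e3" "C = - (e1 * e2 * e3)"

lemma split_curveI:
  assumes distinct: "e1 \<noteq> e2" "e1 \<noteq> e3" "e2 \<noteq> e3"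
    and coeffs: "A = - (e1 + e2 + e3)" "B = e1 * e2 + e1 * e3 + e2 * e3" "C = - (e1 * e2 * e3)"
  shows "split_curve A B C e1 e2 e3"
proof
  fix x assume "x^3 + A * x^2 + B * x + C = 0"
  moreover have "x^3 + A * x^2 + B * x + C = (x - e1) * (x - e2) * (x - e3)"
    unfolding coeffs by (simp add: algebra_simps power2_eq_square power3_eq_cube)
  ultimately have "x = e1 \<or> x = e2 \<or> x = e3" by simp
  moreover have "3 * x^2 + 2 * A * x + B = (x - e1) * (x - e2) + (x - e1) * (x - e3) + (x - e2) * (x - e3)"
    unfolding coeffs by (simp add: algebra_simps power2_eq_square)
  ultimately show "3 * x^2 + 2 * A * x + B \<noteq> 0"
    using distinct by auto
qed (use assms in auto)

context split_curve
begin

lemma on_curve_split: "on_curve E (Affine x y) \<longleftrightarrow> y^2 = (x - e1) * (x - e2) * (x - e3)"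
proof -
  have "x^3 + A * x^2 + B * x + C = (x - e1) * (x - e2) * (x - e3)"
    unfolding coeffs by (simp add: algebra_simps power2_eq_square power3_eq_cube)
  thus ?thesis unfolding on_curve_iff by simp
qed

lemma derivative_split: "3 * x^2 + 2 * A * x + B = (x - e1) * (x - e2) + (x - e1) * (x - e3) + (x - e2) * (x - e3)"
  unfolding coeffs by (simp add: algebra_simps power2_eq_square)

lemma two_torsion: 
  assumes "on_curve E P"
  shows "P [^]\<^bsub>ell_group\<^esub> (2::nat) = \<O> \<longleftrightarrow> P \<in> {\<O>, Affine e1 0, Affine e2 0, Affine e3 0}"
  using assms unfolding pow_2_eq_one_iff[OF assms] by (cases P) (auto simp: on_curve_split simp del: on_curve.simps)

end

section \<open>Reduction modulo the prime above 3\<close>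

locale valued_split_curve = split_curve + valued_subfield +
  fixes \<delta> :: int
  assumes roots_in_K: "e1 \<in> K" "e2 \<in> K" "e3 \<in> K"
    and v_diff: "v (e2 - e1) = \<delta>" "v (e3 - e1) = \<delta>" "v (e3 - e2) = \<delta>"
begin

definition K_pts :: "complex point set" where "K_pts = {P. on_curve E P \<and> set_point P \<subseteq> K}"

text \<open>The nonzero points of the kernel of reduction: after scaling by the root differences,
  the abscissa has a pole.\<close>

definition deep :: "complex point \<Rightarrow> bool" where
  "deep P \<longleftrightarrow> P \<in> K_pts \<and> (\<exists>x y. P = Affine x y \<and> \<not> v_ge \<delta> (x - e1))"

text \<open>Smaller values mean closer to the origin. The value 0 at \<open>\<O>\<close> is a
  filler, since \<open>\<O>\<close> is not \<open>deep\<close>.\<close>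

definition depth :: "complex point \<Rightarrow> int" where
  "depth P = (case P of Affine x y \<Rightarrow> v (x - e1) | _ \<Rightarrow> 0)"

lemma K_pts_add: "P \<in> K_pts \<Longrightarrow> Q \<in> K_pts \<Longrightarrow> P \<^bold>+ Q \<in> K_pts"
proof -
  assume "P \<in> K_pts" "Q \<in> K_pts"
  moreover have "A \<in> K" "B \<in> K" unfolding coeffs using roots_in_K by (simp_all add: closed)
  ultimately show ?thesis unfolding K_pts_def using points_over_subfield_closed[of K P Q]
    by (simp add: closed add_on_curve del: on_curve.simps(2))
qed

lemma K_pts_pow: "P \<in> K_pts \<Longrightarrow> P [^]\<^bsub>ell_group\<^esub> (n::nat) \<in> K_pts"
proof (induction n)
  case 0 show ?case by (simp add: K_pts_def)
qed (auto intro: K_pts_add)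

lemma on_curve_K_pts: "P \<in> K_pts \<Longrightarrow> on_curve E P" unfolding K_pts_def by simp

lemma v_shift: assumes "x \<in> K" "e \<in> K" "e' \<in> K" "v_ge \<delta> (e - e')" shows "v_ge \<delta> (x - e) \<longleftrightarrow> v_ge \<delta> (x - e')"
  using v_ge_add[of \<delta> "x - e" "e - e'"] v_ge_diff[of \<delta> "x - e'" "e - e'"] assms by auto

text \<open>By \<open>nearest_root\<close> the point reduces to one of the 2-torsion points, and
  \<open>double_leaves_disc\<close> applies with that root as centre. The discs of radius
  \<open>\<delta>\<close> around the three roots coincide by \<open>v_shift\<close>, so the result
  can be stated with \<open>e1\<close>.\<close>

lemma double_deep:
  assumes P: "P \<in> K_pts" "\<not> deep P" and ne: "P \<^bold>+ P \<noteq> \<O>"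
  shows "deep (P \<^bold>+ P)"
proof -
  have "P \<noteq> \<O>" using ne by auto
  then obtain x y where Pxy: "P = Affine x y" by (cases P) auto
  have K: "x \<in> K" "y \<in> K" and on: "on_curve E (Affine x y)" using P unfolding K_pts_def Pxy by auto
  have y: "y \<noteq> 0" using ne unfolding Pxy by auto
  have y2: "y^2 = (x - e1) * (x - e2) * (x - e3)" using on unfolding on_curve_split .
  obtain l x2 y2' where D: "P \<^bold>+ P = Affine x2 y2'"
    and l: "l * (2 * y) = 3 * x^2 + 2 * A * x + B"
    and x2: "x2 = l^2 - A - 2 * x" using double_affine[OF y] unfolding Pxy by metis
  note l = l[unfolded derivative_split]
  have x2': "x2 = l^2 + (e1 + e2 + e3) - 2 * x" using x2 unfolding coeffs by simp
  have PP: "P \<^bold>+ P \<in> K_pts" using K_pts_add P by blast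
  hence x2K: "x2 \<in> K" unfolding D K_pts_def by simp
  have vm: "v (e1 - e2) = \<delta>" "v (e1 - e3) = \<delta>" "v (e2 - e3) = \<delta>"
    using v_diff roots_in_K v_minus[of "e2 - e1"] v_minus[of "e3 - e1"] v_minus[of "e3 - e2"] distinct_roots
    by (auto simp: closed)
  have ge: "v_ge \<delta> (e - e')" if "e \<in> {e1, e2, e3}" "e' \<in> {e1, e2, e3}" for e e'
    using that v_diff vm roots_in_K by (auto simp: v_ge_def closed)
  have "v_ge \<delta> (x - e1)" using P unfolding deep_def Pxy by blast
  hence "v_ge (\<delta> + 1) (x - e1) \<or> v_ge (\<delta> + 1) (x - e2) \<or> v_ge (\<delta> + 1) (x - e3)"
    by (intro nearest_root K roots_in_K v_diff distinct_roots)
  hence "\<not> v_ge \<delta> (x2 - e1)"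
  proof (elim disjE)
    assume near: "v_ge (\<delta> + 1) (x - e1)"
    show ?thesis
      by (rule double_leaves_disc[OF K roots_in_K v_diff(1,2) distinct_roots(1,2) near y y2 l x2'])
  next
    assume near: "v_ge (\<delta> + 1) (x - e2)"
    have "\<not> v_ge \<delta> (x2 - e2)"
      by (rule double_leaves_disc[OF K roots_in_K(2,1,3) vm(1) v_diff(3) _ _ near y, of l])
        (use distinct_roots y2 l x2' in \<open>simp_all add: mult_ac add_ac\<close>)
    thus ?thesis using v_shift[OF x2K roots_in_K(2,1)] ge by simp
  next
    assume near: "v_ge (\<delta> + 1) (x - e3)"
    have "\<not> v_ge \<delta> (x2 - e3)"
      by (rule double_leaves_disc[OF K roots_in_K(3,1,2) vm(2,3) _ _ near y, of l])
        (use distinct_roots y2 l x2' in \<open>simp_all add: mult_ac add_ac\<close>)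
    thus ?thesis using v_shift[OF x2K roots_in_K(3,1)] ge by simp
  qed
  thus ?thesis unfolding deep_def D using PP D by auto
qed

lemma triple_deep:
  assumes "deep Q" "Q [^]\<^bsub>ell_group\<^esub> (3::nat) \<noteq> \<O>"
  shows "deep (Q [^]\<^bsub>ell_group\<^esub> (3::nat))" "depth (Q [^]\<^bsub>ell_group\<^esub> (3::nat)) < depth Q"
proof -
  obtain x y where Q: "Q = Affine x y" "Q \<in> K_pts" and x: "\<not> v_ge \<delta> (x - e1)"
    using assms(1) unfolding deep_def by blast
  have K: "x \<in> K" "y \<in> K" and on: "on_curve E (Affine x y)" using Q unfolding K_pts_def Q by auto
  have y2: "y^2 = (x - e1) * (x - e2) * (x - e3)" using on unfolding on_curve_split .
  have "v_ge \<delta> 0" using zero_closed by (simp add: v_ge_def)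
  hence y: "y \<noteq> 0" using y2 x v_shift[of x e1 e2] v_shift[of x e1 e3] v_ge_minus[of \<delta> "e2 - e1"] v_ge_minus[of \<delta> "e3 - e1"]
      K roots_in_K v_diff by (auto simp: v_ge_def closed)
  obtain l x2 y2' where D: "Q \<^bold>+ Q = Affine x2 y2'"
    and l: "l * (2 * y) = 3 * x^2 + 2 * A * x + B"
    and x2: "x2 = l^2 - A - 2 * x" and y2': "y2' = - (l * (x2 - x) + y)"
    using double_affine[OF y] unfolding Q by metis
  note l = l[unfolded derivative_split]
  have x2': "x2 = l^2 + (e1 + e2 + e3) - 2 * x" using x2 unfolding coeffs by simp
  note T = triple_deepens[OF K roots_in_K v_diff(1,2) x y2 l x2' y2']
  have Q3: "Q [^]\<^bsub>ell_group\<^esub> (3::nat) = Affine x2 y2' \<^bold>+ Affine x y"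
    using pow_3[OF on_curve_K_pts[OF Q(2)]] D Q by simp
  have ne: "x2 \<noteq> x"
  proof
    assume e: "x2 = x"
    have "Affine x2 y2' \<in> K_pts" using K_pts_add[OF Q(2) Q(2)] D by simp
    hence "y2'^2 = y^2" using on_curve_K_pts[of "Affine x2 y2'"] on e by simp
    \<comment> \<open>With \<open>x2 = x\<close> the premise of \<open>T\<close> about the chord is
      vacuous, so any slope, here 0, may be inserted.\<close>
    hence "y2' = - y" using T(2)[of 0] power2_eq_iff e by (metis)
    thus False using assms(2) Q3 e by simp
  qed
  then obtain l' x3 y3 where S: "Affine x2 y2' \<^bold>+ Affine x y = Affine x3 y3" "l' * (x - x2) = y - y2'"
    "x3 = l'^2 - A - x2 - x" using add_chord by metis
  have "x3 = l'^2 + (e1 + e2 + e3) - x2 - x" using S(3) unfolding coeffs by simp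
  from T(3)[OF S(2) this ne] have d: "x3 \<noteq> e1" "v (x3 - e1) < v (x - e1)" by blast+
  have "Affine x3 y3 \<in> K_pts" using K_pts_pow[OF Q(2), of 3] S(1) Q3 by simp
  moreover have "v (x - e1) < \<delta>" using x K roots_in_K unfolding v_ge_def by (auto simp: closed)
  ultimately show "deep (Q [^]\<^bsub>ell_group\<^esub> (3::nat))" unfolding Q3 S(1) deep_def using d by (auto simp: v_ge_def)
  show "depth (Q [^]\<^bsub>ell_group\<^esub> (3::nat)) < depth Q" unfolding Q3 S(1) using d by (simp add: depth_def Q(1))
qed

text \<open>A torsion point of order prime to 3 would return to itself under iterated tripling.\<close>

lemma deep_torsion:
  assumes Q: "deep Q" and n: "n > 0" "Q [^]\<^bsub>ell_group\<^esub> (n::nat) = \<O>"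
  shows "\<exists>b::nat. Q [^]\<^bsub>ell_group\<^esub> ((3::nat) ^ b) = \<O>"
proof (rule ccontr)
  assume neg: "\<not> ?thesis"
  have on: "on_curve E Q" using Q unfolding deep_def by (auto dest: on_curve_K_pts)
  have D: "deep (Q [^]\<^bsub>ell_group\<^esub> ((3::nat) ^ k)) \<and> depth (Q [^]\<^bsub>ell_group\<^esub> ((3::nat) ^ (k + j))) + int j \<le> depth (Q [^]\<^bsub>ell_group\<^esub> ((3::nat) ^ k))" for k j
  proof -
    have step: "(Q [^]\<^bsub>ell_group\<^esub> ((3::nat) ^ k)) [^]\<^bsub>ell_group\<^esub> (3::nat) = Q [^]\<^bsub>ell_group\<^esub> ((3::nat) ^ Suc k)" for k
      using on by (subst G.nat_pow_pow) (simp_all add: mult.commute)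
    have deep: "deep (Q [^]\<^bsub>ell_group\<^esub> ((3::nat) ^ k))" for k
    proof (induction k)
      case 0 thus ?case using Q on by (simp del: on_curve.simps(2))
    next
      case (Suc k)
      thus ?case using triple_deep(1)[OF Suc] neg unfolding step by blast
    qed
    have "depth (Q [^]\<^bsub>ell_group\<^esub> ((3::nat) ^ (k + j))) + int j \<le> depth (Q [^]\<^bsub>ell_group\<^esub> ((3::nat) ^ k))"
    proof (induction j)
      case (Suc j)
      have "depth (Q [^]\<^bsub>ell_group\<^esub> ((3::nat) ^ Suc (k + j))) < depth (Q [^]\<^bsub>ell_group\<^esub> ((3::nat) ^ (k + j)))"
        using triple_deep(2)[OF deep[of "k + j"]] neg unfolding step by blast
      thus ?case using Suc unfolding add_Suc_right by linarith
    qed simp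
    thus ?thesis using deep by blast
  qed
  define b where "b = multiplicity 3 n"
  have "n \<noteq> 0" "\<not> is_unit (3::nat)" using n(1) by auto
  then obtain m where nm: "n = 3 ^ b * m" "\<not> 3 dvd m" unfolding b_def by (rule multiplicity_decompose')
  have "coprime 3 m" using nm(2) by (simp add: prime_imp_coprime)
  hence "[3 ^ totient m = 1] (mod m)" by (rule euler_theorem)
  moreover have "m > 0" using nm n(1) by (cases m) auto
  ultimately obtain t where t: "3 ^ totient m = 1 + m * t"
    by (metis cong_le_nat cong_sym one_le_numeral one_le_power mult.commute add.commute)
  \<comment> \<open>Hence tripling \<open>totient m\<close> further times returns to the same point,
    although \<open>D\<close> lowers its depth by at least \<open>totient m\<close>, which is
    positive.\<close>
  have "3 ^ (b + totient m) = 3 ^ b + n * t" unfolding power_add t nm(1) by (simp add: algebra_simps)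
  hence "Q [^]\<^bsub>ell_group\<^esub> ((3::nat) ^ (b + totient m)) = Q [^]\<^bsub>ell_group\<^esub> ((3::nat) ^ b) \<^bold>+ (Q [^]\<^bsub>ell_group\<^esub> n) [^]\<^bsub>ell_group\<^esub> t"
    using on by (simp add: G.nat_pow_pow flip: G.nat_pow_mult)
  also have "\<dots> = Q [^]\<^bsub>ell_group\<^esub> ((3::nat) ^ b)" using n(2) G.nat_pow_one[of t] by simp
  finally show False using D[of b "totient m"] \<open>m > 0\<close> by simp
qed

lemma torsion_2_power_3:
  assumes P: "P \<in> K_pts" and n: "n > 0" "P [^]\<^bsub>ell_group\<^esub> (n::nat) = \<O>"
  shows "\<exists>b::nat. (P [^]\<^bsub>ell_group\<^esub> (2::nat)) [^]\<^bsub>ell_group\<^esub> ((3::nat) ^ b) = \<O>"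
proof -
  have on: "on_curve E P" using P by (rule on_curve_K_pts)
  have comm: "(P [^]\<^bsub>ell_group\<^esub> a) [^]\<^bsub>ell_group\<^esub> b = (P [^]\<^bsub>ell_group\<^esub> b) [^]\<^bsub>ell_group\<^esub> a" for a b :: nat
    using on by (simp add: G.nat_pow_pow mult.commute)
  have one: "\<O> [^]\<^bsub>ell_group\<^esub> (a::nat) = \<O>" for a using G.nat_pow_one[of a] by simp
  show ?thesis
  proof (cases "deep P")
    case True
    then obtain b where "P [^]\<^bsub>ell_group\<^esub> ((3::nat) ^ b) = \<O>" using deep_torsion n by blast
    thus ?thesis using one comm by metis
  next
    case False
    show ?thesis
    proof (cases "P \<^bold>+ P = \<O>")
      case True
      thus ?thesis using one pow_2[OF on] by metis
    next
      case ne: False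
      have "deep (P [^]\<^bsub>ell_group\<^esub> (2::nat))" using double_deep[OF P False ne] unfolding pow_2[OF on] .
      moreover have "(P [^]\<^bsub>ell_group\<^esub> (2::nat)) [^]\<^bsub>ell_group\<^esub> n = \<O>" using comm n(2) one by metis
      ultimately show ?thesis using deep_torsion n(1) by blast
    qed
  qed
qed

end

section \<open>A family with cyclic cubic 2-division field\<close>

text \<open>\<open>fam_P\<close> and \<open>fam_Q\<close> are the coefficients of the cubic with
  roots \<open>x1\<close>, \<open>x2\<close>, \<open>x3\<close> below. They are polymorphic because
  they are evaluated at integers for parity, at rationals and complex numbers for the curve, and at
  a polynomial variable to count values of \<open>j\<close>.\<close>

definition fam_P :: "'a::comm_ring_1 \<Rightarrow> 'a" where "fam_P k = - 3 + 9 * k - 27 * k^2"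
definition fam_Q :: "'a::comm_ring_1 \<Rightarrow> 'a" where "fam_Q k = 1 - 18 * k + 27 * k^2 + 27 * k^3"

lemma of_int_fam [simp]: "of_int (fam_P k) = fam_P (of_int k)" "of_int (fam_Q k) = fam_Q (of_int k)"
  by (simp_all add: fam_P_def fam_Q_def)

lemma of_rat_fam [simp]: "of_rat (fam_P x) = fam_P (of_rat x)" "of_rat (fam_Q x) = fam_Q (of_rat x)"
  by (simp_all add: fam_P_def fam_Q_def of_rat_add of_rat_diff of_rat_mult of_rat_power of_rat_minus)

text \<open>Modulo 2 the cubic is \<open>x^3 + x + 1\<close>, which is irreducible. The nonvanishing
  of \<open>Q\<close> and of the discriminant, the lack of rational roots and the non-divisibility
  of \<open>T\<close> all rest on this parity.\<close>

lemma fam_odd: "odd (fam_P k)" "odd (fam_Q k)" for k :: int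
  unfolding fam_P_def fam_Q_def by (cases "even k"; simp)+

text \<open>The curve \<open>y^2 = x^3 + D (P x - D Q^2)^2\<close>, the quadratic twist by
  \<open>D\<close> of the case \<open>D = 1\<close>.\<close>

definition fam_curve :: "int \<Rightarrow> int \<Rightarrow> rat weierstrass" where
  "fam_curve d k = (let D = of_int d; P = fam_P (of_int k); Q = fam_Q (of_int k) in
     Weierstrass 0 (D * P^2) 0 (- 2 * D^2 * P * Q^2) (D^3 * Q^4))"

text \<open>The last three identities transfer equal valuations from the differences of
  \<open>x\<close>, \<open>y\<close>, \<open>z\<close> to those of the roots: in
  \<open>(z x)^2 - (y z)^2\<close> the factor \<open>x + y\<close> is \<open>- z\<close>.\<close>

lemma zero_sum_cubic:
  fixes x y :: "'a::comm_ring_1"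
  assumes "P = x * y + z * (x + y)" "Q = - x * y * z" "z = - x - y"
    and r: "r1 = - D * (y * z)^2" "r2 = - D * (z * x)^2" "r3 = - D * (x * y)^2"
  shows "D * P^2 = - (r1 + r2 + r3)" "- 2 * D^2 * P * Q^2 = r1 * r2 + r1 * r3 + r2 * r3"
    "D^3 * Q^4 = - (r1 * r2 * r3)" "- 4 * P^3 - 27 * Q^2 = ((x - y) * (y - z) * (z - x))^2"
    "r2 - r1 = D * (x - y) * z^3" "r3 - r1 = D * (x - z) * y^3" "r3 - r2 = D * (y - z) * x^3"
  unfolding assms by (simp_all add: algebra_simps power2_eq_square power3_eq_cube power4_eq_xxxx)

locale curve_family =
  fixes d k :: int and t :: complex
  assumes d: "d = 1 \<or> d = 2" and t: "t^3 = 3 * t - 1" and t_Q_inf: "t \<in> Q_inf_3"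
begin

text \<open>Writing \<open>t = u + 1 / u\<close> with \<open>u\<close> a ninth root of unity,
  \<open>t2\<close> is \<open>u^2 + 1 / u^2\<close>; the third conjugate \<open>t3\<close> follows
  from trace 0.\<close>

definition "t2 = t^2 - 2"
definition "t3 = 2 - t - t^2"

definition "x1 = t + 3 * of_int k * t2"
definition "x2 = t2 + 3 * of_int k * t3"
definition "x3 = t3 + 3 * of_int k * t"

definition "r1 = - of_int d * (x2 * x3)^2"
definition "r2 = - of_int d * (x3 * x1)^2"
definition "r3 = - of_int d * (x1 * x2)^2"

abbreviation P :: complex where "P \<equiv> fam_P (of_int k)"
abbreviation Q :: complex where "Q \<equiv> fam_Q (of_int k)"

text \<open>Rewrite rules for right-nested products, so that together with
  \<open>algebra_simps\<close> every polynomial in \<open>t\<close> is brought to degree at most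
  2.\<close>

lemma t_reduce: "t * (t * t) = 3 * t - 1" "t * (t * (t * z)) = 3 * (t * z) - z"
proof -
  show *: "t * (t * t) = 3 * t - 1" using t unfolding power3_eq_cube mult.assoc .
  have "t * (t * (t * z)) = (t * (t * t)) * z" by simp
  thus "t * (t * (t * z)) = 3 * (t * z) - z" unfolding * by (simp add: algebra_simps)
qed

lemmas t_simps = t_reduce algebra_simps power2_eq_square power3_eq_cube

lemma t2_cubic: "t2^3 = 3 * t2 - 1" and t3_cubic: "t3^3 = 3 * t3 - 1"
  by (simp_all add: t2_def t3_def t_simps)

lemma t_elementary: "t3 = - t - t2" "t * t2 + t3 * (t + t2) = - 3" "t * t2 * t3 = - 1"
  by (simp_all add: t2_def t3_def t_simps)

lemma x_sum: "x3 = - x1 - x2"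
  unfolding x1_def x2_def x3_def t_elementary by (simp add: algebra_simps)

lemma x_P: "x1 * x2 + x3 * (x1 + x2) = P"
  unfolding x1_def x2_def x3_def fam_P_def by (simp add: t2_def t3_def t_simps)

lemma x_Q: "- x1 * x2 * x3 = Q"
  unfolding x1_def x2_def x3_def fam_Q_def by (simp add: t2_def t3_def t_simps)

definition "A = of_int d * P^2"
definition "B = - 2 * (of_int d)^2 * P * Q^2"
definition "C = (of_int d)^3 * Q^4"

lemmas zsc = zero_sum_cubic[OF x_P[symmetric] x_Q[symmetric] x_sum r1_def r2_def r3_def]

lemma of_int_eq_simps: "P = of_int (fam_P k)" "Q = of_int (fam_Q k)" by simp_all

lemma Q_nonzero: "Q \<noteq> 0"
  unfolding of_int_eq_simps using fam_odd[of k] by (auto simp only: of_int_eq_0_iff even_zero)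

lemma disc_nonzero: "- 4 * P^3 - 27 * Q^2 \<noteq> 0"
proof -
  have "odd (- 4 * fam_P k^3 - 27 * fam_Q k^2)" using fam_odd[of k] by simp
  hence "- 4 * fam_P k^3 - 27 * fam_Q k^2 \<noteq> 0" by (metis even_zero)
  hence "of_int (- 4 * fam_P k^3 - 27 * fam_Q k^2) \<noteq> (0 :: complex)" by (simp only: of_int_eq_0_iff not_False_eq_True)
  moreover have "of_int (- 4 * fam_P k^3 - 27 * fam_Q k^2) = - 4 * P^3 - 27 * Q^2" by simp
  ultimately show ?thesis by metis
qed

lemma x_nonzero: "x1 \<noteq> 0" "x2 \<noteq> 0" "x3 \<noteq> 0" using Q_nonzero unfolding x_Q[symmetric] by auto

lemma x_distinct: "x1 \<noteq> x2" "x2 \<noteq> x3" "x3 \<noteq> x1" using disc_nonzero unfolding zsc(4) by auto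

lemma d_nonzero: "of_int d \<noteq> (0 :: complex)" using d by auto

sublocale split_curve A B C r1 r2 r3
proof (rule split_curveI)
  show "A = - (r1 + r2 + r3)" "B = r1 * r2 + r1 * r3 + r2 * r3" "C = - (r1 * r2 * r3)"
    unfolding A_def B_def C_def by (rule zsc)+
  have "r2 - r1 \<noteq> 0" "r3 - r1 \<noteq> 0" "r3 - r2 \<noteq> 0"
    unfolding zsc using x_nonzero x_distinct d_nonzero by auto
  thus "r1 \<noteq> r2" "r1 \<noteq> r3" "r2 \<noteq> r3" by auto
qed

text \<open>The conjugates of \<open>t\<close> are units above 3, and by \<open>tdiff\<close> their
  differences agree up to unit factors. Adding \<open>3 k\<close> times a unit keeps both properties
  for \<open>x1\<close>, \<open>x2\<close>, \<open>x3\<close>, and \<open>zsc\<close> carries the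
  equal valuations over to the roots.\<close>

lemma valued:
  assumes "valued_subfield K v" "t \<in> K"
  shows "\<exists>\<delta>. valued_split_curve A B C r1 r2 r3 K v \<delta>"
proof -
  interpret valued_subfield K v by (rule assms)
  have ofnat: "v_ge 0 (of_nat n)" for n
  proof (induction n)
    case 0 show ?case by (simp add: v_ge_def closed)
  next
    case (Suc n)
    have "v_ge 0 1" by (simp add: v_ge_def closed v_1)
    thus ?case using v_ge_add Suc by simp
  qed
  have ofint: "v_ge 0 (of_int n)" for n
    by (cases n) (auto intro!: ofnat v_ge_minus simp del: of_nat_Suc)
  have unit: "z \<noteq> 0 \<and> v z = 0" if z: "z \<in> K" "z^3 = 3 * z - 1" for z
  proof -
    have z0: "z \<noteq> 0" using z(2) by auto
    \<comment> \<open>Both factors are integral, so both have valuation 0.\<close>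
    have e: "z * (3 - z^2) = 1" using z(2) by (simp add: algebra_simps power2_eq_square power3_eq_cube)
    hence nz: "3 - z^2 \<noteq> 0" by auto
    have K3: "3 - z^2 \<in> K" using z by (simp add: closed)
    have s: "v z + v (3 - z^2) = 0" using v_mult[OF z(1) K3 z0 nz] v_1 unfolding e by simp
    have v3: "v_ge 1 3" using v_3 by (simp add: v_ge_def closed)
    have "v z \<ge> 0"
    proof (rule ccontr)
      assume neg: "\<not> 0 \<le> v z"
      have "v_ge (v (z^2) + 1) 3" using v3 neg v_square[OF z(1) z0] by (elim v_ge_mono) simp
      from v_add_eq(2)[OF _ _ v_ge_minus[OF this]] have "v (z^2 - 3) = v (z^2)" using z z0 by (simp add: closed)
      hence "v (3 - z^2) = 2 * v z" using v_minus[OF K3 nz] v_square[OF z(1) z0] by simp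
      thus False using s neg by simp
    qed
    moreover have "v (3 - z^2) \<ge> 0"
    proof -
      have "v_ge 0 (3 - z^2)" using calculation z z0 v_square[OF z(1) z0]
        by (intro v_ge_diff v_ge_mono[OF v3] v_geI) (simp_all add: closed)
      thus ?thesis using nz unfolding v_ge_def by blast
    qed
    ultimately show ?thesis using s z0 by simp
  qed
  have tK: "t \<in> K" "t2 \<in> K" "t3 \<in> K" using assms(2) by (auto simp: t2_def t3_def closed)
  note u = unit[OF tK(1) t] unit[OF tK(2) t2_cubic] unit[OF tK(3) t3_cubic]
  have k3: "v_ge 1 (3 * of_int k)"
    using v_ge_mult[of 1 3 0 "of_int k"] ofint v_3 by (simp add: v_ge_def closed)
  have kK: "of_int k \<in> K" using ofint[of k] by (simp add: v_ge_def)
  have unit': "z + 3 * of_int k * z' \<noteq> 0 \<and> v (z + 3 * of_int k * z') = 0"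
    if "z \<in> K" "z \<noteq> 0" "v z = 0" "z' \<in> K" "v z' = 0" for z z'
  proof -
    have "v_ge (1 + 0) (3 * of_int k * z')" using that by (intro v_ge_mult k3 v_geI) auto
    thus ?thesis using v_add_eq[of z "3 * of_int k * z'"] that by simp
  qed
  have x: "v x1 = 0" "v x2 = 0" "v x3 = 0" using unit' u tK unfolding x1_def x2_def x3_def by auto
  have xK: "x1 \<in> K" "x2 \<in> K" "x3 \<in> K" unfolding x1_def x2_def x3_def using tK kK by (simp_all add: closed)
  have tdiff: "t2 - t3 = - ((t - t2) * t3)" "t3 - t = - ((t2 - t3) * t)"
    by (simp_all add: t2_def t3_def t_simps)
  have tne: "t \<noteq> t2"
  proof
    assume "t = t2"
    hence "t = t2" "t3 = t2" using tdiff(1) by auto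
    hence "3 * t = 0" using t_elementary(1) by (simp add: eq_neg_iff_add_eq_0)
    thus False using u by simp
  qed
  define \<eta> where "\<eta> = v (t - t2)"
  have m1: "v (- a) = v a" if "a \<in> K" "a \<noteq> 0" for a using v_minus that .
  have d1: "t - t2 \<noteq> 0" "t - t2 \<in> K" using tne tK by (auto simp: closed)
  have d2: "t2 - t3 \<noteq> 0" "t2 - t3 \<in> K" "v (t2 - t3) = \<eta>"
    using d1 u tK v_mult[of "t - t2" t3] m1[of "(t - t2) * t3"] unfolding tdiff(1) by (auto simp: closed \<eta>_def)
  have d3: "t3 - t \<noteq> 0" "t3 - t \<in> K" "v (t3 - t) = \<eta>"
    using d2 u tK v_mult[of "t2 - t3" t] m1[of "(t2 - t3) * t"] unfolding tdiff(2) by (auto simp: closed)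
  have xd: "x1 - x2 = (t - t2) * (1 + 3 * of_int k * - t3)" "x2 - x3 = (t2 - t3) * (1 + 3 * of_int k * - t)"
    "x3 - x1 = (t3 - t) * (1 + 3 * of_int k * - t2)"
    unfolding x1_def x2_def x3_def by (simp_all add: t2_def t3_def t_simps)
  have one_unit: "1 + 3 * of_int k * - z \<noteq> 0 \<and> v (1 + 3 * of_int k * - z) = 0" if "z \<in> K" "z \<noteq> 0" "v z = 0" for z
    using that v_minus by (intro unit') (auto simp: closed v_1)
  have vx: "v (x1 - x2) = \<eta>" "v (x2 - x3) = \<eta>" "v (x3 - x1) = \<eta>"
    unfolding xd using d1 d2 d3 one_unit[of t] one_unit[of t2] one_unit[of t3] u tK kK
    by (simp_all add: v_mult closed \<eta>_def)
  have vd: "v (of_int d) = 0" "of_int d \<in> K" using d v_1 v_2 by (auto simp: closed)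
  have v3: "v (z^3) = 0" if "z \<in> K" "z \<noteq> 0" "v z = 0" for z
    unfolding power3_eq_cube using that by (simp add: v_mult closed)
  have prod: "v (of_int d * y * z^3) = \<eta>" if "y \<in> K" "y \<noteq> 0" "v y = \<eta>" "z \<in> K" "z \<noteq> 0" "v z = 0" for y z
    using that vd d_nonzero v3[of z] v_mult[of "of_int d * y" "z^3"] v_mult[of "of_int d" y] by (simp add: closed)
  have "x1 - x3 = - (x3 - x1)" by simp
  hence vx': "v (x1 - x3) = \<eta>" using v_minus[of "x3 - x1"] vx x_distinct xK by (simp add: closed)
  have "valued_split_curve A B C r1 r2 r3 K v \<eta>"
  proof (intro valued_split_curve.intro valued_split_curve_axioms.intro)
    show "r1 \<in> K" "r2 \<in> K" "r3 \<in> K" unfolding r1_def r2_def r3_def using vd xK by (simp_all add: closed)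
    show "v (r2 - r1) = \<eta>" "v (r3 - r1) = \<eta>" "v (r3 - r2) = \<eta>"
      unfolding zsc by (rule prod; use xK x vx vx' x_distinct x_nonzero in \<open>simp add: closed\<close>)+
  qed unfold_locales
  thus ?thesis by blast
qed

end

section \<open>Torsion points over the $\mathbf{Z}_3$-extension\<close>

lemma Q_inf_3_iff: "x \<in> Q_inf_3 \<longleftrightarrow> x \<in> Q_zeta_3_inf \<and> x \<in> \<real>"
  unfolding Q_inf_3_eq_real_subfield by simp

lemma Q_zeta_diff: "x \<in> Q_zeta_3_inf \<Longrightarrow> y \<in> Q_zeta_3_inf \<Longrightarrow> x - y \<in> Q_zeta_3_inf"
  using Q_zeta_closed(4)[of x "- y"] Q_zeta_closed(3)[of y] by simp

lemma Q_zeta_divide: "x \<in> Q_zeta_3_inf \<Longrightarrow> y \<in> Q_zeta_3_inf \<Longrightarrow> x / y \<in> Q_zeta_3_inf"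
  unfolding divide_inverse by (intro Q_zeta_closed(5,6))

lemma Q_zeta_power: "x \<in> Q_zeta_3_inf \<Longrightarrow> x ^ n \<in> Q_zeta_3_inf"
  by (induction n) (auto intro: Q_zeta_closed)

lemma Q_zeta_of_int: "of_int n \<in> Q_zeta_3_inf" and Q_zeta_numeral: "numeral m \<in> Q_zeta_3_inf"
  by (auto intro: Rats_in_Q_zeta)

lemmas Q_zeta_simps = Q_zeta_closed(1,3-7) Q_zeta_diff Q_zeta_divide Q_zeta_power Q_zeta_of_int Q_zeta_numeral

lemma Rats_subset_Q_inf: "\<rat> \<subseteq> Q_inf_3"
  using Rats_in_Q_zeta by (auto simp: Q_inf_3_iff elim!: Rats_cases')

context curve_family
begin

notation add (infixl "\<^bold>+" 65)

abbreviation pow :: "complex point \<Rightarrow> nat \<Rightarrow> complex point" (infixr "\<^bold>^" 75)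
  where "R \<^bold>^ n \<equiv> R [^]\<^bsub>ell_group\<^esub> n"

lemma PQ_in_Q_zeta: "P \<in> Q_zeta_3_inf" "Q \<in> Q_zeta_3_inf" "A \<in> Q_zeta_3_inf" "B \<in> Q_zeta_3_inf"
  unfolding A_def B_def unfolding fam_P_def fam_Q_def by (simp_all add: Q_zeta_simps)

lemma PQ_real: "P \<in> \<real>" "Q \<in> \<real>" "A \<in> \<real>" "B \<in> \<real>"
  unfolding A_def B_def unfolding fam_P_def fam_Q_def by (simp_all)

definition pts_over :: "complex set \<Rightarrow> complex point set" where
  "pts_over K = {R. on_curve E R \<and> set_point R \<subseteq> K}"

lemma pts_over_on_curve: "R \<in> pts_over K \<Longrightarrow> on_curve E R" unfolding pts_over_def by simp

lemma Q_inf_subfield: "x \<in> Q_inf_3 \<Longrightarrow> y \<in> Q_inf_3 \<Longrightarrow> x - y \<in> Q_inf_3"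
  "x \<in> Q_inf_3 \<Longrightarrow> y \<in> Q_inf_3 \<Longrightarrow> x * y \<in> Q_inf_3" "x \<in> Q_inf_3 \<Longrightarrow> inverse x \<in> Q_inf_3" "1 \<in> Q_inf_3"
  by (auto simp: Q_inf_3_iff Q_zeta_simps)

lemma pts_over_add: "R \<in> pts_over Q_inf_3 \<Longrightarrow> S \<in> pts_over Q_inf_3 \<Longrightarrow> R \<^bold>+ S \<in> pts_over Q_inf_3"
  unfolding pts_over_def
  using points_over_subfield_closed[of Q_inf_3 R S] Q_inf_subfield PQ_in_Q_zeta PQ_real add_on_curve
  by (simp add: Q_inf_3_iff del: on_curve.simps(2))

lemma pts_over_Rats_pow: assumes "R \<in> pts_over \<rat>" shows "R \<^bold>^ n \<in> pts_over \<rat>"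
proof (induction n)
  case 0 show ?case by (simp add: pts_over_def)
next
  case (Suc n)
  have "P \<in> \<rat>" "Q \<in> \<rat>" unfolding of_int_eq_simps by (rule Rats_of_int)+
  hence "A \<in> \<rat>" "B \<in> \<rat>" unfolding A_def B_def by simp_all
  thus ?case using Suc assms points_over_subfield_closed[of \<rat> "R \<^bold>^ n" R] add_on_curve
    unfolding pts_over_def by (simp del: on_curve.simps(2))
qed

lemma pts_over_pow: "R \<in> pts_over Q_inf_3 \<Longrightarrow> R \<^bold>^ n \<in> pts_over Q_inf_3"
proof (induction n)
  case 0 show ?case by (simp add: pts_over_def)
qed (auto intro: pts_over_add)

lemma pow_add: "on_curve E R \<Longrightarrow> R \<^bold>^ (m + n) = R \<^bold>^ m \<^bold>+ R \<^bold>^ n"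
  using G.nat_pow_mult[of R m n] by simp

lemma pow_mult: "on_curve E R \<Longrightarrow> (R \<^bold>^ m) \<^bold>^ n = R \<^bold>^ (m * n)"
  using G.nat_pow_pow[of R m n] by simp

lemma O_pow [simp]: "\<O> \<^bold>^ n = \<O>" using G.nat_pow_one[of n] by simp

lemma pow_on_curve: "on_curve E R \<Longrightarrow> on_curve E (R \<^bold>^ n)"
  using G.nat_pow_closed[of R n] by simp

lemma torsion_over_Q_inf:
  assumes R: "R \<in> pts_over Q_inf_3" and n: "n > 0" "R \<^bold>^ n = \<O>"
  shows "\<exists>b. (R \<^bold>^ 2) \<^bold>^ (3 ^ b) = \<O>"
proof -
  have "set_point R \<subseteq> Q_zeta_3_inf" "t \<in> Q_zeta_3_inf" "finite (set_point R)"
    using R t_Q_inf unfolding pts_over_def Q_inf_3_eq_real_subfield by (cases R; auto)+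
  then obtain K v where K: "valued_subfield K v" "insert t (set_point R) \<subseteq> K"
    using Q_zeta_valued_subfield[of "insert t (set_point R)"] by auto
  then obtain \<delta> where "valued_split_curve A B C r1 r2 r3 K v \<delta>" using valued[OF K(1)] by auto
  then interpret V: valued_split_curve A B C r1 r2 r3 K v \<delta> .
  have "R \<in> V.K_pts" using R K(2) unfolding V.K_pts_def pts_over_def by auto
  thus ?thesis using V.torsion_2_power_3 n by blast
qed

lemma curve_eq: "on_curve E (Affine x y) \<longleftrightarrow> y^2 = x^3 + of_int d * (P * x - of_int d * Q^2)^2"
  unfolding on_curve_iff A_def B_def C_def by (simp add: algebra_simps power2_eq_square power3_eq_cube power4_eq_xxxx)

lemma pow_3_eq_O:
  assumes "on_curve E R" "R \<^bold>^ 3 = \<O>" shows "R \<^bold>+ R = point_neg R"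
proof -
  have "point_neg (R \<^bold>+ R) = R"
    using assms pow_3[OF assms(1)] G.inv_equality[of "R" "R \<^bold>+ R"] add_comm[of R "R \<^bold>+ R"] add_on_curve inv_eq_neg[of "R \<^bold>+ R"]
    by (simp del: on_curve.simps(2))
  thus ?thesis by (metis point_neg_neg)
qed

text \<open>
  The 3-division polynomial is \<open>x\<close> times a factor that equals the sum of squares below
  on the curve, so that only \<open>x = 0\<close> is left over the reals.
\<close>

lemma real_3_torsion:
  assumes on: "on_curve E (Affine x y)" and re: "x \<in> \<real>" "y \<in> \<real>" and 3: "Affine x y \<^bold>^ 3 = \<O>"
  shows "x = 0"
proof (rule ccontr)
  assume x: "x \<noteq> 0"
  have dbl: "Affine x y \<^bold>+ Affine x y = Affine x (- y)" using pow_3_eq_O[OF on 3] by simp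
  hence y: "y \<noteq> 0" by auto
  obtain l x2 y2 where D: "Affine x y \<^bold>+ Affine x y = Affine x2 y2" and l: "l * (2 * y) = 3 * x^2 + 2 * A * x + B"
    and x2: "x2 = l^2 - A - 2 * x" using double_affine[OF y] by metis
  have l2: "l^2 = A + 3 * x" using x2 dbl D by simp
  let ?D = "of_int d :: complex"
  define L where "L = P * x - ?D * Q^2"
  have y2: "y^2 = x^3 + ?D * L^2" using on unfolding curve_eq L_def .
  have f: "3 * x^2 + 2 * A * x + B = 3 * x^2 + 2 * ?D * P * L"
    unfolding A_def B_def L_def by (simp add: algebra_simps power2_eq_square)
  \<comment> \<open>Squaring the tangent equation eliminates the slope, whose square is known
    because \<open>2 R = - R\<close> has the abscissa of \<open>R\<close>.\<close>
  have "(3 * x^2 + 2 * ?D * P * L)^2 = l^2 * (4 * y^2)"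
    unfolding f[symmetric] l[symmetric] by (simp add: power_mult_distrib)
  hence "(3 * x^2 + 2 * ?D * P * L)^2 = (?D * P^2 + 3 * x) * (4 * (x^3 + ?D * L^2))"
    unfolding l2 y2 A_def .
  moreover have "(?D * P^2 + 3 * x) * (4 * (x^3 + ?D * L^2)) - (3 * x^2 + 2 * ?D * P * L)^2
      = x * (3 * (x^3 + ?D * L^2) + ?D * (P * x - 3 * ?D * Q^2)^2)"
    unfolding L_def by (simp add: algebra_simps power2_eq_square power3_eq_cube)
  ultimately have "3 * y^2 + ?D * (P * x - 3 * ?D * Q^2)^2 = 0" using x unfolding y2 by simp
  moreover obtain a where a: "y = of_real a" using re(2) by (elim Reals_cases)
  moreover have "P * x - 3 * ?D * Q^2 \<in> \<real>" using re PQ_real by simp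
  then obtain b where b: "P * x - 3 * ?D * Q^2 = of_real b" by (elim Reals_cases)
  ultimately have "complex_of_real (3 * a^2 + of_int d * b^2) = of_real 0" by simp
  hence "3 * a^2 + of_int d * b^2 = 0" unfolding of_real_eq_iff .
  moreover have "of_int d * b^2 \<ge> 0" using d by auto
  ultimately have "a^2 \<le> 0" by linarith
  thus False using y a by simp
qed

text \<open>A root is \<open>- d s^2\<close> with \<open>s^3 + P s^2 + Q^2 = 0\<close>. If
  \<open>s^2\<close> is rational then so is \<open>s\<close>, being \<open>s^3 / s^2\<close>. For
  \<open>s = a / b\<close> in lowest terms the equation modulo 2 reads
  \<open>a^3 + a^2 b + b^3 = 0\<close>, which forces \<open>a\<close> and \<open>b\<close> to be
  even.\<close>

lemma no_rational_root:
  assumes "r \<in> {r1, r2, r3}" shows "r \<notin> \<rat>"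
proof
  assume "r \<in> \<rat>"
  have "\<exists>s. r = - of_int d * s^2 \<and> s^3 + P * s^2 + Q^2 = 0"
  proof -
    have "(- (x2 * x3))^3 + P * (- (x2 * x3))^2 + Q^2 = 0"
      "(- (x3 * x1))^3 + P * (- (x3 * x1))^2 + Q^2 = 0"
      "(- (x1 * x2))^3 + P * (- (x1 * x2))^2 + Q^2 = 0"
      unfolding x_P[symmetric] x_Q[symmetric] x_sum by (simp_all add: algebra_simps power2_eq_square power3_eq_cube)
    moreover have "r1 = - of_int d * (- (x2 * x3))^2" "r2 = - of_int d * (- (x3 * x1))^2" "r3 = - of_int d * (- (x1 * x2))^2"
      unfolding r1_def r2_def r3_def by simp_all
    ultimately show ?thesis using assms by blast
  qed
  then obtain s where s: "r = - of_int d * s^2" "s^3 + P * s^2 + Q^2 = 0" by blast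
  have "s^2 = - r / of_int d" using s(1) d_nonzero by simp
  hence s2: "s^2 \<in> \<rat>" using \<open>r \<in> \<rat>\<close> by simp
  have "s * (s^2) = - (P * s^2 + Q^2)" using s(2) by (simp add: eq_neg_iff_add_eq_0 power3_eq_cube power2_eq_square algebra_simps)
  moreover have "s \<noteq> 0" using s(2) Q_nonzero by auto
  ultimately have "s = - (P * s^2 + Q^2) / s^2" by (simp add: field_simps)
  moreover have "P \<in> \<rat>" "Q \<in> \<rat>" unfolding of_int_eq_simps by (rule Rats_of_int)+
  ultimately have "s \<in> \<rat>" using s2 by (metis Rats_add Rats_divide Rats_minus_iff Rats_mult Rats_power)
  then obtain a b where ab: "b > 0" "coprime a b" "s = of_int a / of_int b" by (elim Rats_cases')
  have "of_int (a^3 + fam_P k * a^2 * b + fam_Q k^2 * b^3) = (0 :: complex)"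
    using s(2) ab(1) unfolding ab(3) by (simp add: field_simps power2_eq_square power3_eq_cube)
  hence e: "a^3 + fam_P k * a^2 * b + fam_Q k^2 * b^3 = 0" unfolding of_int_eq_0_iff .
  have "even (a^3 + fam_P k * a^2 * b + fam_Q k^2 * b^3)" unfolding e by simp
  hence "even a \<and> even b" using fam_odd[of k] by auto
  thus False using ab(2) by (meson coprime_common_divisor dvd_refl odd_one)
qed

lemma r_Q_inf: "r1 \<in> Q_inf_3" "r2 \<in> Q_inf_3" "r3 \<in> Q_inf_3"
proof -
  have "t \<in> Q_zeta_3_inf" "t \<in> \<real>" using t_Q_inf by (auto simp: Q_inf_3_iff)
  thus "r1 \<in> Q_inf_3" "r2 \<in> Q_inf_3" "r3 \<in> Q_inf_3"
    unfolding Q_inf_3_iff r1_def r2_def r3_def x1_def x2_def x3_def t2_def t3_def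
    by (simp_all add: Q_zeta_simps)
qed

definition tors :: "complex set \<Rightarrow> complex point set" where
  "tors K = {R \<in> pts_over K. \<exists>n>0. R \<^bold>^ n = \<O>}"

lemma tors_mono: "R \<in> tors \<rat> \<Longrightarrow> R \<in> tors Q_inf_3"
  using Rats_subset_Q_inf unfolding tors_def pts_over_def by auto

lemma two_torsion_Q_inf: "{R \<in> pts_over Q_inf_3. R \<^bold>^ 2 = \<O>} = {\<O>, Affine r1 0, Affine r2 0, Affine r3 0}"
proof -
  have "on_curve E (Affine r1 0)" "on_curve E (Affine r2 0)" "on_curve E (Affine r3 0)"
    unfolding on_curve_split by simp_all
  moreover have "0 \<in> Q_inf_3" using Q_zeta_simps by (simp add: Q_inf_3_iff)
  ultimately have sub: "{\<O>, Affine r1 0, Affine r2 0, Affine r3 0} \<subseteq> pts_over Q_inf_3"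
    using r_Q_inf unfolding pts_over_def by (simp del: on_curve.simps(2))
  show ?thesis
  proof (rule equalityI; rule subsetI)
    fix R assume "R \<in> {R \<in> pts_over Q_inf_3. R \<^bold>^ 2 = \<O>}"
    thus "R \<in> {\<O>, Affine r1 0, Affine r2 0, Affine r3 0}" using two_torsion[OF pts_over_on_curve] by blast
  next
    fix R assume R: "R \<in> {\<O>, Affine r1 0, Affine r2 0, Affine r3 0}"
    hence "R \<in> pts_over Q_inf_3" using sub by blast
    thus "R \<in> {R \<in> pts_over Q_inf_3. R \<^bold>^ 2 = \<O>}" using two_torsion[OF pts_over_on_curve] R by blast
  qed
qed

lemma two_torsion_Rats: assumes "R \<in> pts_over \<rat>" "R \<^bold>^ 2 = \<O>" shows "R = \<O>"
proof -
  have "R \<in> pts_over Q_inf_3" using assms Rats_subset_Q_inf unfolding pts_over_def by auto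
  hence "R \<in> {\<O>, Affine r1 0, Affine r2 0, Affine r3 0}" using two_torsion_Q_inf assms by blast
  thus ?thesis using assms(1) no_rational_root unfolding pts_over_def by auto
qed

lemma tors_d2:
  assumes "d = 2" shows "tors Q_inf_3 = {R \<in> pts_over Q_inf_3. R \<^bold>^ 2 = \<O>}" "tors \<rat> = {\<O>}"
proof -
  have no3: "R = \<O>" if R: "R \<in> pts_over Q_inf_3" "R \<^bold>^ 3 = \<O>" for R
  proof (cases R)
    case (Affine x y)
    have xy: "x \<in> \<real>" "y \<in> \<real>" "y \<in> Q_zeta_3_inf" and on: "on_curve E (Affine x y)"
      using R(1) unfolding Affine pts_over_def by (auto simp: Q_inf_3_iff)
    have "x = 0" using real_3_torsion[OF on xy(1,2)] R(2) Affine by simp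
    hence "y^2 = 2 * (2 * Q^2)^2" using on assms unfolding curve_eq by simp
    hence "(y / (2 * Q^2))^2 = of_int 2" using Q_nonzero by (simp add: power_divide)
    moreover have "y / (2 * Q^2) \<in> Q_zeta_3_inf" using xy PQ_in_Q_zeta by (simp add: Q_zeta_simps)
    ultimately show ?thesis using Q_zeta_power_neq_2_mod_4[of _ 2 2] by auto
  qed
  have "R \<^bold>^ 2 = \<O>" if R: "R \<in> pts_over Q_inf_3" "n > 0" "R \<^bold>^ n = \<O>" for R n
  proof -
    obtain b where b: "(R \<^bold>^ 2) \<^bold>^ (3 ^ b) = \<O>" using torsion_over_Q_inf[OF R] by blast
    have R2: "R \<^bold>^ 2 \<in> pts_over Q_inf_3" by (rule pts_over_pow[OF R(1)])
    show ?thesis using b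
    proof (induction b)
      case 0
      thus ?case using pts_over_on_curve[OF R2] by (simp del: on_curve.simps(2))
    next
      case (Suc b)
      have "((R \<^bold>^ 2) \<^bold>^ (3 ^ b)) \<^bold>^ 3 = \<O>" using Suc(2) pts_over_on_curve[OF R2] by (simp add: pow_mult mult.commute)
      hence "(R \<^bold>^ 2) \<^bold>^ (3 ^ b) = \<O>" using no3 pts_over_pow[OF R2] by blast
      thus ?case by (rule Suc.IH)
    qed
  qed
  moreover have "\<exists>n>0. R \<^bold>^ n = \<O>" if "R \<^bold>^ 2 = \<O>" for R
    using that by (rule exI[of _ 2, OF conjI, rotated]) simp
  ultimately show *: "tors Q_inf_3 = {R \<in> pts_over Q_inf_3. R \<^bold>^ 2 = \<O>}" unfolding tors_def by blast
  have "R = \<O>" if "R \<in> tors \<rat>" for R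
    using tors_mono[OF that] that two_torsion_Rats unfolding * by (simp add: tors_def)
  moreover have "\<O> \<in> tors \<rat>" by (auto simp: tors_def pts_over_def)
  ultimately show "tors \<rat> = {\<O>}" by blast
qed

end

section \<open>Recognizing products of cyclic groups from generators\<close>

context comm_group
begin

lemma pow_mod_eq:
  assumes "a \<in> carrier G" "a [^] (m::nat) = \<one>" shows "a [^] (i mod m) = a [^] (i::nat)"
proof -
  have "a [^] i = a [^] (m * (i div m) + i mod m)" by simp
  also have "\<dots> = (a [^] m) [^] (i div m) \<otimes> a [^] (i mod m)"
    using assms(1) by (simp only: nat_pow_mult[symmetric] nat_pow_pow)
  finally show ?thesis using assms by simp
qed

lemma pow_nat_mod_add:
  assumes a: "a \<in> carrier G" "a [^] (m::nat) = \<one>" and ij: "0 \<le> i" "0 \<le> j"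
  shows "a [^] nat ((i + j) mod int m) = a [^] nat i \<otimes> a [^] nat j"
proof -
  have "nat ((i + j) mod int m) = (nat i + nat j) mod m"
    using ij by (simp add: nat_mod_distrib nat_add_distrib)
  thus ?thesis using pow_mod_eq[OF a, of "nat i + nat j"] a by (simp add: nat_pow_mult)
qed

lemma integer_mod_group_iso:
  assumes a: "a \<in> carrier G" "a [^] (m::nat) = \<one>" "m > 0"
    and free: "\<And>i::nat. a [^] i = \<one> \<Longrightarrow> m dvd i"
  shows "integer_mod_group m \<cong> G\<lparr>carrier := range (\<lambda>i::nat. a [^] i)\<rparr>"
proof -
  let ?f = "\<lambda>i. a [^] nat i"
  have "?f \<in> hom (integer_mod_group m) (G\<lparr>carrier := range (\<lambda>i::nat. a [^] i)\<rparr>)"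
    using pow_nat_mod_add[OF a(1,2)] a(3) by (auto simp: hom_def carrier_integer_mod_group)
  moreover have "inj_on ?f (carrier (integer_mod_group m))"
  proof (rule inj_onI)
    fix i j assume ij: "i \<in> carrier (integer_mod_group m)" "j \<in> carrier (integer_mod_group m)" "?f i = ?f j"
    hence r: "0 \<le> i" "i < int m" "0 \<le> j" "j < int m" using a(3) by (auto simp: carrier_integer_mod_group)
    \<comment> \<open>\<open>m - nat j\<close> represents the exponent \<open>- j\<close>, so that
      all exponents stay natural numbers.\<close>
    have "a [^] (nat i + (m - nat j)) = ?f j \<otimes> a [^] (m - nat j)"
      using ij(3) a by (simp add: nat_pow_mult[symmetric])
    also have "\<dots> = \<one>" unfolding nat_pow_mult[OF a(1)] using a(2) r by simp
    finally have "m dvd nat i + (m - nat j)" by (rule free)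
    hence "int m dvd int (nat i + (m - nat j))" by (simp only: int_dvd_int_iff)
    moreover have "int (nat i + (m - nat j)) = (i - j) + int m" using r by (simp add: of_nat_diff nat_le_iff)
    ultimately have "int m dvd (i - j) + int m" by metis
    hence "int m dvd i - j" by simp
    thus "i = j" using r by (metis mod_eq_dvd_iff mod_pos_pos_trivial)
  qed
  moreover have "?f ` carrier (integer_mod_group m) = range (\<lambda>i::nat. a [^] i)"
  proof (intro equalityI subsetI)
    fix x assume "x \<in> range (\<lambda>i::nat. a [^] i)"
    then obtain i :: nat where "x = a [^] i" by blast
    hence "x = ?f (int (i mod m))" using pow_mod_eq[OF a(1,2)] by simp
    moreover have "int (i mod m) \<in> carrier (integer_mod_group m)" using a(3) by (simp add: carrier_integer_mod_group)
    ultimately show "x \<in> ?f ` carrier (integer_mod_group m)" by blast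
  qed auto
  ultimately show ?thesis unfolding is_iso_def iso_def bij_betw_def by auto
qed

lemma integer_mod_group_prod_iso:
  assumes a: "a \<in> carrier G" "a [^] (m::nat) = \<one>" "m > 0"
    and b: "b \<in> carrier G" "b [^] (n::nat) = \<one>" "n > 0"
    and free: "\<And>i j :: nat. a [^] i \<otimes> b [^] j = \<one> \<Longrightarrow> m dvd i \<and> n dvd j"
  shows "integer_mod_group m \<times>\<times> integer_mod_group n \<cong> G\<lparr>carrier := range (\<lambda>(i :: nat, j :: nat). a [^] i \<otimes> b [^] j)\<rparr>"
proof -
  let ?f = "\<lambda>(i, j). a [^] nat i \<otimes> b [^] nat j"
  let ?M = "integer_mod_group m" and ?N = "integer_mod_group n"
  let ?S = "range (\<lambda>(i :: nat, j :: nat). a [^] i \<otimes> b [^] j)"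
  have car: "x \<in> carrier (?M \<times>\<times> ?N) \<longleftrightarrow> (\<exists>i j. x = (i, j) \<and> 0 \<le> i \<and> i < int m \<and> 0 \<le> j \<and> j < int n)" for x
    using a(3) b(3) by (auto simp: carrier_integer_mod_group DirProd_def)
  have "?f \<in> hom (?M \<times>\<times> ?N) (G\<lparr>carrier := ?S\<rparr>)"
  proof (rule homI)
    fix x assume "x \<in> carrier (?M \<times>\<times> ?N)" thus "?f x \<in> carrier (G\<lparr>carrier := ?S\<rparr>)" unfolding car by auto
  next
    fix x y assume "x \<in> carrier (?M \<times>\<times> ?N)" "y \<in> carrier (?M \<times>\<times> ?N)"
    then obtain i j i' j' where e: "x = (i, j)" "y = (i', j')" "0 \<le> i" "0 \<le> j" "0 \<le> i'" "0 \<le> j'" unfolding car by blast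
    have "?f (x \<otimes>\<^bsub>?M \<times>\<times> ?N\<^esub> y) = (a [^] nat i \<otimes> a [^] nat i') \<otimes> (b [^] nat j \<otimes> b [^] nat j')"
      using pow_nat_mod_add[OF a(1,2) e(3,5)] pow_nat_mod_add[OF b(1,2) e(4,6)] unfolding e(1,2) by simp
    also have "\<dots> = ?f x \<otimes> ?f y" unfolding e(1,2) using a b by (simp add: m_ac)
    finally show "?f (x \<otimes>\<^bsub>?M \<times>\<times> ?N\<^esub> y) = ?f x \<otimes>\<^bsub>G\<lparr>carrier := ?S\<rparr>\<^esub> ?f y" by simp
  qed
  moreover have "inj_on ?f (carrier (?M \<times>\<times> ?N))"
  proof (rule inj_onI)
    fix x y assume xy: "x \<in> carrier (?M \<times>\<times> ?N)" "y \<in> carrier (?M \<times>\<times> ?N)" "?f x = ?f y"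
    then obtain i j i' j' where e: "x = (i, j)" "y = (i', j')" and r: "0 \<le> i" "i < int m" "0 \<le> j" "j < int n"
      "0 \<le> i'" "i' < int m" "0 \<le> j'" "j' < int n" unfolding car by blast
    have "a [^] (nat i + (m - nat i')) \<otimes> b [^] (nat j + (n - nat j'))
        = ?f x \<otimes> (a [^] (m - nat i') \<otimes> b [^] (n - nat j'))"
      unfolding e using a b by (simp add: nat_pow_mult[symmetric] m_ac)
    also have "\<dots> = (a [^] nat i' \<otimes> a [^] (m - nat i')) \<otimes> (b [^] nat j' \<otimes> b [^] (n - nat j'))"
      unfolding xy(3) unfolding e using a b by (simp add: m_ac)
    also have "\<dots> = \<one>" unfolding nat_pow_mult[OF a(1)] nat_pow_mult[OF b(1)] using a(2) b(2) r by simp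
    finally have "m dvd nat i + (m - nat i') \<and> n dvd nat j + (n - nat j')" by (rule free)
    hence "int m dvd int (nat i + (m - nat i'))" "int n dvd int (nat j + (n - nat j'))" by (simp_all only: int_dvd_int_iff)
    moreover have "int (nat i + (m - nat i')) = (i - i') + int m" "int (nat j + (n - nat j')) = (j - j') + int n"
      using r by (simp_all add: of_nat_diff nat_le_iff)
    ultimately have "int m dvd (i - i') + int m" "int n dvd (j - j') + int n" by metis+
    hence "int m dvd i - i'" "int n dvd j - j'" by simp_all
    hence "i = i'" "j = j'" using r by (metis mod_eq_dvd_iff mod_pos_pos_trivial)+
    thus "x = y" unfolding e by simp
  qed
  moreover have "?f ` carrier (?M \<times>\<times> ?N) = ?S"
  proof (intro equalityI subsetI)
    fix x assume "x \<in> ?S"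
    then obtain i j :: nat where "x = a [^] i \<otimes> b [^] j" by auto
    hence "x = ?f (int (i mod m), int (j mod n))" using pow_mod_eq[OF a(1,2)] pow_mod_eq[OF b(1,2)] by simp
    moreover have "(int (i mod m), int (j mod n)) \<in> carrier (?M \<times>\<times> ?N)" unfolding car using a(3) b(3) by simp
    ultimately show "x \<in> ?f ` carrier (?M \<times>\<times> ?N)" by blast
  qed auto
  ultimately show ?thesis unfolding is_iso_def iso_def bij_betw_def by auto
qed

end

section \<open>The j-invariants of the family\<close>

lemma j_invariant_fam_curve:
  fixes d k :: int
  assumes "d \<noteq> 0"
  defines "P \<equiv> fam_P (of_int k) :: rat" and "Q \<equiv> fam_Q (of_int k) :: rat"
  shows "elliptic_curve (fam_curve d k)"
    "j_invariant (fam_curve d k) = - 256 * P^3 * (P^3 + 6 * Q^2)^3 / (Q^6 * (4 * P^3 + 27 * Q^2))"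
proof -
  let ?D = "of_int d :: rat"
  have c4: "c\<^sub>4 (fam_curve d k) = 16 * ?D^2 * P * (P^3 + 6 * Q^2)"
    unfolding c\<^sub>4_def b\<^sub>2_def b\<^sub>4_def fam_curve_def Let_def P_def[symmetric] Q_def[symmetric]
    by (simp add: algebra_simps power2_eq_square power3_eq_cube)
  have disc: "discriminant (fam_curve d k) = - 16 * ?D^6 * (Q^6 * (4 * P^3 + 27 * Q^2))"
    unfolding discriminant_def b\<^sub>2_def b\<^sub>4_def b\<^sub>6_def b\<^sub>8_def fam_curve_def Let_def P_def[symmetric] Q_def[symmetric]
    by (simp add: algebra_simps eval_nat_numeral)
  have Q: "Q \<noteq> 0" unfolding Q_def using fam_odd(2)[of k] by (metis even_zero of_int_eq_0_iff of_int_fam(2))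
  have "4 * P^3 + 27 * Q^2 = of_int (4 * fam_P k^3 + 27 * fam_Q k^2)" unfolding P_def Q_def by simp
  moreover have "odd (4 * fam_P k^3 + 27 * fam_Q k^2)" using fam_odd[of k] by simp
  ultimately have nz: "4 * P^3 + 27 * Q^2 \<noteq> 0" by (metis even_zero of_int_eq_0_iff)
  show "elliptic_curve (fam_curve d k)" unfolding elliptic_curve_def disc using Q nz assms(1) by simp
  show "j_invariant (fam_curve d k) = - 256 * P^3 * (P^3 + 6 * Q^2)^3 / (Q^6 * (4 * P^3 + 27 * Q^2))"
  proof -
    \<comment> \<open>The factor \<open>- 16 * ?D^6\<close> is shared with the discriminant, so the
      twist does not affect \<open>j\<close>.\<close>
    have "(16 * ?D^2 * P * (P^3 + 6 * Q^2))^3 = (- 16 * ?D^6) * (- 256 * P^3 * (P^3 + 6 * Q^2)^3)"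
      by (simp add: power_mult_distrib flip: power_mult)
    moreover have "- 16 * ?D^6 \<noteq> 0" using assms(1) by simp
    ultimately show ?thesis unfolding j_invariant_def c4 disc using mult_divide_mult_cancel_left by metis
  qed
qed

text \<open>If only finitely many values occurred, some value \<open>c\<close> would be taken
  infinitely often, and the numerator minus \<open>c\<close> times the denominator would vanish
  identically as a polynomial in \<open>k\<close>.\<close>

lemma infinite_j_fam_curve:
  assumes "d \<noteq> 0" shows "infinite (range (\<lambda>k. j_invariant (fam_curve d k)))"
proof
  let ?j = "\<lambda>n :: nat. j_invariant (fam_curve d (int n))"
  assume "finite (range (\<lambda>k. j_invariant (fam_curve d k)))"
  hence "finite (range ?j)" by (rule finite_subset[rotated]) auto
  then obtain n0 where inf: "infinite {n. ?j n = ?j n0}"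
    using pigeonhole_infinite[of UNIV ?j] by auto
  define c where "c = ?j n0"
  define p q :: "rat poly" where "p = fam_P [:0, 1:]" and "q = fam_Q [:0, 1:]"
  have pq: "poly p x = fam_P x" "poly q x = fam_Q x" for x unfolding p_def q_def fam_P_def fam_Q_def by simp_all
  define r where "r = [:-256:] * p^3 * (p^3 + 6 * q^2)^3 - [:c:] * (q^6 * (4 * p^3 + 27 * q^2))"
  have r: "poly r x = - 256 * fam_P x^3 * (fam_P x^3 + 6 * fam_Q x^2)^3 - c * (fam_Q x^6 * (4 * fam_P x^3 + 27 * fam_Q x^2))" for x
    unfolding r_def by (simp add: pq)
  have "poly r (of_nat n) = 0" if "?j n = c" for n
  proof -
    have Q: "fam_Q (of_nat n :: rat) \<noteq> 0" using fam_odd(2)[of "int n"]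
      by (metis even_zero of_int_eq_0_iff of_int_fam(2) of_int_of_nat_eq)
    have "4 * fam_P (of_nat n)^3 + 27 * fam_Q (of_nat n :: rat)^2 = of_int (4 * fam_P (int n)^3 + 27 * fam_Q (int n)^2)" by simp
    moreover have "odd (4 * fam_P (int n)^3 + 27 * fam_Q (int n)^2)" using fam_odd[of "int n"] by simp
    ultimately have nz: "4 * fam_P (of_nat n)^3 + 27 * fam_Q (of_nat n :: rat)^2 \<noteq> 0" by (metis even_zero of_int_eq_0_iff)
    have "fam_Q (of_nat n)^6 * (4 * fam_P (of_nat n)^3 + 27 * fam_Q (of_nat n)^2) \<noteq> (0 :: rat)" using Q nz by simp
    from nonzero_divide_eq_eq[OF this] show ?thesis
      using that unfolding j_invariant_fam_curve(2)[OF assms] r of_int_of_nat_eq by (metis eq_iff_diff_eq_0)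
  qed
  hence "of_nat ` {n. ?j n = ?j n0} \<subseteq> {x. poly r x = 0}" unfolding c_def by blast
  moreover have "infinite (of_nat ` {n. ?j n = ?j n0} :: rat set)"
    using inf by (simp add: finite_image_iff inj_on_def)
  ultimately have "r = 0" using poly_roots_finite finite_subset by blast
  \<comment> \<open>The parameters 0 and 1 give different values of \<open>j\<close>, so no single
    \<open>c\<close> fits both equations.\<close>
  hence "poly r 0 = 0" "poly r 1 = 0" by simp_all
  thus False unfolding r fam_P_def fam_Q_def by simp
qed

section \<open>Group structure of the torsion, with the case d = 2\<close>

context curve_family
begin

lemma map_fam_curve: "map_weierstrass of_rat (fam_curve d k) = E"
  unfolding fam_curve_def A_def B_def C_def Let_def
  by (simp add: of_rat_mult of_rat_power of_rat_minus)

lemma mordell_weil_fam: "mordell_weil (fam_curve d k) K = ell_group\<lparr>carrier := pts_over K\<rparr>"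
  unfolding mordell_weil_def map_fam_curve ell_group_def pts_over_def by simp

lemma torsion_points_fam: "torsion_points (mordell_weil (fam_curve d k) K) = tors K"
  unfolding torsion_points_def tors_def mordell_weil_fam by (simp add: nat_pow_def)

lemma torsion_group_fam: "torsion_group (mordell_weil (fam_curve d k) K) = ell_group\<lparr>carrier := tors K\<rparr>"
  unfolding torsion_group_def torsion_points_fam unfolding mordell_weil_fam by simp

abbreviation "S1 \<equiv> Affine r1 0"
abbreviation "S2 \<equiv> Affine r2 0"
abbreviation "S3 \<equiv> Affine r3 0"

lemma pow_distrib: "on_curve E R \<Longrightarrow> on_curve E S \<Longrightarrow> (R \<^bold>+ S) \<^bold>^ n = R \<^bold>^ n \<^bold>+ S \<^bold>^ n"
  using G.nat_pow_distrib[of R S n] unfolding ell_group_simps by blast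

lemma pow_swap: "on_curve E R \<Longrightarrow> (R \<^bold>^ m) \<^bold>^ n = (R \<^bold>^ n) \<^bold>^ m"
  using pow_mult[of R] by (simp only: mult.commute)

lemma S_on_curve: "on_curve E S1" "on_curve E S2" "on_curve E S3"
  unfolding on_curve_split by simp_all

lemma S_pts: "S1 \<in> pts_over Q_inf_3" "S2 \<in> pts_over Q_inf_3" "S3 \<in> pts_over Q_inf_3"
  and S_double: "S1 \<^bold>^ 2 = \<O>" "S2 \<^bold>^ 2 = \<O>" "S3 \<^bold>^ 2 = \<O>"
  using two_torsion_Q_inf by blast+

text \<open>The sum is again 2-torsion, and cancellation excludes three of the four
  possibilities.\<close>

lemma S_add: "S1 \<^bold>+ S2 = S3"
proof -
  have "S1 \<^bold>+ S2 \<in> pts_over Q_inf_3" by (intro pts_over_add S_pts)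
  moreover have "(S1 \<^bold>+ S2) \<^bold>^ 2 = \<O>"
    unfolding pow_distrib[OF S_on_curve(1,2)] S_double by simp
  ultimately have "S1 \<^bold>+ S2 \<in> {\<O>, S1, S2, S3}" using two_torsion_Q_inf by blast
  moreover have "S1 \<^bold>+ S2 \<noteq> \<O>" using distinct_roots by (simp add: Let_def)
  moreover have "S1 \<^bold>+ S2 \<noteq> S1" "S1 \<^bold>+ S2 \<noteq> S2"
    using add_right_cancel[OF S_on_curve(2) _ S_on_curve(1), of \<O>] add_right_cancel[OF S_on_curve(1) _ S_on_curve(2), of \<O>]
      add_comm[OF S_on_curve(1,2)] by auto
  ultimately show ?thesis by blast
qed

lemma pow_parity: assumes "on_curve E R" "R \<^bold>^ 2 = \<O>" shows "R \<^bold>^ n = (if even n then \<O> else R)"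
proof -
  have R: "R \<in> carrier ell_group" using assms(1) by simp
  have "R \<^bold>^ n = R \<^bold>^ (n mod 2)" using G.pow_mod_eq[OF R, of 2 n] assms(2) unfolding ell_group_simps by metis
  moreover have "R \<^bold>^ 0 = \<O>" "R \<^bold>^ 1 = R" using G.nat_pow_0 G.nat_pow_eone[OF R] unfolding ell_group_simps by auto
  ultimately show ?thesis by (cases "even n") (metis even_iff_mod_2_eq_zero, metis odd_iff_mod_2_eq_one)
qed

lemma torsion_iso_d2:
  assumes "d = 2"
  shows "torsion_points (mordell_weil (fam_curve d k) \<rat>) = {\<O>}"
    "torsion_group (mordell_weil (fam_curve d k) Q_inf_3) \<cong> integer_mod_group 2 \<times>\<times> integer_mod_group 2"
proof -
  show "torsion_points (mordell_weil (fam_curve d k) \<rat>) = {\<O>}"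
    unfolding torsion_points_fam by (rule tors_d2(2)[OF assms])
  let ?f = "\<lambda>(i, j). S1 \<^bold>^ i \<^bold>+ S2 \<^bold>^ j"
  have f: "?f (i, j) = (if even i then if even j then \<O> else S2 else if even j then S1 else S3)" for i j
    unfolding split pow_parity[OF S_on_curve(1) S_double(1)] pow_parity[OF S_on_curve(2) S_double(2)]
    using S_add by (cases "even i"; cases "even j") (simp_all only: if_True if_False add_O point_add.simps(1))
  have free: "2 dvd i \<and> 2 dvd j" if "?f (i, j) = \<O>" for i j
    using that unfolding f by (auto split: if_splits)
  have "integer_mod_group 2 \<times>\<times> integer_mod_group 2
      \<cong> ell_group\<lparr>carrier := range (\<lambda>(i, j). S1 \<^bold>^ i \<otimes>\<^bsub>ell_group\<^esub> S2 \<^bold>^ j)\<rparr>"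
    by (rule G.integer_mod_group_prod_iso)
      (use S_on_curve S_double free in \<open>simp_all only: ell_group_simps mem_Collect_eq split zero_less_numeral\<close>)
  hence "integer_mod_group 2 \<times>\<times> integer_mod_group 2 \<cong> ell_group\<lparr>carrier := range ?f\<rparr>"
    unfolding ell_group_simps .
  moreover have "range ?f = {\<O>, S1, S2, S3}"
  proof (rule equalityI; rule subsetI)
    fix x assume "x \<in> range ?f"
    then obtain i j where "x = ?f (i, j)" by auto
    thus "x \<in> {\<O>, S1, S2, S3}" unfolding f by (auto split: if_splits)
  next
    fix x assume "x \<in> {\<O>, S1, S2, S3}"
    hence "x = ?f (0, 0) \<or> x = ?f (1, 0) \<or> x = ?f (0, 1) \<or> x = ?f (1, 1)" unfolding f by auto
    thus "x \<in> range ?f" by blast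
  qed
  ultimately have "integer_mod_group 2 \<times>\<times> integer_mod_group 2 \<cong> torsion_group (mordell_weil (fam_curve d k) Q_inf_3)"
    unfolding torsion_group_fam tors_d2(1)[OF assms] two_torsion_Q_inf by simp
  thus "torsion_group (mordell_weil (fam_curve d k) Q_inf_3) \<cong> integer_mod_group 2 \<times>\<times> integer_mod_group 2"
    by (rule group.iso_sym[OF DirProd_group[OF group_integer_mod_group group_integer_mod_group]])
qed

text \<open>
  If $y = l x + m$ meets the curve in three points, then the product of the values of
  $y - (P x - Q^2)$ at these points is a cube. As the value is $2 Q^2$ at \<open>- T\<close>,
  the point \<open>T\<close> is not divisible by 3.
\<close>

lemma on_line_cube:
  assumes "d = 1" and "on_line A B C l m (a1, b1) (a2, b2) (a3, b3)"
  shows "(b1 - (P * a1 - Q^2)) * (b2 - (P * a2 - Q^2)) * (b3 - (P * a3 - Q^2)) = (m + Q^2)^3"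
proof -
  have e: "a1 + a2 + a3 = l^2 - P^2" "a1 * a2 + a1 * a3 + a2 * a3 = - 2 * P * Q^2 - 2 * l * m"
    "a1 * a2 * a3 = m^2 - Q^4" and b: "b1 = l * a1 + m" "b2 = l * a2 + m" "b3 = l * a3 + m"
    using assms unfolding on_line_def A_def B_def C_def by auto
  \<comment> \<open>Each factor is \<open>(l - P) * a_i + (m + Q^2)\<close>. All terms but the last
    cancel because \<open>y - (P x - Q^2)\<close> vanishes to third order at \<open>T\<close> and
    nowhere else on the affine curve.\<close>
  have "(b1 - (P * a1 - Q^2)) * (b2 - (P * a2 - Q^2)) * (b3 - (P * a3 - Q^2))
      = (l - P)^3 * (a1 * a2 * a3) + (l - P)^2 * (m + Q^2) * (a1 * a2 + a1 * a3 + a2 * a3)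
        + (l - P) * (m + Q^2)^2 * (a1 + a2 + a3) + (m + Q^2)^3"
    unfolding b by (simp add: algebra_simps power2_eq_square power3_eq_cube)
  also have "\<dots> = (m + Q^2)^3"
    unfolding e by (simp add: algebra_simps power2_eq_square power3_eq_cube power4_eq_xxxx)
  finally show ?thesis .
qed

text \<open>The sign puts \<open>T\<close> on its flex tangent \<open>y = P x - Q^2\<close>; at
  \<open>- T\<close> the function \<open>y - (P x - Q^2)\<close> then takes the nonzero value
  \<open>2 Q^2\<close>.\<close>

definition T :: "complex point" where "T = Affine 0 (- (Q^2))"

lemma T_neg: "point_neg T = Affine 0 (Q^2)" unfolding T_def by simp

section \<open>The case d = 1: points of order 3 and 6\<close>

context
  assumes d1: "d = 1"
begin

lemma T_on_curve: "on_curve E T" unfolding T_def curve_eq using d1 by simp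

lemma T_pts: "T \<in> pts_over \<rat>" "T \<in> pts_over Q_inf_3"
proof -
  have "Q \<in> \<rat>" unfolding of_int_eq_simps by (rule Rats_of_int)
  thus "T \<in> pts_over \<rat>" using T_on_curve unfolding pts_over_def by (simp add: T_def del: on_curve.simps)
  thus "T \<in> pts_over Q_inf_3" using Rats_subset_Q_inf unfolding pts_over_def by blast
qed

lemma T_double: "T \<^bold>+ T = point_neg T"
proof -
  have y: "- (Q^2) \<noteq> 0" using Q_nonzero by simp
  obtain l x2 y2 where D: "T \<^bold>+ T = Affine x2 y2" and l: "l * (2 * - (Q^2)) = 3 * 0^2 + 2 * A * 0 + B"
    and x2: "x2 = l^2 - A - 2 * 0" and y2: "y2 = - (l * (x2 - 0) + - (Q^2))"
    unfolding T_def by (rule double_affine[OF y])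
  have "l * (2 * - (Q^2)) = P * (2 * - (Q^2))" unfolding l B_def using d1 by simp
  hence "l = P" using y by (metis mult_right_cancel mult_eq_0_iff zero_neq_numeral)
  moreover have "A = P^2" unfolding A_def using d1 by simp
  ultimately show ?thesis unfolding D T_neg using x2 y2 by simp
qed

lemma T_pow: "T \<^bold>^ 2 = point_neg T" "T \<^bold>^ 3 = \<O>"
  using pow_2[OF T_on_curve] pow_3[OF T_on_curve] T_double add_neg[of "point_neg T"] by simp_all

lemma T_pow_eq_O: assumes "T \<^bold>^ n = \<O>" shows "3 dvd n"
proof (rule ccontr)
  assume "\<not> 3 dvd n"
  hence "n mod 3 = 1 \<or> n mod 3 = 2" by presburger
  moreover have "T \<in> carrier ell_group" using T_on_curve by simp
  hence "T \<^bold>^ (n mod 3) = \<O>" "T \<^bold>^ 1 = T"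
    using G.pow_mod_eq[of T 3 n] G.nat_pow_eone[of T] T_pow(2) assms unfolding ell_group_simps by metis+
  ultimately show False using T_pow(1) by (auto simp: T_def)
qed

lemma three_torsion:
  assumes R: "R \<in> pts_over Q_inf_3" "R \<^bold>^ 3 = \<O>" shows "R \<in> {\<O>, T, point_neg T}"
proof (cases R)
  case (Affine x y)
  have xy: "x \<in> \<real>" "y \<in> \<real>" and on: "on_curve E (Affine x y)"
    using R(1) unfolding Affine pts_over_def by (auto simp: Q_inf_3_iff)
  have "x = 0" using real_3_torsion[OF on xy] R(2) Affine by simp
  hence "y^2 = (Q^2)^2" using on d1 unfolding curve_eq by simp
  hence "y = Q^2 \<or> y = - (Q^2)" by (simp only: power2_eq_iff)
  thus ?thesis unfolding Affine T_neg unfolding T_def using \<open>x = 0\<close> by blast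
qed simp

lemma zero_x_torsion: assumes "on_curve E (Affine 0 y)" shows "Affine 0 y \<^bold>^ 3 = \<O>"
proof -
  have "y^2 = (Q^2)^2" using assms d1 unfolding curve_eq by simp
  hence "y = Q^2 \<or> y = - (Q^2)" by (simp only: power2_eq_iff)
  hence "Affine 0 y = T \<or> Affine 0 y = point_neg T" unfolding T_neg unfolding T_def by blast
  moreover have "point_neg T \<^bold>^ 3 = \<O>"
    unfolding T_pow(1)[symmetric] pow_mult[OF T_on_curve] using pow_mult[OF T_on_curve, of 3 2] T_pow(2) by simp
  ultimately show ?thesis using T_pow(2) by metis
qed

text \<open>The tangent at \<open>R\<close> and the chord through \<open>2 R\<close> and
  \<open>R\<close> give two cubes by \<open>on_line_cube\<close>. In their product the values
  \<open>g\<close> and \<open>g'\<close> at \<open>2 R\<close> and \<open>- 2 R\<close> multiply to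
  \<open>- xs^3\<close>, and \<open>f\<close> occurs to the third power, so \<open>2 Q^2\<close>
  itself becomes a cube in \<open>Q_zeta_3_inf\<close>.\<close>

lemma T_not_divisible:
  assumes R: "R \<in> pts_over Q_inf_3" shows "R \<^bold>^ 3 \<noteq> T"
proof
  assume R3: "R \<^bold>^ 3 = T"
  have on: "on_curve E R" by (rule pts_over_on_curve[OF R])
  have T0: "T \<noteq> \<O>" "T \<^bold>^ 2 \<noteq> \<O>" using T_pow(1) by (auto simp: T_def)
  obtain x1 y1 where Rxy: "R = Affine x1 y1"
    using R3 T0 by (cases R) auto
  have xy: "x1 \<in> Q_zeta_3_inf" "y1 \<in> Q_zeta_3_inf" using R unfolding Rxy pts_over_def by (auto simp: Q_inf_3_iff)
  have x10: "x1 \<noteq> 0" using zero_x_torsion[of y1] on R3 T0 unfolding Rxy by auto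
  have RRR: "(R \<^bold>+ R) \<^bold>+ R = T" using R3 pow_3[OF on] by simp
  have "y1 \<noteq> 0"
  proof
    assume "y1 = 0"
    hence "R \<^bold>+ R = \<O>" unfolding Rxy by simp
    hence "R = T" using RRR by simp
    thus False using \<open>R \<^bold>+ R = \<O>\<close> T_double T0 by (simp add: T_def)
  qed
  hence ne1: "\<not> (x1 = x1 \<and> y1 + y1 = 0)" by simp
  obtain xs ys' where c1: "collinear A B C (x1, y1) (x1, y1) (xs, ys')"
    using collinear_exists[OF on[unfolded Rxy] on[unfolded Rxy] ne1] by blast
  define ys where "ys = - ys'"
  have S: "R \<^bold>+ R = Affine xs ys" unfolding Rxy ys_def by (rule add_eq_of_collinear[OF c1 ne1])
  have SS: "R \<^bold>+ R \<in> pts_over Q_inf_3" by (rule pts_over_add[OF R R])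
  hence Son: "on_curve E (Affine xs ys)" and xys: "xs \<in> Q_zeta_3_inf" "ys \<in> Q_zeta_3_inf"
    unfolding S pts_over_def by (auto simp: Q_inf_3_iff simp del: on_curve.simps)
  have xs0: "xs \<noteq> 0"
  proof
    assume "xs = 0"
    hence "(R \<^bold>^ 2) \<^bold>^ 3 = \<O>" using zero_x_torsion Son S pow_2[OF on] by simp
    hence "(R \<^bold>^ 3) \<^bold>^ 2 = \<O>" unfolding pow_mult[OF on] by (simp add: mult.commute)
    thus False using R3 T0 by simp
  qed
  \<comment> \<open>So the second line is a genuine chord, with slope in the field.\<close>
  have x_ne: "xs \<noteq> x1"
  proof
    assume e: "xs = x1"
    have "ys^2 = y1^2" using Son on unfolding Rxy e on_curve_iff by simp
    hence "ys = y1 \<or> ys = - y1" by (simp add: power2_eq_iff)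
    thus False
    proof
      assume "ys = y1"
      hence "R \<^bold>+ R = \<O> \<^bold>+ R" using S Rxy e by simp
      hence "R = \<O>" using add_right_cancel[OF on _ on, of \<O>] by simp
      thus False using Rxy by simp
    next
      assume "ys = - y1"
      hence "R \<^bold>+ R = point_neg R" using S Rxy e by simp
      hence "(R \<^bold>+ R) \<^bold>+ R = \<O>" using add_neg[of "point_neg R"] by simp
      thus False using RRR T0 by simp
    qed
  qed
  hence ne2: "\<not> (xs = x1 \<and> ys + y1 = 0)" by simp
  obtain x4 y4 where c2: "collinear A B C (xs, ys) (x1, y1) (x4, y4)"
    using collinear_exists[OF Son on[unfolded Rxy] ne2] by blast
  have "Affine x4 (- y4) = T" using add_eq_of_collinear[OF c2 ne2] RRR S Rxy by simp
  hence x4: "x4 = 0" "y4 = Q^2" unfolding T_def by auto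
  obtain l1 m1 where l1: "on_line A B C l1 m1 (x1, y1) (x1, y1) (xs, ys')" using c1 unfolding collinear_def by blast
  obtain l2 m2 where l2: "on_line A B C l2 m2 (xs, ys) (x1, y1) (x4, y4)" using c2 unfolding collinear_def by blast
  have "l1 * (2 * y1) = 3 * x1^2 + 2 * A * x1 + B"
  proof -
    have e: "A = l1^2 - x1 - x1 - xs" "B = x1 * x1 + x1 * xs + x1 * xs + 2 * l1 * m1" "y1 = l1 * x1 + m1"
      using l1 unfolding on_line_def by (auto simp: algebra_simps)
    show ?thesis unfolding e by (simp add: algebra_simps power2_eq_square)
  qed
  hence "l1 = (3 * x1^2 + 2 * A * x1 + B) / (2 * y1)" using \<open>y1 \<noteq> 0\<close> by (simp add: eq_divide_eq)
  hence l1z: "l1 \<in> Q_zeta_3_inf" using xy PQ_in_Q_zeta by (simp add: Q_zeta_simps)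
  have "l2 * (xs - x1) = ys - y1" using l2 unfolding on_line_def by (auto simp: algebra_simps)
  hence "l2 = (ys - y1) / (xs - x1)" using x_ne by (simp add: eq_divide_eq)
  hence l2z: "l2 \<in> Q_zeta_3_inf" using xy xys by (simp add: Q_zeta_simps)
  have "y1 = l1 * x1 + m1" "y1 = l2 * x1 + m2" using l1 l2 unfolding on_line_def by auto
  hence "m1 = y1 - l1 * x1" "m2 = y1 - l2 * x1" by (metis add_diff_cancel_left')+
  hence mz: "m1 \<in> Q_zeta_3_inf" "m2 \<in> Q_zeta_3_inf" using xy l1z l2z by (simp_all add: Q_zeta_simps)
  define f where "f = y1 - (P * x1 - Q^2)"
  define g where "g = ys - (P * xs - Q^2)"
  define g' where "g' = ys' - (P * xs - Q^2)"
  have F1: "f * f * g' = (m1 + Q^2)^3" using on_line_cube[OF d1 l1] unfolding f_def g'_def .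
  have F2: "g * f * (2 * Q^2) = (m2 + Q^2)^3" using on_line_cube[OF d1 l2] unfolding f_def g_def x4 by simp
  have "g * g' = - (ys^2 - (P * xs - Q^2)^2)" unfolding g_def g'_def ys_def by (simp add: algebra_simps power2_eq_square)
  also have "ys^2 = xs^3 + (P * xs - Q^2)^2" using Son d1 unfolding curve_eq by simp
  finally have gg: "g * g' = - (xs^3)" by simp
  have f0: "f \<noteq> 0"
  proof
    assume "f = 0"
    hence "y1^2 = (P * x1 - Q^2)^2" unfolding f_def by simp
    moreover have "y1^2 = x1^3 + (P * x1 - Q^2)^2" using on d1 unfolding Rxy curve_eq by simp
    ultimately show False using x10 by simp
  qed
  define z where "z = (m1 + Q^2) * (m2 + Q^2) / (- (f * xs))"
  have "((m1 + Q^2) * (m2 + Q^2))^3 = (f * f * g') * (g * f * (2 * Q^2))"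
    unfolding F1 F2 by (simp add: power_mult_distrib)
  also have "\<dots> = f^3 * (g * g') * (2 * Q^2)" by (simp add: power3_eq_cube mult_ac)
  also have "\<dots> = (- (f * xs))^3 * (2 * Q^2)" unfolding gg by (simp add: power3_eq_cube mult_ac)
  finally have "z^3 = 2 * Q^2" unfolding z_def power_divide using f0 xs0 by simp
  hence "z^3 = of_int (2 * (fam_Q k)^2)" by simp
  moreover have "z \<in> Q_zeta_3_inf" unfolding z_def f_def using mz xy xys PQ_in_Q_zeta by (simp add: Q_zeta_simps)
  moreover have "2 * (fam_Q k)^2 mod 4 = 2"
  proof -
    obtain q where "fam_Q k = 2 * q + 1" using fam_odd(2)[of k] by (elim oddE)
    hence "2 * (fam_Q k)^2 = 4 * (2 * q^2 + 2 * q) + 2" by (simp add: power2_eq_square algebra_simps)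
    thus ?thesis by presburger
  qed
  ultimately show False using Q_zeta_power_neq_2_mod_4[of z 3 "2 * (fam_Q k)^2"] by simp
qed

text \<open>If \<open>3^b R\<close> were a nonzero 3-torsion point with \<open>b > 0\<close>, then
  \<open>T\<close> would be divisible by 3, against \<open>T_not_divisible\<close>.\<close>

lemma power_3_torsion:
  assumes R: "R \<in> pts_over Q_inf_3" and b: "R \<^bold>^ (3 ^ b) = \<O>" shows "R \<^bold>^ 3 = \<O>"
  using b
proof (induction b)
  case 0
  hence "R = \<O>" using pts_over_on_curve[OF R] by (simp del: on_curve.simps(2))
  thus ?case by simp
next
  case (Suc b)
  note on = pts_over_on_curve[OF R]
  have Rb: "R \<^bold>^ (3 ^ b) \<in> pts_over Q_inf_3" by (rule pts_over_pow[OF R])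
  have "(R \<^bold>^ (3 ^ b)) \<^bold>^ 3 = \<O>" using Suc.prems unfolding pow_mult[OF on] power_Suc2 .
  from three_torsion[OF Rb this] consider "R \<^bold>^ (3 ^ b) = \<O>" | "R \<^bold>^ (3 ^ b) = T" | "R \<^bold>^ (3 ^ b) = point_neg T" by blast
  thus ?case
  proof cases
    case 1 thus ?thesis by (rule Suc.IH)
  next
    case 2
    show ?thesis
    proof (cases b)
      case 0 thus ?thesis using 2 T_pow(2) R on by (simp del: on_curve.simps(2))
    next
      case (Suc c)
      have "(R \<^bold>^ (3 ^ c)) \<^bold>^ 3 = T" using 2 unfolding Suc pow_mult[OF on] power_Suc2 .
      thus ?thesis using T_not_divisible[OF pts_over_pow[OF R]] by blast
    qed
  next
    case 3
    \<comment> \<open>Doubling turns \<open>- T\<close> into \<open>T\<close>, so \<open>2 R\<close>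
      takes the place of \<open>R\<close>.\<close>
    have "(R \<^bold>^ (3 ^ b)) \<^bold>^ 2 = T"
      unfolding 3 T_pow(1)[symmetric] pow_mult[OF T_on_curve]
      using pow_add[OF T_on_curve, of 3 1] T_pow(2) G.nat_pow_eone[of T] T_on_curve by (simp del: on_curve.simps(2))
    hence T2: "(R \<^bold>^ 2) \<^bold>^ (3 ^ b) = T" unfolding pow_mult[OF on] by (simp only: mult.commute)
    show ?thesis
    proof (cases b)
      case 0
      have "R = point_neg T" using 3 0 on by (simp del: on_curve.simps(2))
      thus ?thesis using zero_x_torsion on T_neg by metis
    next
      case (Suc c)
      have R2: "R \<^bold>^ 2 \<in> pts_over Q_inf_3" by (rule pts_over_pow[OF R])
      have "((R \<^bold>^ 2) \<^bold>^ (3 ^ c)) \<^bold>^ 3 = T" using T2 unfolding Suc pow_mult[OF pts_over_on_curve[OF R2]] power_Suc2 .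
      thus ?thesis using T_not_divisible[OF pts_over_pow[OF R2]] by blast
    qed
  qed
qed

lemma tors_d1: "tors Q_inf_3 = {R \<in> pts_over Q_inf_3. R \<^bold>^ 6 = \<O>}"
proof -
  have "R \<^bold>^ 6 = \<O>" if R: "R \<in> pts_over Q_inf_3" "n > 0" "R \<^bold>^ n = \<O>" for R n
  proof -
    obtain b where "(R \<^bold>^ 2) \<^bold>^ (3 ^ b) = \<O>" using torsion_over_Q_inf[OF R] by blast
    hence "(R \<^bold>^ 2) \<^bold>^ 3 = \<O>" by (rule power_3_torsion[OF pts_over_pow[OF R(1)]])
    thus ?thesis unfolding pow_mult[OF pts_over_on_curve[OF R(1)]] by simp
  qed
  moreover have "\<exists>n>0. R \<^bold>^ n = \<O>" if "R \<^bold>^ 6 = \<O>" for R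
    using that by (rule exI[of _ 6, OF conjI, rotated]) simp
  ultimately show ?thesis unfolding tors_def by blast
qed

lemma tors_Rats_d1: "tors \<rat> = range (\<lambda>i. T \<^bold>^ i)"
proof (rule equalityI; rule subsetI)
  fix R assume R: "R \<in> tors \<rat>"
  hence RQ: "R \<in> pts_over \<rat>" and on: "on_curve E R" unfolding tors_def pts_over_def by auto
  have R': "R \<in> pts_over Q_inf_3" "R \<^bold>^ 6 = \<O>" using tors_mono[OF R] unfolding tors_d1 by auto
  have "(R \<^bold>^ 3) \<^bold>^ 2 = \<O>" using R'(2) unfolding pow_mult[OF on] by simp
  hence "R \<^bold>^ 3 = \<O>" by (rule two_torsion_Rats[OF pts_over_Rats_pow[OF RQ]])
  hence "R = \<O> \<or> R = T \<or> R = T \<^bold>^ 2" using three_torsion[OF R'(1)] T_pow(1) by auto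
  moreover have "T \<^bold>^ 0 = \<O>" "T \<^bold>^ 1 = T" using G.nat_pow_0 G.nat_pow_eone[of T] T_on_curve by auto
  ultimately show "R \<in> range (\<lambda>i. T \<^bold>^ i)" by (metis rangeI)
next
  fix R assume "R \<in> range (\<lambda>i. T \<^bold>^ i)"
  then obtain i where i: "R = T \<^bold>^ i" by blast
  have "R \<^bold>^ 3 = (T \<^bold>^ 3) \<^bold>^ i" unfolding i pow_mult[OF T_on_curve] by (simp only: mult.commute)
  hence "R \<^bold>^ 3 = \<O>" using T_pow(2) by simp
  moreover have "R \<in> pts_over \<rat>" unfolding i by (rule pts_over_Rats_pow[OF T_pts(1)])
  ultimately show "R \<in> tors \<rat>" unfolding tors_def by (auto intro!: exI[of _ 3])
qed

text \<open>A point of order 6, whose multiples \<open>3 W = S2\<close> and \<open>4 W = T\<close>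
  recover both summands; with \<open>S1\<close> it generates the torsion.\<close>

definition W :: "complex point" where "W = S2 \<^bold>+ T"

lemma W_on_curve: "on_curve E W" unfolding W_def by (intro add_on_curve S_on_curve T_on_curve)

lemma W_pow: "W \<^bold>^ n = S2 \<^bold>^ n \<^bold>+ T \<^bold>^ n"
  unfolding W_def by (rule pow_distrib[OF S_on_curve(2) T_on_curve])

lemma W_pow_values: "W \<^bold>^ 3 = S2" "W \<^bold>^ 4 = T" "W \<^bold>^ 6 = \<O>"
proof -
  have T4: "T \<^bold>^ 4 = T" "T \<^bold>^ 6 = \<O>"
    using pow_add[OF T_on_curve, of 3 1] pow_add[OF T_on_curve, of 3 3] T_pow(2) G.nat_pow_eone[of T] T_on_curve
    by (simp_all del: on_curve.simps(2))
  show "W \<^bold>^ 3 = S2" "W \<^bold>^ 4 = T" "W \<^bold>^ 6 = \<O>"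
    unfolding W_pow pow_parity[OF S_on_curve(2) S_double(2)] T4 T_pow(2) by simp_all
qed

text \<open>Multiplying the relation by 4 leaves only a multiple of \<open>T\<close>; multiplying by
  3 leaves a relation between \<open>S1\<close> and \<open>S2\<close>.\<close>

lemma S1_W_free: assumes "S1 \<^bold>^ i \<^bold>+ W \<^bold>^ j = \<O>" shows "2 dvd i \<and> 6 dvd j"
proof -
  have on: "on_curve E (S1 \<^bold>^ i)" "on_curve E (W \<^bold>^ j)" by (intro pow_on_curve S_on_curve W_on_curve)+
  have dist: "(S1 \<^bold>^ i \<^bold>+ W \<^bold>^ j) \<^bold>^ n = (S1 \<^bold>^ n) \<^bold>^ i \<^bold>+ (W \<^bold>^ n) \<^bold>^ j" for n
    unfolding pow_distrib[OF on] pow_swap[OF S_on_curve(1), of i] pow_swap[OF W_on_curve, of j] ..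
  have "(W \<^bold>^ 4) \<^bold>^ j = \<O>"
    using dist[of 4] assms pow_parity[OF S_on_curve(1) S_double(1), of 4] by simp
  hence j3: "3 dvd j" unfolding W_pow_values by (rule T_pow_eq_O)
  have "S1 \<^bold>^ 3 = S1" using pow_parity[OF S_on_curve(1) S_double(1), of 3] by simp
  hence "S1 \<^bold>^ i \<^bold>+ S2 \<^bold>^ j = \<O>" using dist[of 3] assms W_pow_values(1) by simp
  hence "even i \<and> even j"
    unfolding pow_parity[OF S_on_curve(1) S_double(1)] pow_parity[OF S_on_curve(2) S_double(2)]
    using S_add by (cases "even i"; cases "even j") (simp_all only: if_True if_False add_O point_add.simps(1) point.distinct)
  thus ?thesis using j3 by presburger
qed

text \<open>\<open>R = 7 R = 3 R + 4 R\<close> splits \<open>R\<close> into a 2-torsion and a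
  3-torsion part; the multiples of \<open>S2\<close> and \<open>T\<close> in these parts combine
  into a single multiple of \<open>W\<close>.\<close>

lemma six_torsion: "{R \<in> pts_over Q_inf_3. R \<^bold>^ 6 = \<O>} = range (\<lambda>(i, j). S1 \<^bold>^ i \<^bold>+ W \<^bold>^ j)"
proof (rule equalityI; rule subsetI)
  fix R assume "R \<in> {R \<in> pts_over Q_inf_3. R \<^bold>^ 6 = \<O>}"
  hence R: "R \<in> pts_over Q_inf_3" "R \<^bold>^ 6 = \<O>" by auto
  note on = pts_over_on_curve[OF R(1)]
  have "(R \<^bold>^ 3) \<^bold>^ 2 = R \<^bold>^ 6" "(R \<^bold>^ 4) \<^bold>^ 3 = (R \<^bold>^ 6) \<^bold>^ 2" unfolding pow_mult[OF on] by simp_all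
  hence "(R \<^bold>^ 3) \<^bold>^ 2 = \<O>" "(R \<^bold>^ 4) \<^bold>^ 3 = \<O>" unfolding R(2) by simp_all
  hence "R \<^bold>^ 3 \<in> {\<O>, S1, S2, S3}" and R4: "R \<^bold>^ 4 \<in> {\<O>, T, point_neg T}"
    using two_torsion_Q_inf pts_over_pow[OF R(1)] three_torsion by blast+
  moreover have "S1 \<^bold>^ 0 \<^bold>+ S2 \<^bold>^ 0 = \<O>" "S1 \<^bold>^ 1 \<^bold>+ S2 \<^bold>^ 0 = S1" "S1 \<^bold>^ 0 \<^bold>+ S2 \<^bold>^ 1 = S2" "S1 \<^bold>^ 1 \<^bold>+ S2 \<^bold>^ 1 = S3"
    unfolding pow_parity[OF S_on_curve(1) S_double(1)] pow_parity[OF S_on_curve(2) S_double(2)]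
    using S_add by (simp_all only: even_zero odd_one if_True if_False add_O point_add.simps(1))
  ultimately obtain i h where h: "R \<^bold>^ 3 = S1 \<^bold>^ i \<^bold>+ S2 \<^bold>^ h" by (metis insertE singletonD)
  have "T \<^bold>^ 0 = \<O>" "T \<^bold>^ 1 = T" using G.nat_pow_0 G.nat_pow_eone[of T] T_on_curve by auto
  then obtain j where j: "R \<^bold>^ 4 = T \<^bold>^ j" using R4 T_pow(1) by (metis insertE singletonD)
  have onp: "on_curve E (S1 \<^bold>^ i)" "on_curve E (S2 \<^bold>^ h)" "on_curve E (T \<^bold>^ j)"
    by (intro pow_on_curve S_on_curve T_on_curve)+
  have "R = R \<^bold>^ 7" using pow_add[OF on, of 6 1] R(2) G.nat_pow_eone[of R] on by simp
  also have "\<dots> = R \<^bold>^ 3 \<^bold>+ R \<^bold>^ 4" using pow_add[OF on, of 3 4] by simp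
  also have "\<dots> = S1 \<^bold>^ i \<^bold>+ (S2 \<^bold>^ h \<^bold>+ T \<^bold>^ j)" unfolding h j by (rule add_assoc[OF onp])
  also have "S2 \<^bold>^ h \<^bold>+ T \<^bold>^ j = W \<^bold>^ (3 * h + 4 * j)"
    unfolding pow_add[OF W_on_curve] pow_mult[OF W_on_curve, symmetric] W_pow_values ..
  finally show "R \<in> range (\<lambda>(i, j). S1 \<^bold>^ i \<^bold>+ W \<^bold>^ j)" by auto
next
  fix R assume "R \<in> range (\<lambda>(i, j). S1 \<^bold>^ i \<^bold>+ W \<^bold>^ j)"
  then obtain i j where Rij: "R = S1 \<^bold>^ i \<^bold>+ W \<^bold>^ j" by auto
  have "W \<in> pts_over Q_inf_3" unfolding W_def by (intro pts_over_add S_pts T_pts)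
  hence "R \<in> pts_over Q_inf_3" unfolding Rij by (intro pts_over_add pts_over_pow S_pts)
  moreover have "R \<^bold>^ 6 = (S1 \<^bold>^ 6) \<^bold>^ i \<^bold>+ (W \<^bold>^ 6) \<^bold>^ j"
    unfolding Rij pow_distrib[OF pow_on_curve[OF S_on_curve(1)] pow_on_curve[OF W_on_curve]]
      pow_swap[OF S_on_curve(1), of i] pow_swap[OF W_on_curve, of j] ..
  hence "R \<^bold>^ 6 = \<O>" unfolding W_pow_values pow_parity[OF S_on_curve(1) S_double(1), of 6] by simp
  ultimately show "R \<in> {R \<in> pts_over Q_inf_3. R \<^bold>^ 6 = \<O>}" by blast
qed

lemma torsion_iso_d1:
  "torsion_group (mordell_weil (fam_curve d k) \<rat>) \<cong> integer_mod_group 3"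
  "torsion_group (mordell_weil (fam_curve d k) Q_inf_3) \<cong> integer_mod_group 2 \<times>\<times> integer_mod_group 6"
proof -
  have "integer_mod_group 3 \<cong> ell_group\<lparr>carrier := range (\<lambda>i. T \<^bold>^ i)\<rparr>"
    by (rule G.integer_mod_group_iso)
      (use T_on_curve T_pow(2) T_pow_eq_O in \<open>simp_all only: ell_group_simps mem_Collect_eq zero_less_numeral\<close>)
  hence "integer_mod_group 3 \<cong> torsion_group (mordell_weil (fam_curve d k) \<rat>)"
    unfolding torsion_group_fam tors_Rats_d1 .
  thus "torsion_group (mordell_weil (fam_curve d k) \<rat>) \<cong> integer_mod_group 3"
    by (rule group.iso_sym[OF group_integer_mod_group])
  have "integer_mod_group 2 \<times>\<times> integer_mod_group 6
      \<cong> ell_group\<lparr>carrier := range (\<lambda>(i, j). S1 \<^bold>^ i \<otimes>\<^bsub>ell_group\<^esub> W \<^bold>^ j)\<rparr>"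
    by (rule G.integer_mod_group_prod_iso)
      (use S_on_curve S_double W_on_curve W_pow_values S1_W_free in
        \<open>simp_all only: ell_group_simps mem_Collect_eq zero_less_numeral\<close>)
  hence "integer_mod_group 2 \<times>\<times> integer_mod_group 6 \<cong> torsion_group (mordell_weil (fam_curve d k) Q_inf_3)"
    unfolding torsion_group_fam tors_d1 six_torsion ell_group_simps .
  thus "torsion_group (mordell_weil (fam_curve d k) Q_inf_3) \<cong> integer_mod_group 2 \<times>\<times> integer_mod_group 6"
    by (rule group.iso_sym[OF DirProd_group[OF group_integer_mod_group group_integer_mod_group]])
qed

end

end

section \<open>Existence of theta and conclusion\<close>

lemma theta_exists: "\<exists>t \<in> Q_inf_3. t^3 = 3 * t - 1"
proof
  let ?z = "cyclo 2"
  \<comment> \<open>With \<open>?z\<close> a primitive ninth root of unity, the cube of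
    \<open>?t\<close> is \<open>3 * ?t\<close> plus the sum of the two primitive cube roots of
    unity, which is -1.\<close>
  let ?t = "?z + inverse ?z"
  have z0: "?z \<noteq> 0" unfolding cyclo_def by simp
  have z3: "?z ^ 3 = cyclo 1" using cyclo_Suc[of 1] by (simp add: numeral_2_eq_2)
  have w0: "cyclo 1 \<noteq> 0" unfolding cyclo_def by simp
  have "cyclo 1 * (cyclo 1 + inverse (cyclo 1) + 1) = 1 + cyclo 1 + cyclo 1 ^ 2"
    using w0 by (simp add: algebra_simps power2_eq_square)
  hence w: "cyclo 1 + inverse (cyclo 1) = - 1" using cyclo_1 w0 by (simp add: eq_neg_iff_add_eq_0)
  have "(x + y)^3 = x^3 + y^3 + 3 * (x * y) * (x + y)" for x y :: complex
    by (simp add: algebra_simps power3_eq_cube)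
  hence "?t ^ 3 = ?z ^ 3 + inverse ?z ^ 3 + 3 * (?z * inverse ?z) * ?t" .
  hence "?t ^ 3 = ?z ^ 3 + inverse (?z ^ 3) + 3 * ?t" using z0 by (simp add: power_inverse)
  thus "?t ^ 3 = 3 * ?t - 1" unfolding z3 w by simp
  have "?z ^ 3 ^ 2 = 1" by (rule cyclo_power)
  hence "?z \<in> Q_zeta_3_inf" by (rule Q_zeta_closed)
  moreover have "?t \<in> \<real>" unfolding cyclo_def by (simp add: complex_is_Real_iff cis_inverse)
  ultimately show "?t \<in> Q_inf_3" unfolding Q_inf_3_iff by (simp add: Q_zeta_simps)
qed

theorem corollary6p5:
  shows "infinite {j::rat. \<exists>E::rat weierstrass.
            elliptic_curve E \<and> j_invariant E = j \<and>
            torsion_points (mordell_weil E \<rat>) = {\<O>} \<and>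
            torsion_group (mordell_weil E Q_inf_3)
              \<cong> integer_mod_group 2 \<times>\<times> integer_mod_group 2}
       \<and> infinite {j::rat. \<exists>E::rat weierstrass.
            elliptic_curve E \<and> j_invariant E = j \<and>
            torsion_group (mordell_weil E \<rat>) \<cong> integer_mod_group 3 \<and>
            torsion_group (mordell_weil E Q_inf_3)
              \<cong> integer_mod_group 2 \<times>\<times> integer_mod_group 6}"
proof -
  obtain t where t: "t \<in> Q_inf_3" "t^3 = 3 * t - 1" using theta_exists by blast
  have fam: "curve_family d t" if "d = 1 \<or> d = 2" for d by (rule curve_family.intro[OF that t(2,1)])
  show ?thesis
  proof (intro conjI; rule infinite_super)
    show "infinite (range (\<lambda>k. j_invariant (fam_curve 2 k)))" "infinite (range (\<lambda>k. j_invariant (fam_curve 1 k)))"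
      by (rule infinite_j_fam_curve; simp)+
    show "range (\<lambda>k. j_invariant (fam_curve 2 k)) \<subseteq> {j. \<exists>E. elliptic_curve E \<and> j_invariant E = j \<and>
        torsion_points (mordell_weil E \<rat>) = {\<O>} \<and>
        torsion_group (mordell_weil E Q_inf_3) \<cong> integer_mod_group 2 \<times>\<times> integer_mod_group 2}"
    proof (rule image_subsetI, rule CollectI, intro exI conjI)
      fix k
      show "elliptic_curve (fam_curve 2 k)" by (rule j_invariant_fam_curve) simp
      show "torsion_points (mordell_weil (fam_curve 2 k) \<rat>) = {\<O>}"
        "torsion_group (mordell_weil (fam_curve 2 k) Q_inf_3) \<cong> integer_mod_group 2 \<times>\<times> integer_mod_group 2"
        by (rule curve_family.torsion_iso_d2[OF fam]; simp)+
    qed (rule refl)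
    show "range (\<lambda>k. j_invariant (fam_curve 1 k)) \<subseteq> {j. \<exists>E. elliptic_curve E \<and> j_invariant E = j \<and>
        torsion_group (mordell_weil E \<rat>) \<cong> integer_mod_group 3 \<and>
        torsion_group (mordell_weil E Q_inf_3) \<cong> integer_mod_group 2 \<times>\<times> integer_mod_group 6}"
    proof (rule image_subsetI, rule CollectI, intro exI conjI)
      fix k
      show "elliptic_curve (fam_curve 1 k)" by (rule j_invariant_fam_curve) simp
      show "torsion_group (mordell_weil (fam_curve 1 k) \<rat>) \<cong> integer_mod_group 3"
        "torsion_group (mordell_weil (fam_curve 1 k) Q_inf_3) \<cong> integer_mod_group 2 \<times>\<times> integer_mod_group 6"
        by (rule curve_family.torsion_iso_d1[OF fam]; simp)+
    qed (rule refl)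
  qed
qed

end
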